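(* Let $f\in L^2(\Omega)$ and, for $\epsilon,\delta>0$, let $u^{\delta,\epsilon}=u^{\epsilon,\delta}$ be the solution of $$f(x)=\frac{C}{\delta^{N+2}}\int_{\mathbb{R}^N}J\left(\frac{x-y}{\delta}\right)(u^{\epsilon,\delta}(y)-u^{\epsilon,\delta}(x))\,dy,\quad x\in\Omega^\epsilon,\qquad u^{\epsilon,\delta}(x)\equiv0,\quad x\in\mathbb{R}^N\setminus\Omega^\epsilon.$$ Let $b^\epsilon=C_0\,\epsilon$ with a constant $C_0>0$, and let $w$ be given by: the solution of $\Delta w=f$ in $\Omega$ with $w=0$ on $\partial\Omega$, if $r^\epsilon\ll b^\epsilon$; $w=0$, if $r^\epsilon=b^\epsilon$. Then $$\lim_{\delta\to0}\left(\lim_{\epsilon\to0}\tilde u^{\delta,\epsilon}\right)=w\quad\text{weakly in }L^2(\Omega).$$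
   Context: $\Omega\subset\mathbb{R}^N$ is an open bounded domain. The perforated domain is $\Omega^\epsilon=\Omega\setminus\bigcup_i B_{r^\epsilon}(x_i)$, where $B_{r^\epsilon}(x_i)$ are the closed balls strictly contained in $\Omega$ with centers $x_i\in\Omega$ of the form $x_i\in2\epsilon\mathbb{Z}^N$ and radius $0<r^\epsilon<\epsilon\le1$ (so $C_0<1$ when $r^\epsilon=b^\epsilon$). The kernel $J\in\mathcal{C}(\mathbb{R}^N,\mathbb{R})$ is non-negative, compactly supported, radially symmetric, $J(0)>0$, and $\int_{\mathbb{R}^N}J(x)\,dx=1$. The normalizing constant is $C=\left(\frac12\int_{\mathbb{R}^N}J(x)\,x_1^2\,dx\right)^{-1}$, $x_1$ being the first coordinate of $x$. The notation $r^\epsilon\ll b^\epsilon$ means $r^\epsilon/b^\epsilon\to0$ as $\epsilon\to0$. The boundary value problem for $w$ is understood in the weak sense ($w\in H^1_0(\Omega)$). The tilde denotes extension by zero. The solution $u^{\epsilon,\delta}\in L^2$ exists and is unique; the inner limit is weak in $L^2(\Omega)$.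
   Formalization: If r^ε ≪ b^ε, Ω is also assumed such that every H^1(R^N) function vanishing a.e. outside Ω lies in H^1_0(Ω) (true e.g. for Lipschitz boundary); without this the claim fails, e.g. for a disc slit along a radius with f = −1. *)

theory Defs
  imports "HOL-Analysis.Analysis"
begin

section \<open>Function spaces\<close>

definition L2 :: "'a::euclidean_space set \<Rightarrow> ('a \<Rightarrow> 'b::euclidean_space) set" where
  "L2 \<Omega> = {f \<in> borel_measurable (lebesgue_on \<Omega>). integrable (lebesgue_on \<Omega>) (\<lambda>x. (norm (f x))\<^sup>2)}"

definition weakly_tendsto_L2 ::
    "'a::euclidean_space set \<Rightarrow> ('i \<Rightarrow> 'a \<Rightarrow> real) \<Rightarrow> ('a \<Rightarrow> real) \<Rightarrow> 'i filter \<Rightarrow> bool" where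
  "weakly_tendsto_L2 \<Omega> u v F \<longleftrightarrow>
     (\<forall>\<^sub>F i in F. u i \<in> L2 \<Omega>) \<and> v \<in> L2 \<Omega> \<and>
     (\<forall>g\<in>L2 \<Omega>. ((\<lambda>i. \<integral>x. u i x * g x \<partial>lebesgue_on \<Omega>) \<longlongrightarrow> (\<integral>x. v x * g x \<partial>lebesgue_on \<Omega>)) F)"

definition partial_deriv :: "'n::finite \<Rightarrow> (real^'n \<Rightarrow> real) \<Rightarrow> real^'n \<Rightarrow> real" where
  "partial_deriv i \<phi> x = frechet_derivative \<phi> (at x) (axis i 1)"

definition grad :: "(real^'n::finite \<Rightarrow> real) \<Rightarrow> real^'n \<Rightarrow> real^'n" where
  "grad \<phi> x = (\<chi> i. partial_deriv i \<phi> x)"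

primrec C_k :: "nat \<Rightarrow> (real^'n::finite \<Rightarrow> real) \<Rightarrow> bool" where
  "C_k 0 \<phi> \<longleftrightarrow> continuous_on UNIV \<phi>"
| "C_k (Suc k) \<phi> \<longleftrightarrow> (\<forall>x. \<phi> differentiable (at x)) \<and> (\<forall>i. C_k k (partial_deriv i \<phi>))"

definition test_functions :: "(real^'n::finite) set \<Rightarrow> (real^'n \<Rightarrow> real) set" where
  "test_functions \<Omega> =
     {\<phi>. (\<forall>k. C_k k \<phi>) \<and> compact (closure {x. \<phi> x \<noteq> 0}) \<and> closure {x. \<phi> x \<noteq> 0} \<subseteq> \<Omega>}"

definition weak_gradient ::
    "(real^'n::finite) set \<Rightarrow> (real^'n \<Rightarrow> real) \<Rightarrow> (real^'n \<Rightarrow> real^'n) \<Rightarrow> bool" where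
  "weak_gradient \<Omega> w g \<longleftrightarrow>
     w \<in> L2 \<Omega> \<and> g \<in> L2 \<Omega> \<and>
     (\<forall>\<phi>\<in>test_functions \<Omega>.
        (\<integral>x. w x *\<^sub>R grad \<phi> x \<partial>lebesgue_on \<Omega>) = - (\<integral>x. \<phi> x *\<^sub>R g x \<partial>lebesgue_on \<Omega>))"

definition H1 :: "(real^'n::finite) set \<Rightarrow> (real^'n \<Rightarrow> real) set" where
  "H1 \<Omega> = {w. \<exists>g. weak_gradient \<Omega> w g}"

text \<open>The closure of the test functions in the norm of \<open>H1 \<Omega>\<close>.\<close>

definition H1_0 :: "(real^'n::finite) set \<Rightarrow> (real^'n \<Rightarrow> real) set" where
  "H1_0 \<Omega> = {w. \<exists>g \<phi>. weak_gradient \<Omega> w g \<and> (\<forall>n::nat. \<phi> n \<in> test_functions \<Omega>) \<and>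
     (\<lambda>n. (\<integral>x. (\<phi> n x - w x)\<^sup>2 + (norm (grad (\<phi> n) x - g x))\<^sup>2 \<partial>lebesgue_on \<Omega>)) \<longlonglongrightarrow> 0}"

definition weak_Poisson_Dirichlet_solution ::
    "(real^'n::finite) set \<Rightarrow> (real^'n \<Rightarrow> real) \<Rightarrow> (real^'n \<Rightarrow> real) \<Rightarrow> bool" where
  "weak_Poisson_Dirichlet_solution \<Omega> f w \<longleftrightarrow>
     w \<in> H1_0 \<Omega> \<and>
     (\<exists>g. weak_gradient \<Omega> w g \<and>
        (\<forall>\<phi>\<in>test_functions \<Omega>.
           - (\<integral>x. g x \<bullet> grad \<phi> x \<partial>lebesgue_on \<Omega>) = (\<integral>x. f x * \<phi> x \<partial>lebesgue_on \<Omega>)))"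

text \<open>
  Every function in \<open>H1_0 \<Omega>\<close>, extended by zero, lies in \<open>H1 UNIV\<close> and vanishes outside
  \<open>\<Omega>\<close>. The next definition is the converse, so it says that the two usual descriptions
  of the Dirichlet space of \<open>\<Omega>\<close> coincide. It holds for instance for bounded open sets
  with Lipschitz (or just continuous) boundary, and fails for a disc slit along a radius. It cannot
  be dropped: the nonlocal problem does not see the slit, which is a null set, but \<open>H1_0\<close> does.
\<close>

definition zero_extension_regular :: "(real^'n::finite) set \<Rightarrow> bool" where
  "zero_extension_regular \<Omega> \<longleftrightarrow>
     (\<forall>v. v \<in> H1 UNIV \<and> (AE x in lebesgue. x \<notin> \<Omega> \<longrightarrow> v x = 0) \<longrightarrow> v \<in> H1_0 \<Omega>)"

section \<open>The nonlocal problem in the perforated domain\<close>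

definition perforated_domain :: "(real^'n::finite) set \<Rightarrow> real \<Rightarrow> real \<Rightarrow> (real^'n) set" where
  "perforated_domain \<Omega> \<epsilon> \<rho> =
     \<Omega> - \<Union> {cball a \<rho> | a. a \<in> \<Omega> \<and> (\<forall>i. \<exists>m::int. a $ i = 2 * \<epsilon> * of_int m) \<and> cball a \<rho> \<subseteq> \<Omega>}"

definition admissible_kernel :: "(real^'n::finite \<Rightarrow> real) \<Rightarrow> bool" where
  "admissible_kernel J \<longleftrightarrow>
     continuous_on UNIV J \<and> (\<forall>x. 0 \<le> J x) \<and> compact (closure {x. J x \<noteq> 0}) \<and>
     (\<forall>x y. norm x = norm y \<longrightarrow> J x = J y) \<and> 0 < J 0 \<and> (\<integral>x. J x \<partial>lebesgue) = 1"

text \<open>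
  The index type carries no order, so the coordinate that plays the role of the first one is a
  parameter; for a radial kernel the value does not depend on it.
\<close>

definition normalizing_constant :: "'n::finite \<Rightarrow> (real^'n \<Rightarrow> real) \<Rightarrow> real" where
  "normalizing_constant k J = inverse (1 / 2 * (\<integral>x. J x * (x $ k)\<^sup>2 \<partial>lebesgue))"

text \<open>
  \<open>u\<close> is defined on the whole space and vanishes outside \<open>D\<close>, so it is its own
  extension by zero. As usual for classes in \<open>L2 UNIV\<close>, both conditions are imposed almost everywhere.
\<close>

definition nonlocal_Dirichlet_solution ::
    "real \<Rightarrow> (real^'n::finite \<Rightarrow> real) \<Rightarrow> (real^'n) set \<Rightarrow> real \<Rightarrow> (real^'n \<Rightarrow> real) \<Rightarrow>
     (real^'n \<Rightarrow> real) \<Rightarrow> bool" where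
  "nonlocal_Dirichlet_solution C J D \<delta> f u \<longleftrightarrow>
     u \<in> L2 UNIV \<and>
     (AE x in lebesgue. x \<in> D \<longrightarrow>
        f x = C / \<delta> ^ (CARD('n) + 2) * (\<integral>y. J ((x - y) /\<^sub>R \<delta>) * (u y - u x) \<partial>lebesgue)) \<and>
     (AE x in lebesgue. x \<notin> D \<longrightarrow> u x = 0)"

end

theory Submission
  imports Defs
begin

text \<open>
  Extended by zero, the solution satisfies \<open>u = 1\<^bsub>D\<^esub> (J\<^sub>\<delta> * u - (\<delta>\<^sup>2/C) f)\<close> with \<open>D\<close> the perforated
  domain. Convolution with \<open>J\<^sub>\<delta>\<close> is compact on \<open>\<Omega>\<close>, and Schur's test with the concave weight
  \<open>R\<^sup>2 - \<bar>x\<bar>\<^sup>2\<close> shows that it is a contraction there, with spectral gap at least \<open>c \<delta>\<^sup>2\<close>. As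
  \<open>\<epsilon> \<rightarrow> 0\<close> the indicator of \<open>D\<close> tends weakly to \<open>\<theta> 1\<^bsub>\<Omega>\<^esub>\<close>, where \<open>\<theta>\<close> is the volume fraction left by
  the holes, so \<open>u\<close> tends weakly to the solution \<open>v\<close> of \<open>v = \<theta> 1\<^bsub>\<Omega>\<^esub> (J\<^sub>\<delta> * v - (\<delta>\<^sup>2/C) f)\<close>.

  If \<open>\<theta> < 1\<close>, this equation alone forces \<open>\<parallel>v\<parallel> \<le> (\<delta>\<^sup>2/C) \<parallel>f\<parallel> / (1 - \<theta>)\<close>. If \<open>\<theta> = 1\<close>, the spectral gap
  bounds \<open>v\<close> and its nonlocal energy uniformly in \<open>\<delta>\<close>. Every weak cluster point of \<open>v\<close> then has a
  square-integrable gradient and vanishes outside \<open>\<Omega>\<close>, hence lies in \<open>H1_0 \<Omega>\<close>, and testing against the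
  rescaled nonlocal operator, which converges to the Laplacian on test functions, identifies it
  with the unique weak solution of the Dirichlet problem.
\<close>

section \<open>The Hilbert space of square-integrable functions\<close>

text \<open>The obstacle is the product of the indicator of the perforated domain with a convolution
  of the solution: as \<epsilon> tends to 0 both are a priori only weakly convergent, and weak
  limits do not multiply. For fixed \<delta> convolution restores strong convergence. As \<delta>
  tends to 0 this gain is lost and the contraction factor tends to 1; for \<theta> = 1 what survives
  is a balance of powers, since the spectral gap and the load both carry a factor
  \<open>\<delta>\<^sup>2\<close>. The weight in Schur's test makes the gap explicit without
  regularity of the boundary, and in the limit the same estimate becomes the classical Poincare
  inequality, hence uniqueness. The gradient of a cluster point comes from convolution with the
  first-moment kernel, divided by \<open>\<delta>\<^sup>2\<close>: its pairing with the solution is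
  controlled by the nonlocal energy, and on test functions it converges to a partial derivative.
  Cluster points are taken along filters, so Tychonoff's theorem replaces separability and
  subsequences. Regularity of \<Omega> enters once, to place a cluster point in
  \<open>H1_0 \<Omega>\<close>.\<close>

lemma sigma_finite_lebesgue: "sigma_finite_measure (lebesgue :: 'a::euclidean_space measure)"
proof -
  obtain A :: "'a set set" where A: "countable A" "A \<subseteq> sets lborel" "\<Union>A = space lborel"
      "\<forall>a\<in>A. emeasure lborel a \<noteq> \<infinity>"
    using lborel.sigma_finite_countable by auto
  show ?thesis
  proof
    have "emeasure lebesgue a \<noteq> \<infinity>" if "a \<in> A" for a
      using A that by auto
    then show "\<exists>A :: 'a set set. countable A \<and> A \<subseteq> sets lebesgue \<and> \<Union>A = space lebesgue \<and> (\<forall>a\<in>A. emeasure lebesgue a \<noteq> \<infinity>)"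
      using A sets_completionI_sets[of _ lborel]
      by (intro exI[of _ A] conjI) (auto simp del: sets_lborel)
  qed
qed

interpretation lebesgue: sigma_finite_measure "lebesgue :: 'a::euclidean_space measure"
  by (rule sigma_finite_lebesgue)

interpretation lebesgue_pair: pair_sigma_finite
  "lebesgue :: 'a::euclidean_space measure" "lebesgue :: 'b::euclidean_space measure" ..

lemma L2_UNIV_iff:
  fixes f :: "'a::euclidean_space \<Rightarrow> real"
  shows "f \<in> L2 UNIV \<longleftrightarrow> f \<in> borel_measurable lebesgue \<and> integrable lebesgue (\<lambda>x. (f x)\<^sup>2)"
  by (simp add: L2_def lebesgue_on_UNIV_eq)

lemma L2_measurable:
  fixes f :: "'a::euclidean_space \<Rightarrow> real"
  shows "f \<in> L2 UNIV \<Longrightarrow> f \<in> borel_measurable lebesgue"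
  by (simp add: L2_UNIV_iff)

lemma L2_integrable_sq:
  fixes f :: "'a::euclidean_space \<Rightarrow> real"
  shows "f \<in> L2 UNIV \<Longrightarrow> integrable lebesgue (\<lambda>x. (f x)\<^sup>2)"
  by (simp add: L2_UNIV_iff)

lemma abs_mult_le_sum_sq: "\<bar>a * b\<bar> \<le> a\<^sup>2 + b\<^sup>2" for a b :: real
proof -
  have "2 * \<bar>a * b\<bar> \<le> a\<^sup>2 + b\<^sup>2"
    using zero_le_power2[of "\<bar>a\<bar> - \<bar>b\<bar>"] by (simp add: power2_diff abs_mult)
  then show ?thesis by (smt (verit) abs_ge_zero)
qed

lemma L2_integrable_mult:
  fixes f g :: "'a::euclidean_space \<Rightarrow> real"
  assumes "f \<in> L2 UNIV" "g \<in> L2 UNIV"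
  shows "integrable lebesgue (\<lambda>x. f x * g x)"
proof (rule Bochner_Integration.integrable_bound)
  show "integrable lebesgue (\<lambda>x. (f x)\<^sup>2 + (g x)\<^sup>2)"
    using assms by (intro Bochner_Integration.integrable_add L2_integrable_sq)
  show "AE x in lebesgue. norm (f x * g x) \<le> norm ((f x)\<^sup>2 + (g x)\<^sup>2)"
    using abs_mult_le_sum_sq by (intro AE_I2) (metis abs_ge_self order_trans real_norm_def)
qed (use assms in \<open>auto simp: L2_UNIV_iff\<close>)

lemma L2_add:
  fixes f g :: "'a::euclidean_space \<Rightarrow> real"
  assumes "f \<in> L2 UNIV" "g \<in> L2 UNIV"
  shows "(\<lambda>x. f x + g x) \<in> L2 UNIV"
proof -
  have "integrable lebesgue (\<lambda>x. (f x)\<^sup>2 + (g x)\<^sup>2 + 2 * (f x * g x))"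
    using assms by (intro Bochner_Integration.integrable_add L2_integrable_sq integrable_mult_right L2_integrable_mult)
  moreover have "(\<lambda>x. (f x)\<^sup>2 + (g x)\<^sup>2 + 2 * (f x * g x)) = (\<lambda>x. (f x + g x)\<^sup>2)"
    by (auto simp: power2_eq_square algebra_simps)
  ultimately show ?thesis
    using assms by (auto simp: L2_UNIV_iff)
qed

lemma L2_cmult:
  fixes f :: "'a::euclidean_space \<Rightarrow> real"
  assumes "f \<in> L2 UNIV" shows "(\<lambda>x. c * f x) \<in> L2 UNIV"
  using assms by (auto simp: L2_UNIV_iff power_mult_distrib)

lemma L2_uminus:
  fixes f :: "'a::euclidean_space \<Rightarrow> real"
  assumes "f \<in> L2 UNIV" shows "(\<lambda>x. - f x) \<in> L2 UNIV"
  using L2_cmult[OF assms, of "-1"] by simp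

lemma L2_diff:
  fixes f g :: "'a::euclidean_space \<Rightarrow> real"
  assumes "f \<in> L2 UNIV" "g \<in> L2 UNIV"
  shows "(\<lambda>x. f x - g x) \<in> L2 UNIV"
  using L2_add[OF assms(1) L2_uminus[OF assms(2)]] by simp

lemma L2_zero [simp]: "(\<lambda>x. 0 :: real) \<in> L2 UNIV"
  by (simp add: L2_UNIV_iff)

lemma L2_cong_AE:
  fixes f g :: "'a::euclidean_space \<Rightarrow> real"
  assumes "f \<in> L2 UNIV" "AE x in lebesgue. g x = f x"
  shows "g \<in> L2 UNIV"
proof -
  have g: "g \<in> borel_measurable lebesgue"
    by (rule borel_measurable_AE[OF L2_measurable[OF assms(1)]]) (use assms(2) in auto)
  show ?thesis
    unfolding L2_UNIV_iff
    using g assms by (auto simp: L2_UNIV_iff intro: integrable_cong_AE_imp)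
qed

text \<open>Square integrability is part of the relation, so functions outside
  \<open>L2 UNIV\<close> are related to nothing, not even to themselves; the quotient is therefore
  partial and its elements are exactly the usual classes.\<close>

definition l2rel :: "('a::euclidean_space \<Rightarrow> real) \<Rightarrow> ('a \<Rightarrow> real) \<Rightarrow> bool" where
  "l2rel f g \<longleftrightarrow> f \<in> L2 UNIV \<and> g \<in> L2 UNIV \<and> (AE x in lebesgue. f x = g x)"

lemma part_equivp_l2rel: "part_equivp (l2rel :: ('a::euclidean_space \<Rightarrow> real) \<Rightarrow> _)"
proof (rule part_equivpI)
  show "\<exists>f :: 'a \<Rightarrow> real. l2rel f f"
    by (rule exI[of _ "\<lambda>x. 0"]) (simp add: l2rel_def)
  show "symp (l2rel :: ('a \<Rightarrow> real) \<Rightarrow> _)"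
    by (rule sympI) (auto simp: l2rel_def eq_commute)
  show "transp (l2rel :: ('a \<Rightarrow> real) \<Rightarrow> _)"
  proof (rule transpI)
    fix f g h :: "'a \<Rightarrow> real"
    assume *: "l2rel f g" "l2rel g h"
    then have "AE x in lebesgue. f x = g x" "AE x in lebesgue. g x = h x"
      by (auto simp: l2rel_def)
    then have "AE x in lebesgue. f x = h x" by eventually_elim simp
    then show "l2rel f h" using * by (auto simp: l2rel_def)
  qed
qed

quotient_type (overloaded) 'a l2 = "'a::euclidean_space \<Rightarrow> real" / partial: l2rel
  by (rule part_equivp_l2rel)

lemma l2rel_cong2:
  fixes f1 f2 g1 g2 :: "'a::euclidean_space \<Rightarrow> real"
  assumes "l2rel f1 f2" "l2rel g1 g2"
    "\<And>u v :: 'a \<Rightarrow> real. u \<in> L2 UNIV \<Longrightarrow> v \<in> L2 UNIV \<Longrightarrow> (\<lambda>x. h (u x) (v x)) \<in> L2 UNIV"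
  shows "l2rel (\<lambda>x. h (f1 x) (g1 x)) (\<lambda>x. h (f2 x) (g2 x))"
proof -
  have "AE x in lebesgue. f1 x = f2 x" "AE x in lebesgue. g1 x = g2 x"
    using assms by (auto simp: l2rel_def)
  then have "AE x in lebesgue. h (f1 x) (g1 x) = h (f2 x) (g2 x)"
    by eventually_elim simp
  then show ?thesis using assms unfolding l2rel_def by blast
qed

lemma l2rel_inner:
  fixes f1 f2 g1 g2 :: "'a::euclidean_space \<Rightarrow> real"
  assumes "l2rel f1 f2" "l2rel g1 g2"
  shows "(\<integral>x. f1 x * g1 x \<partial>lebesgue) = (\<integral>x. f2 x * g2 x \<partial>lebesgue)"
proof -
  have ae: "AE x in lebesgue. f1 x = f2 x" "AE x in lebesgue. g1 x = g2 x"
    and L: "f1 \<in> L2 UNIV" "f2 \<in> L2 UNIV" "g1 \<in> L2 UNIV" "g2 \<in> L2 UNIV"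
    using assms by (auto simp: l2rel_def)
  have [measurable]: "f1 \<in> borel_measurable lebesgue" "f2 \<in> borel_measurable lebesgue"
    "g1 \<in> borel_measurable lebesgue" "g2 \<in> borel_measurable lebesgue"
    using L by (simp_all add: L2_measurable)
  have "AE x in lebesgue. f1 x * g1 x = f2 x * g2 x"
    using ae by eventually_elim simp
  then show ?thesis by (intro integral_cong_AE) measurable
qed

instantiation l2 :: (euclidean_space) real_vector
begin

lift_definition zero_l2 :: "'a l2" is "\<lambda>x. 0"
  by (simp add: l2rel_def)
lift_definition plus_l2 :: "'a l2 \<Rightarrow> 'a l2 \<Rightarrow> 'a l2" is "\<lambda>f g x. f x + g x"
  by (rule l2rel_cong2) (auto intro: L2_add)
lift_definition minus_l2 :: "'a l2 \<Rightarrow> 'a l2 \<Rightarrow> 'a l2" is "\<lambda>f g x. f x - g x"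
  by (rule l2rel_cong2) (auto intro: L2_diff)
lift_definition uminus_l2 :: "'a l2 \<Rightarrow> 'a l2" is "\<lambda>f x. - f x"
  by (auto simp: l2rel_def intro: L2_uminus)
lift_definition scaleR_l2 :: "real \<Rightarrow> 'a l2 \<Rightarrow> 'a l2" is "\<lambda>c f x. c * f x"
  by (auto simp: l2rel_def intro: L2_cmult)
instance
proof
  fix a b :: real and x y z :: "'a l2"
  show "x + y + z = x + (y + z)" by transfer (auto simp: l2rel_def algebra_simps intro!: L2_add)
  show "x + y = y + x" by transfer (auto simp: l2rel_def algebra_simps intro!: L2_add)
  show "0 + x = x" by transfer (auto simp: l2rel_def)
  show "- x + x = 0" by transfer (auto simp: l2rel_def)
  show "x - y = x + - y" by transfer (auto simp: l2rel_def intro: L2_diff)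
  show "a *\<^sub>R (x + y) = a *\<^sub>R x + a *\<^sub>R y"
    by transfer (auto simp: l2rel_def algebra_simps intro!: L2_add L2_cmult)
  show "(a + b) *\<^sub>R x = a *\<^sub>R x + b *\<^sub>R x"
    by transfer (auto simp: l2rel_def algebra_simps intro!: L2_add L2_cmult)
  show "a *\<^sub>R b *\<^sub>R x = (a * b) *\<^sub>R x"
    by transfer (auto simp: l2rel_def algebra_simps intro!: L2_cmult)
  show "1 *\<^sub>R x = x" by transfer (auto simp: l2rel_def)
qed

end

instantiation l2 :: (euclidean_space) real_inner
begin

lift_definition inner_l2 :: "'a l2 \<Rightarrow> 'a l2 \<Rightarrow> real" is "\<lambda>f g. (\<integral>x. f x * g x \<partial>lebesgue)"
  by (rule l2rel_inner)

definition "norm_l2 (x :: 'a l2) = sqrt (x \<bullet> x)"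
definition "sgn_l2 (x :: 'a l2) = x /\<^sub>R norm x"
definition "dist_l2 (x :: 'a l2) y = norm (x - y)"
definition uniformity_l2 :: "('a l2 \<times> 'a l2) filter" where
  "uniformity_l2 = (INF e\<in>{0 <..}. principal {(x, y). dist x y < e})"
definition open_l2 :: "'a l2 set \<Rightarrow> bool" where
  "open_l2 U = (\<forall>x\<in>U. eventually (\<lambda>(x', y). x' = x \<longrightarrow> y \<in> U) uniformity)"

instance
proof
  fix a :: real and x y z :: "'a l2"
  show "sgn x = x /\<^sub>R norm x" by (rule sgn_l2_def)
  show "dist x y = norm (x - y)" by (rule dist_l2_def)
  show "x \<bullet> y = y \<bullet> x" by transfer (simp add: mult.commute)
  show "(x + y) \<bullet> z = x \<bullet> z + y \<bullet> z"
    by transfer (auto simp: l2rel_def distrib_right L2_integrable_mult)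
  show "(a *\<^sub>R x) \<bullet> y = a * (x \<bullet> y)"
    by transfer (simp add: mult.assoc)
  show "0 \<le> x \<bullet> x" by transfer simp
  show "x \<bullet> x = 0 \<longleftrightarrow> x = 0"
  proof (transfer, goal_cases)
    case (1 f)
    then have "integrable lebesgue (\<lambda>x. f x * f x)"
      by (auto simp: l2rel_def intro: L2_integrable_mult)
    then have "(\<integral>x. f x * f x \<partial>lebesgue) = 0 \<longleftrightarrow> (AE x in lebesgue. f x * f x = 0)"
      by (intro integral_nonneg_eq_0_iff_AE) auto
    also have "\<dots> \<longleftrightarrow> l2rel f (\<lambda>x. 0)"
      using 1 by (auto simp: l2rel_def)
    finally show ?case .
  qed
  show "norm x = sqrt (x \<bullet> x)" by (rule norm_l2_def)
qed (simp_all only: uniformity_l2_def open_l2_def)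

end

text \<open>A total map: a function that is not square integrable is sent to the zero class. This
  default is why the computation rules for \<open>cls\<close> assume membership in
  \<open>L2 UNIV\<close>.\<close>

lift_definition cls :: "('a::euclidean_space \<Rightarrow> real) \<Rightarrow> 'a l2" is
  "\<lambda>f. if f \<in> L2 UNIV then f else (\<lambda>x. 0)"
  by (auto simp: l2rel_def)


text \<open>A chosen representative. Its single values carry no meaning, but its integrals and
  convolutions do not depend on the choice.\<close>

definition fn :: "'a::euclidean_space l2 \<Rightarrow> 'a \<Rightarrow> real" where
  "fn = rep_l2"

lemma l2rel_fn: "l2rel (fn x) (fn x)"
  unfolding fn_def by (rule Quotient3_rep_reflp[OF Quotient3_l2])

lemma fn_L2 [simp]: "fn x \<in> L2 UNIV"
  using l2rel_fn[of x] by (simp add: l2rel_def)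

lemma fn_measurable [measurable]: "fn x \<in> borel_measurable lebesgue"
  by (rule L2_measurable) simp

lemma cls_eq_iff:
  assumes "f \<in> L2 UNIV" "g \<in> L2 UNIV"
  shows "cls f = cls g \<longleftrightarrow> (AE x in lebesgue. f x = g x)"
  using assms by transfer (simp add: l2rel_def)

lemma cls_fn [simp]: "cls (fn x) = x"
proof -
  have "cls (fn x) = abs_l2 (fn x)"
    by (simp add: cls.abs_eq)
  also have "\<dots> = x"
    unfolding fn_def by (rule Quotient3_abs_rep[OF Quotient3_l2])
  finally show ?thesis .
qed

lemma fn_cls_AE:
  assumes "f \<in> L2 UNIV"
  shows "AE x in lebesgue. fn (cls f) x = f x"
  using cls_eq_iff[OF fn_L2[of "cls f"] assms] by simp

lemma inner_cls:
  assumes "f \<in> L2 UNIV" "g \<in> L2 UNIV"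
  shows "cls f \<bullet> cls g = (\<integral>x. f x * g x \<partial>lebesgue)"
  using assms by transfer simp

lemma norm_cls_sq:
  assumes "f \<in> L2 UNIV"
  shows "(norm (cls f))\<^sup>2 = (\<integral>x. (f x)\<^sup>2 \<partial>lebesgue)"
  using inner_cls[OF assms assms] unfolding power2_norm_eq_inner by (simp add: power2_eq_square)

lemma cls_add:
  assumes "f \<in> L2 UNIV" "g \<in> L2 UNIV"
  shows "cls (\<lambda>x. f x + g x) = cls f + cls g"
  using assms L2_add[OF assms] by transfer (simp add: l2rel_def)

lemma cls_diff:
  assumes "f \<in> L2 UNIV" "g \<in> L2 UNIV"
  shows "cls (\<lambda>x. f x - g x) = cls f - cls g"
  using assms L2_diff[OF assms] by transfer (simp add: l2rel_def)

lemma cls_cmult: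
  assumes "f \<in> L2 UNIV"
  shows "cls (\<lambda>x. c * f x) = c *\<^sub>R cls f"
  using assms L2_cmult[OF assms] by transfer (simp add: l2rel_def)

lemma cls_zero [simp]: "cls (\<lambda>x. 0) = 0"
  by transfer (simp add: l2rel_def)

section \<open>Completeness of the space of classes\<close>

lemma L2_positive_exists: "\<exists>\<omega> :: 'a::euclidean_space \<Rightarrow> real. \<omega> \<in> L2 UNIV \<and> (\<forall>x. 0 < \<omega> x)"
proof -
  obtain h :: "'a \<Rightarrow> real" where h: "h \<in> borel_measurable lebesgue" "\<And>x. 0 < h x" "integrable lebesgue h"
    using lebesgue.obtain_positive_integrable_function by (metis UNIV_I space_completion space_lborel)
  have "(\<lambda>x. sqrt (h x)) \<in> L2 UNIV"
    using h less_imp_le[OF h(2)] by (auto simp: L2_UNIV_iff)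
  then show ?thesis using h(2) by (intro exI[of _ "\<lambda>x. sqrt (h x)"]) auto
qed

lemma Cauchy_mult_pos_imp_convergent:
  fixes s :: "nat \<Rightarrow> real"
  assumes "Cauchy (\<lambda>i. s i * w)" "0 < w"
  shows "convergent s"
proof -
  have "convergent (\<lambda>i. s i * w)" using assms(1) by (rule Cauchy_convergent)
  then obtain l where "(\<lambda>i. s i * w) \<longlonglongrightarrow> l" by (auto simp: convergent_def)
  then have "(\<lambda>i. (s i * w) * (1 / w)) \<longlonglongrightarrow> l * (1 / w)" by (intro tendsto_intros)
  then show ?thesis using assms(2) by (auto simp: convergent_def)
qed

text \<open>Multiplying by a positive square-integrable weight turns an \<open>L2\<close>-Cauchy sequence into an
  \<open>L1\<close>-Cauchy one, which has an almost everywhere convergent subsequence; Fatou's lemma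
  then gives convergence in norm.\<close>

instance l2 :: (euclidean_space) complete_space
proof
  fix X :: "nat \<Rightarrow> 'a l2"
  assume X: "Cauchy X"
  obtain \<omega> :: "'a \<Rightarrow> real" where \<omega>: "\<omega> \<in> L2 UNIV" "\<And>x. 0 < \<omega> x"
    using L2_positive_exists by auto
  define s where "s n x = fn (X n) x * \<omega> x" for n x
  have int_s: "integrable lebesgue (s n)" for n
    unfolding s_def using \<omega>(1) by (intro L2_integrable_mult) auto
  have "(\<lambda>x. \<bar>g x\<bar>) \<in> L2 UNIV" if "g \<in> L2 UNIV" for g :: "'a \<Rightarrow> real"
    using that by (auto simp: L2_UNIV_iff)
  note L2_abs = this
  have L1: "(LINT x|lebesgue. norm (s i x - s j x)) \<le> norm (X i - X j) * norm (cls \<omega>)" for i j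
  proof -
    define d where "d = (\<lambda>x. \<bar>fn (X i) x - fn (X j) x\<bar>)"
    have d: "d \<in> L2 UNIV" unfolding d_def by (intro L2_abs L2_diff) auto
    have "(LINT x|lebesgue. norm (s i x - s j x)) = (LINT x|lebesgue. d x * \<omega> x)"
      using less_imp_le[OF \<omega>(2)]
      by (intro Bochner_Integration.integral_cong) (auto simp: s_def d_def abs_mult left_diff_distrib[symmetric])
    also have "\<dots> = cls d \<bullet> cls \<omega>"
      using d \<omega>(1) by (simp add: inner_cls)
    also have "\<dots> \<le> norm (cls d) * norm (cls \<omega>)"
      by (rule norm_cauchy_schwarz)
    also have "(norm (cls d))\<^sup>2 = (norm (cls (\<lambda>x. fn (X i) x - fn (X j) x)))\<^sup>2"
      using d by (simp add: norm_cls_sq L2_diff d_def)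
    then have "norm (cls d) = norm (X i - X j)"
      by (simp add: cls_diff)
    finally show ?thesis .
  qed
  have "\<exists>N. \<forall>i\<ge>N. \<forall>j\<ge>N. (LINT x|lebesgue. norm (s i x - s j x)) < e" if "e > 0" for e
  proof -
    have pos: "e / (norm (cls \<omega>) + 1) > 0"
      using that by (intro divide_pos_pos) (auto intro: add_nonneg_pos)
    from CauchyD[OF X pos] obtain N where N: "\<And>i j. i \<ge> N \<Longrightarrow> j \<ge> N \<Longrightarrow> norm (X i - X j) < e / (norm (cls \<omega>) + 1)"
      by auto
    have "(LINT x|lebesgue. norm (s i x - s j x)) < e" if "i \<ge> N" "j \<ge> N" for i j
    proof -
      have "(LINT x|lebesgue. norm (s i x - s j x)) \<le> norm (X i - X j) * (norm (cls \<omega>) + 1)"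
        using L1[of i j] by (simp add: distrib_left) (smt (verit) norm_ge_zero)
      also have "\<dots> < e / (norm (cls \<omega>) + 1) * (norm (cls \<omega>) + 1)"
        using N[OF that] by (intro mult_strict_right_mono) (auto intro: add_nonneg_pos)
      also have "\<dots> = e"
        using norm_ge_zero[of "cls \<omega>"] by (simp add: add_nonneg_eq_0_iff)
      finally show ?thesis .
    qed
    then show ?thesis by blast
  qed
  from cauchy_L1_AE_cauchy_subseq[OF int_s this]
  obtain r where r: "strict_mono r" "AE x in lebesgue. Cauchy (\<lambda>i. s (r i) x)" by blast
  have conv: "AE x in lebesgue. convergent (\<lambda>i. fn (X (r i)) x)"
    using r(2) by eventually_elim (use \<omega>(2) in \<open>auto simp: s_def intro: Cauchy_mult_pos_imp_convergent\<close>)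
  define f where "f x = lim (\<lambda>i. fn (X (r i)) x)" for x
  have f_meas[measurable]: "f \<in> borel_measurable lebesgue"
    unfolding f_def by (intro borel_measurable_lim_metric) simp
  have lim: "AE x in lebesgue. (\<lambda>i. fn (X (r i)) x) \<longlonglongrightarrow> f x"
    using conv by eventually_elim (simp add: f_def convergent_LIMSEQ_iff)
  \<comment> \<open>Fatou along the subsequence compares the pointwise limit \<open>f\<close> with
    each \<open>X m\<close>. Integrability of the difference comes out of the bound, so
    \<open>f\<close> need not be known to be square integrable yet.\<close>
  have fatou: "integrable lebesgue (\<lambda>x. (f x - fn (X m) x)\<^sup>2) \<and> (\<integral>x. (f x - fn (X m) x)\<^sup>2 \<partial>lebesgue) \<le> e"
    if e: "e \<ge> 0" "\<And>i. i \<ge> N \<Longrightarrow> (norm (X (r i) - X m))\<^sup>2 \<le> e" for m N e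
  proof -
    have "(\<integral>\<^sup>+x. ennreal ((f x - fn (X m) x)\<^sup>2) \<partial>lebesgue)
        = (\<integral>\<^sup>+x. liminf (\<lambda>i. ennreal ((fn (X (r i)) x - fn (X m) x)\<^sup>2)) \<partial>lebesgue)"
    proof (rule nn_integral_cong_AE)
      show "AE x in lebesgue. ennreal ((f x - fn (X m) x)\<^sup>2) = liminf (\<lambda>i. ennreal ((fn (X (r i)) x - fn (X m) x)\<^sup>2))"
        using lim
      proof eventually_elim
        case (elim x)
        have "(\<lambda>i. ennreal ((fn (X (r i)) x - fn (X m) x)\<^sup>2)) \<longlonglongrightarrow> ennreal ((f x - fn (X m) x)\<^sup>2)"
          by (intro tendsto_intros elim)
        from lim_imp_Liminf[OF _ this] show ?case by simp
      qed
    qed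
    also have "\<dots> \<le> liminf (\<lambda>i. \<integral>\<^sup>+x. ennreal ((fn (X (r i)) x - fn (X m) x)\<^sup>2) \<partial>lebesgue)"
      by (intro nn_integral_liminf) measurable
    also have "\<dots> \<le> ennreal e"
    proof (rule Liminf_le)
      show "\<forall>\<^sub>F i in sequentially. (\<integral>\<^sup>+x. ennreal ((fn (X (r i)) x - fn (X m) x)\<^sup>2) \<partial>lebesgue) \<le> ennreal e"
        using eventually_ge_at_top[of N]
      proof eventually_elim
        case (elim i)
        have L: "(\<lambda>x. fn (X (r i)) x - fn (X m) x) \<in> L2 UNIV" by (intro L2_diff) auto
        have "(\<integral>\<^sup>+x. ennreal ((fn (X (r i)) x - fn (X m) x)\<^sup>2) \<partial>lebesgue)
          = ennreal (\<integral>x. (fn (X (r i)) x - fn (X m) x)\<^sup>2 \<partial>lebesgue)"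
          by (intro nn_integral_eq_integral L2_integrable_sq L) auto
        also have "(\<integral>x. (fn (X (r i)) x - fn (X m) x)\<^sup>2 \<partial>lebesgue) = (norm (X (r i) - X m))\<^sup>2"
          using norm_cls_sq[OF L] by (simp add: cls_diff)
        finally show ?case using e(2)[OF elim] by (simp add: ennreal_leI)
      qed
    qed simp
    finally have le: "(\<integral>\<^sup>+x. ennreal ((f x - fn (X m) x)\<^sup>2) \<partial>lebesgue) \<le> ennreal e" .
    have int: "integrable lebesgue (\<lambda>x. (f x - fn (X m) x)\<^sup>2)"
      using le by (intro integrableI_bounded) (auto intro: le_less_trans)
    have "ennreal (\<integral>x. (f x - fn (X m) x)\<^sup>2 \<partial>lebesgue) \<le> ennreal e"
      using nn_integral_eq_integral[OF int] le by simp
    then show ?thesis using int e by (simp add: ennreal_le_iff)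
  qed
  have Cau: "\<exists>N. \<forall>m\<ge>N. \<forall>i\<ge>N. (norm (X (r i) - X m))\<^sup>2 \<le> e\<^sup>2" if "e > 0" for e
  proof -
    from CauchyD[OF X that] obtain N where N: "\<And>i j. i \<ge> N \<Longrightarrow> j \<ge> N \<Longrightarrow> norm (X i - X j) < e"
      by auto
    have "(norm (X (r i) - X m))\<^sup>2 \<le> e\<^sup>2" if "i \<ge> N" "m \<ge> N" for i m
      using N[of "r i" m] that seq_suble[OF r(1), of i] by (intro power_mono) (auto intro: less_imp_le)
    then show ?thesis by blast
  qed
  obtain N0 where N0: "\<And>m i. m \<ge> N0 \<Longrightarrow> i \<ge> N0 \<Longrightarrow> (norm (X (r i) - X m))\<^sup>2 \<le> 1\<^sup>2"
    using Cau[of 1] by auto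
  have "integrable lebesgue (\<lambda>x. (f x - fn (X N0) x)\<^sup>2)"
    using fatou[of "1\<^sup>2" N0 N0] N0 by simp
  then have "(\<lambda>x. f x - fn (X N0) x) \<in> L2 UNIV"
    by (auto simp: L2_UNIV_iff)
  from L2_add[OF this fn_L2[of "X N0"]] have f: "f \<in> L2 UNIV" by simp
  have "X \<longlonglongrightarrow> cls f"
  proof (rule metric_LIMSEQ_I)
    fix e :: real assume "e > 0"
    then obtain N where N: "\<And>m i. m \<ge> N \<Longrightarrow> i \<ge> N \<Longrightarrow> (norm (X (r i) - X m))\<^sup>2 \<le> (e/2)\<^sup>2"
      using Cau[of "e/2"] by auto
    have "dist (X m) (cls f) < e" if "m \<ge> N" for m
    proof -
      have "(norm (cls f - X m))\<^sup>2 = (\<integral>x. (f x - fn (X m) x)\<^sup>2 \<partial>lebesgue)"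
        using norm_cls_sq[OF L2_diff[OF f fn_L2[of "X m"]]] f by (simp add: cls_diff)
      also have "\<dots> \<le> (e/2)\<^sup>2"
        using fatou[of "(e/2)\<^sup>2" N m] N that by auto
      finally have "norm (cls f - X m) \<le> e/2"
        using \<open>e > 0\<close> by (simp add: power2_le_iff_abs_le)
      then show ?thesis using \<open>e > 0\<close> by (simp add: dist_norm norm_minus_commute)
    qed
    then show "\<exists>N. \<forall>m\<ge>N. dist (X m) (cls f) < e" by blast
  qed
  then show "convergent X" by (auto simp: convergent_def)
qed

section \<open>Weak compactness in Hilbert spaces\<close>

text \<open>The functional is given by its graph \<open>S\<close>, so that its values on a class need not be known to
  be independent of the representative beforehand.\<close>

lemma riesz_graph:
  fixes S :: "('h::{real_inner,complete_space} \<times> real) set"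
  assumes S: "subspace S" and bound: "\<And>h r. (h, r) \<in> S \<Longrightarrow> \<bar>r\<bar> \<le> K * norm h"
  shows "\<exists>g. \<forall>h r. (h, r) \<in> S \<longrightarrow> r = g \<bullet> h"
proof -
  \<comment> \<open>Direct method: the representing vector minimises half the squared norm minus the
    functional. The minimum over \<open>S\<close> need not be attained, but the first components of
    a minimising sequence converge.\<close>
  define J where "J s = (norm (fst s))\<^sup>2 / 2 - snd s" for s :: "'h \<times> real"
  have low: "J s \<ge> - K\<^sup>2 / 2" if "s \<in> S" for s
  proof -
    have "snd s \<le> K * norm (fst s)" using bound[of "fst s" "snd s"] that by auto
    moreover have "0 \<le> (norm (fst s) - K)\<^sup>2" by simp
    ultimately show ?thesis unfolding J_def by (simp add: power2_diff algebra_simps)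
  qed
  define \<mu> where "\<mu> = Inf (J ` S)"
  have ne: "J ` S \<noteq> {}" using S by (auto simp: subspace_def)
  have bdd: "bdd_below (J ` S)" using low by (intro bdd_belowI[of _ "- K\<^sup>2 / 2"]) auto
  have mu: "\<mu> \<le> J s" if "s \<in> S" for s
    unfolding \<mu>_def using that bdd by (intro cInf_lower) auto
  have "\<exists>s\<in>S. J s < \<mu> + inverse (real (Suc n))" for n
    using cInf_lessD[OF ne, of "\<mu> + inverse (real (Suc n))"] unfolding \<mu>_def by auto
  then obtain s where s: "\<And>n. s n \<in> S" "\<And>n. J (s n) < \<mu> + inverse (real (Suc n))" by metis
  \<comment> \<open>Parallelogram identity; this uniform convexity in the first component makes
    minimising sequences Cauchy there.\<close>
  have par: "(norm (fst a - fst b))\<^sup>2 / 8 = J a / 2 + J b / 2 - J ((1/2) *\<^sub>R (a + b))" for a b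
    unfolding J_def by (simp add: power2_norm_eq_inner inner_simps inner_commute power_divide field_simps)
  have gap: "(norm (fst (s n) - fst (s m)))\<^sup>2 \<le> 8 * inverse (real (Suc N))" if "N \<le> n" "N \<le> m" for n m N
  proof -
    have "(1/2) *\<^sub>R (s n + s m) \<in> S" using S s(1) by (simp add: subspace_add subspace_scale)
    then have "\<mu> \<le> J ((1/2) *\<^sub>R (s n + s m))" by (rule mu)
    moreover have "inverse (real (Suc n)) \<le> inverse (real (Suc N))" "inverse (real (Suc m)) \<le> inverse (real (Suc N))"
      using that by (auto intro!: le_imp_inverse_le)
    ultimately show ?thesis using par[of "s n" "s m"] s(2)[of n] s(2)[of m] by linarith
  qed
  have "Cauchy (\<lambda>n. fst (s n))"
  proof (rule metric_CauchyI)
    fix e :: real assume "e > 0"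
    then have "e\<^sup>2 / 8 > 0" by simp
    then obtain N where N: "inverse (real (Suc N)) < e\<^sup>2 / 8" using reals_Archimedean by blast
    have "dist (fst (s m)) (fst (s n)) < e" if "m \<ge> N" "n \<ge> N" for m n
    proof -
      have "(norm (fst (s m) - fst (s n)))\<^sup>2 < e\<^sup>2" using gap[OF that] N by linarith
      then show ?thesis using \<open>e > 0\<close> by (simp add: dist_norm power2_less_imp_less)
    qed
    then show "\<exists>M. \<forall>m\<ge>M. \<forall>n\<ge>M. dist (fst (s m)) (fst (s n)) < e" by blast
  qed
  then obtain g where g: "(\<lambda>n. fst (s n)) \<longlonglongrightarrow> g"
    using Cauchy_convergent convergent_def by blast
  \<comment> \<open>First variation at the limit \<open>g\<close>. The change of \<open>J\<close>
    when \<open>s n\<close> is perturbed by a multiple of \<open>(h, r)\<close> involves only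
    \<open>fst (s n)\<close>, so no convergence of \<open>snd (s n)\<close> is required.\<close>
  have key: "0 \<le> t * (g \<bullet> h - r) + t\<^sup>2 * (norm h)\<^sup>2 / 2" if hr: "(h, r) \<in> S" for h r t
  proof -
    have "\<mu> \<le> J (s n) + (t * (fst (s n) \<bullet> h - r) + t\<^sup>2 * (norm h)\<^sup>2 / 2)" for n
    proof -
      have "s n + t *\<^sub>R (h, r) \<in> S" using S s(1) hr by (simp only: subspace_add subspace_scale)
      from mu[OF this] have "\<mu> \<le> J (s n + t *\<^sub>R (h, r))" .
      also have "\<dots> = J (s n) + (t * (fst (s n) \<bullet> h - r) + t\<^sup>2 * (norm h)\<^sup>2 / 2)"
        unfolding J_def power2_norm_eq_inner
        by (simp add: inner_simps inner_commute power2_eq_square field_simps)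
      finally show ?thesis .
    qed
    then have "0 \<le> inverse (real (Suc n)) + (t * (fst (s n) \<bullet> h - r) + t\<^sup>2 * (norm h)\<^sup>2 / 2)" for n
      using s(2)[of n] by (smt (verit))
    moreover have "(\<lambda>n. inverse (real (Suc n)) + (t * (fst (s n) \<bullet> h - r) + t\<^sup>2 * (norm h)\<^sup>2 / 2))
       \<longlonglongrightarrow> 0 + (t * (g \<bullet> h - r) + t\<^sup>2 * (norm h)\<^sup>2 / 2)"
      by (intro tendsto_intros g LIMSEQ_inverse_real_of_nat)
    ultimately show ?thesis using LIMSEQ_le_const by fastforce
  qed
  have "r = g \<bullet> h" if hr: "(h, r) \<in> S" for h r
  proof (rule ccontr)
    define q where "q = g \<bullet> h - r"
    assume "r \<noteq> g \<bullet> h"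
    then have q: "q\<^sup>2 > 0" by (simp add: q_def)
    \<comment> \<open>The quadratic in \<open>t\<close> is minimal at
      \<open>- q / (norm h)\<^sup>2\<close>; the added 1 keeps the denominator positive when
      \<open>h = 0\<close>.\<close>
    define c where "c = (norm h)\<^sup>2 + 1"
    have c: "c > 0" "(norm h)\<^sup>2 < c" "(norm h)\<^sup>2 \<ge> 0" by (auto simp: c_def add_nonneg_pos)
    have "0 \<le> (- q / c) * q + (- q / c)\<^sup>2 * (norm h)\<^sup>2 / 2"
      using key[OF hr, of "- q / c"] unfolding q_def .
    also have "(- q / c)\<^sup>2 * (norm h)\<^sup>2 / 2 \<le> (- q / c)\<^sup>2 * c / 2"
      using c by (intro divide_right_mono mult_left_mono) auto
    also have "(- q / c) * q + (- q / c)\<^sup>2 * c / 2 = - (q\<^sup>2 / (2 * c))"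
      using c by (simp add: field_simps power2_eq_square)
    finally show False using q c divide_pos_pos[of "q\<^sup>2" "2 * c"] by linarith
  qed
  then show ?thesis by blast
qed

text \<open>Tychonoff: pointwise bounds cut out a product of compact intervals, and the topology on
  functions is the product topology.\<close>

lemma compact_PiE_bounds:
  fixes B :: "'a \<Rightarrow> real"
  shows "compact {L :: 'a \<Rightarrow> real. \<forall>g. \<bar>L g\<bar> \<le> B g}"
proof -
  have "compactin (product_topology (\<lambda>i. euclidean) (UNIV::'a set)) (PiE UNIV (\<lambda>g. {- B g..B g}))"
    by (subst compactin_PiE) auto
  then have "compact (PiE UNIV (\<lambda>g. {- B g..B g}))"
    by (simp add: euclidean_product_topology)
  also have "PiE UNIV (\<lambda>g. {- B g..B g}) = {L :: 'a \<Rightarrow> real. \<forall>g. \<bar>L g\<bar> \<le> B g}"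
    by (auto simp: PiE_iff abs_le_iff minus_le_iff)
  finally show ?thesis .
qed

text \<open>Banach-Alaoglu along filters: view \<open>v i\<close> as the functional
  \<open>g \<mapsto> v i \<bullet> g\<close>, take a cluster point in the product space, and
  represent it by a vector.\<close>

lemma bounded_imp_weak_cluster_point:
  fixes v :: "'i \<Rightarrow> 'h::{real_inner,complete_space}"
  assumes F: "F \<noteq> bot" and bound: "\<forall>\<^sub>F i in F. norm (v i) \<le> K"
  shows "\<exists>G x. G \<noteq> bot \<and> G \<le> F \<and> (\<forall>g. ((\<lambda>i. v i \<bullet> g) \<longlongrightarrow> x \<bullet> g) G)"
proof -
  define \<Phi> where "\<Phi> i = (\<lambda>g. v i \<bullet> g)" for i
  let ?S = "{L :: 'h \<Rightarrow> real. \<forall>g. \<bar>L g\<bar> \<le> K * norm g}"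
  have ev: "\<forall>\<^sub>F L in filtermap \<Phi> F. L \<in> ?S"
    unfolding eventually_filtermap using bound
  proof eventually_elim
    case (elim i)
    have "\<bar>v i \<bullet> g\<bar> \<le> K * norm g" for g
      using Cauchy_Schwarz_ineq2[of "v i" g] mult_right_mono[OF elim norm_ge_zero[of g]] by linarith
    then show ?case by (simp add: \<Phi>_def)
  qed
  have "filtermap \<Phi> F \<noteq> bot" using F by (simp add: filtermap_bot_iff)
  with ev obtain L where L: "L \<in> ?S" "inf (nhds L) (filtermap \<Phi> F) \<noteq> bot"
    using compact_PiE_bounds[of "\<lambda>g. K * norm g"] unfolding compact_filter by blast
  \<comment> \<open>\<open>F\<close> refined by the preimages of the neighbourhoods of
    \<open>L\<close>; it is proper because \<open>L\<close> is a cluster point of the image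
    filter.\<close>
  define G where "G = inf F (filtercomap \<Phi> (nhds L))"
  have GF: "G \<le> F" by (simp add: G_def)
  have Gbot: "G \<noteq> bot"
  proof
    assume "G = bot"
    then have "eventually (\<lambda>_. False) (inf F (filtercomap \<Phi> (nhds L)))" by (simp add: G_def)
    then obtain P Q where PQ: "eventually P F" "eventually Q (filtercomap \<Phi> (nhds L))" "\<And>x. P x \<and> Q x \<Longrightarrow> False"
      unfolding eventually_inf by blast
    then obtain R where R: "eventually R (nhds L)" "\<And>x. R (\<Phi> x) \<Longrightarrow> Q x"
      unfolding eventually_filtercomap by blast
    have "eventually (\<lambda>y. \<not> R y) (filtermap \<Phi> F)"
      unfolding eventually_filtermap using PQ(1) by eventually_elim (use R(2) PQ(3) in blast)
    then have "eventually (\<lambda>_. False) (inf (nhds L) (filtermap \<Phi> F))"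
      unfolding eventually_inf using R(1) by blast
    then show False using L(2) by (simp add: trivial_limit_def)
  qed
  have lim\<Phi>: "filterlim \<Phi> (nhds L) G"
    unfolding G_def by (metis filterlim_filtercomap filterlim_inf filterlim_mono inf.cobounded2 order_refl)
  have lim: "((\<lambda>i. v i \<bullet> g) \<longlongrightarrow> L g) G" for g
  proof -
    have "continuous_on UNIV (\<lambda>L :: 'h \<Rightarrow> real. L g)"
      by (rule continuous_on_product_coordinates)
    from continuous_on_tendsto_compose[OF this lim\<Phi>] show ?thesis by (simp add: \<Phi>_def)
  qed
  \<comment> \<open>Limits along \<open>G\<close> make \<open>L\<close> linear, so its graph is a
    subspace to which the Riesz argument applies.\<close>
  let ?T = "range (\<lambda>h. (h, L h))"
  have "L (x + y) = L x + L y" for x y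
    using tendsto_unique[OF Gbot lim[of "x + y"], of "L x + L y"] tendsto_add[OF lim[of x] lim[of y]]
    by (simp add: inner_simps)
  moreover have "L (c *\<^sub>R x) = c * L x" for c x
    using tendsto_unique[OF Gbot lim[of "c *\<^sub>R x"], of "c * L x"] tendsto_mult_left[OF lim[of x], of c]
    by (simp add: inner_simps)
  ultimately have "linear L" by (intro linearI) auto
  then have "subspace ?T"
    by (auto simp: subspace_def linear_0 linear_add linear_cmul image_iff zero_prod_def)
  then have "\<exists>x. \<forall>h r. (h, r) \<in> ?T \<longrightarrow> r = x \<bullet> h"
    by (rule riesz_graph[where K = K]) (use L(1) in auto)
  then obtain x where x: "\<forall>h r. (h, r) \<in> ?T \<longrightarrow> r = x \<bullet> h" by blast
  have "L h = x \<bullet> h" for h using x by blast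
  then show ?thesis using Gbot GF lim by auto
qed

text \<open>If convergence failed against some \<open>g\<close>, \<open>F\<close> could be
  restricted to indices that stay \<open>e\<close> away from the limit. A cluster point along the
  restricted filter must be \<open>w\<close>, which contradicts the restriction.\<close>

lemma tendsto_of_weak_cluster_points:
  fixes v :: "'i \<Rightarrow> 'h::{real_inner,complete_space}"
  assumes bound: "\<forall>\<^sub>F i in F. norm (v i) \<le> K"
    and uniq: "\<And>G x. G \<noteq> bot \<Longrightarrow> G \<le> F \<Longrightarrow> (\<And>g. ((\<lambda>i. v i \<bullet> g) \<longlongrightarrow> x \<bullet> g) G) \<Longrightarrow> x = w"
  shows "((\<lambda>i. v i \<bullet> g) \<longlongrightarrow> w \<bullet> g) F"
proof (rule ccontr)
  assume "\<not> ?thesis"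
  then obtain e where e: "e > 0" "\<not> (\<forall>\<^sub>F i in F. dist (v i \<bullet> g) (w \<bullet> g) < e)"
    unfolding tendsto_iff by blast
  define F' where "F' = inf F (principal {i. \<not> dist (v i \<bullet> g) (w \<bullet> g) < e})"
  have F': "F' \<noteq> bot"
    using e(2) unfolding F'_def trivial_limit_def eventually_inf_principal by simp
  have "\<forall>\<^sub>F i in F'. norm (v i) \<le> K"
    using bound unfolding F'_def eventually_inf_principal by eventually_elim simp
  from bounded_imp_weak_cluster_point[OF F' this] obtain G x where
    G: "G \<noteq> bot" "G \<le> F'" "\<And>g. ((\<lambda>i. v i \<bullet> g) \<longlongrightarrow> x \<bullet> g) G" by blast
  have "x = w" using uniq[OF G(1) _ G(3)] G(2) by (simp add: F'_def)
  then have "\<forall>\<^sub>F i in G. dist (v i \<bullet> g) (w \<bullet> g) < e"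
    using G(3)[of g] e(1) unfolding tendsto_iff by blast
  moreover have "\<forall>\<^sub>F i in G. \<not> dist (v i \<bullet> g) (w \<bullet> g) < e"
    by (rule filter_leD[OF G(2)]) (simp add: F'_def eventually_inf_principal)
  ultimately have "\<forall>\<^sub>F i in G. False" by eventually_elim simp
  then show False using G(1) by (simp add: trivial_limit_def)
qed

lemma tendsto_inner_weak_strong:
  fixes v g :: "'i \<Rightarrow> 'h::real_inner"
  assumes "\<forall>\<^sub>F i in F. norm (v i) \<le> K" "((\<lambda>i. v i \<bullet> h) \<longlongrightarrow> x \<bullet> h) F" "(g \<longlongrightarrow> h) F"
  shows "((\<lambda>i. v i \<bullet> g i) \<longlongrightarrow> x \<bullet> h) F"
proof -
  have "((\<lambda>i. v i \<bullet> (g i - h)) \<longlongrightarrow> 0) F"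
  proof (rule Lim_null_comparison)
    show "\<forall>\<^sub>F i in F. norm (v i \<bullet> (g i - h)) \<le> K * norm (g i - h)"
      using assms(1)
    proof eventually_elim
      case (elim i)
      then show ?case
        using Cauchy_Schwarz_ineq2[of "v i" "g i - h"] mult_right_mono[OF elim norm_ge_zero[of "g i - h"]] by auto
    qed
    have "((\<lambda>i. K * norm (g i - h)) \<longlongrightarrow> K * norm (h - h)) F"
      by (intro tendsto_intros assms(3))
    then show "((\<lambda>i. K * norm (g i - h)) \<longlongrightarrow> 0) F" by simp
  qed
  from tendsto_add[OF this assms(2)] show ?thesis by (simp add: inner_simps)
qed

text \<open>Homogeneity: apply the quadratic bound to the normalised vectors. The predicates
  \<open>P\<close> and \<open>Q\<close> admit bounds known only on sets closed under scaling, such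
  as functions supported in a given set.\<close>

lemma bilinear_bound_of_quadratic:
  fixes B :: "'h::real_inner \<Rightarrow> 'h \<Rightarrow> real" and P Q :: "'h \<Rightarrow> bool"
  assumes sc1: "\<And>c u v. P u \<Longrightarrow> B (c *\<^sub>R u) v = c * B u v" and sc2: "\<And>c u v. Q v \<Longrightarrow> B u (c *\<^sub>R v) = c * B u v"
    and P: "\<And>c u. P u \<Longrightarrow> P (c *\<^sub>R u)" and Q: "\<And>c u. Q u \<Longrightarrow> Q (c *\<^sub>R u)"
    and q: "\<And>u v. P u \<Longrightarrow> Q v \<Longrightarrow> \<bar>B u v\<bar> \<le> l * ((norm u)\<^sup>2 + (norm v)\<^sup>2) / 2"
    and uv: "P u" "Q v"
  shows "\<bar>B u v\<bar> \<le> l * norm u * norm v"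
proof (cases "u = 0 \<or> v = 0")
  case True
  then have "B u v = 0" using sc1[of u 0 v] sc2[of v u 0] uv by auto
  then show ?thesis using True by auto
next
  case False
  then have n: "norm u > 0" "norm v > 0" by auto
  have "\<bar>B ((1 / norm u) *\<^sub>R u) ((1 / norm v) *\<^sub>R v)\<bar>
      \<le> l * ((norm ((1 / norm u) *\<^sub>R u))\<^sup>2 + (norm ((1 / norm v) *\<^sub>R v))\<^sup>2) / 2"
    by (intro q P Q uv)
  also have "\<dots> = l" using n by simp
  also have "B ((1 / norm u) *\<^sub>R u) ((1 / norm v) *\<^sub>R v) = B u v / (norm u * norm v)"
    using sc1[OF uv(1)] sc2[OF uv(2)] P Q uv by simp
  finally show ?thesis using n by (simp add: abs_divide abs_mult field_simps)
qed

section \<open>Convolution with continuous kernels of bounded support\<close>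

lemma integral_lebesgue_affine:
  fixes f :: "'a::euclidean_space \<Rightarrow> real"
  assumes f: "f \<in> borel_measurable borel" and c: "c \<noteq> 0"
  shows "(\<integral>x. f x \<partial>lebesgue) = \<bar>c\<bar> ^ DIM('a) * (\<integral>x. f (t + c *\<^sub>R x) \<partial>lebesgue)"
proof -
  have T [measurable]: "(\<lambda>x::'a. t + c *\<^sub>R x) \<in> borel_measurable borel" by simp
  have "(\<integral>x. f x \<partial>lebesgue) = (\<integral>x. f x \<partial>lborel)"
    using f by (intro integral_completion) simp
  also have "\<dots> = (\<integral>x. \<bar>c\<bar> ^ DIM('a) * f (t + c *\<^sub>R x) \<partial>lborel)"
    by (subst lborel_affine[OF c, of t]) (use f in \<open>simp add: integral_density integral_distr\<close>)
  also have "\<dots> = \<bar>c\<bar> ^ DIM('a) * (\<integral>x. f (t + c *\<^sub>R x) \<partial>lebesgue)"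
    using f by (simp add: integral_completion)
  finally show ?thesis .
qed

lemma integral_lebesgue_reflect:
  fixes f :: "'a::euclidean_space \<Rightarrow> real"
  assumes f: "f \<in> borel_measurable borel"
  shows "(\<integral>x. f (t - x) \<partial>lebesgue) = (\<integral>x. f x \<partial>lebesgue)"
  using integral_lebesgue_affine[OF f, of "-1" t] by simp

lemma integrable_lebesgue_bounded_support:
  fixes f :: "'a::euclidean_space \<Rightarrow> real"
  assumes f: "f \<in> borel_measurable lebesgue" and B: "\<And>x. \<bar>f x\<bar> \<le> B" and R: "\<And>x. f x \<noteq> 0 \<Longrightarrow> norm x \<le> R"
  shows "integrable lebesgue f"
proof (rule Bochner_Integration.integrable_bound)
  have "cball (0::'a) R \<in> lmeasurable" by simp
  then show "integrable lebesgue (\<lambda>x. B * indicator (cball (0::'a) R) x)"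
    by (intro integrable_mult_right) (simp add: lmeasurable_iff_integrable)
  show "AE x in lebesgue. norm (f x) \<le> norm (B * indicator (cball 0 R) x)"
  proof (intro AE_I2)
    fix x
    show "norm (f x) \<le> norm (B * indicator (cball 0 R) x)"
      using B[of x] R[of x] by (cases "f x = 0") auto
  qed
qed (rule f)

text \<open>Continuity makes \<open>k (x - y)\<close> measurable on the product; bounded support
  makes \<open>k\<close> bounded, integrable and square integrable. Kernels may change sign, as the
  first-moment kernel \<open>Q\<close> does.\<close>

definition ckernel :: "('a::euclidean_space \<Rightarrow> real) \<Rightarrow> bool" where
  "ckernel k \<longleftrightarrow> continuous_on UNIV k \<and> (\<exists>R. \<forall>z. k z \<noteq> 0 \<longrightarrow> norm z \<le> R)"

lemma ckernel_borel: "ckernel k \<Longrightarrow> k \<in> borel_measurable borel"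
  by (simp add: ckernel_def borel_measurable_continuous_onI)

lemma ckernel_lebesgue: "ckernel k \<Longrightarrow> k \<in> borel_measurable lebesgue"
  by (intro measurable_completion) (simp add: ckernel_borel)

lemma ckernel_bounded:
  assumes "ckernel k" shows "\<exists>B. \<forall>z. \<bar>k z\<bar> \<le> B"
proof -
  obtain R where R: "\<And>z. k z \<noteq> 0 \<Longrightarrow> norm z \<le> R" using assms by (auto simp: ckernel_def)
  have "bounded (k ` cball 0 R)"
    using assms by (intro compact_imp_bounded compact_continuous_image)
      (auto simp: ckernel_def intro: continuous_on_subset)
  then obtain B where "\<forall>x\<in>cball 0 R. \<bar>k x\<bar> \<le> B" by (auto simp: bounded_iff)
  then have B: "\<And>z. norm z \<le> R \<Longrightarrow> \<bar>k z\<bar> \<le> B" by simp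
  have "\<bar>k z\<bar> \<le> max B 0" for z
    using B[of z] R[of z] by (cases "k z = 0") auto
  then show ?thesis by blast
qed

lemma ckernel_mult_continuous:
  assumes "ckernel k" "continuous_on UNIV h"
  shows "ckernel (\<lambda>z. k z * h z)"
proof -
  obtain R where "\<And>z. k z \<noteq> 0 \<Longrightarrow> norm z \<le> R" using assms by (auto simp: ckernel_def)
  then have "\<forall>z. k z * h z \<noteq> 0 \<longrightarrow> norm z \<le> R" by auto
  moreover have "continuous_on UNIV (\<lambda>z. k z * h z)"
    using assms by (intro continuous_on_mult) (auto simp: ckernel_def)
  ultimately show ?thesis unfolding ckernel_def by auto
qed

lemma ckernel_abs: "ckernel k \<Longrightarrow> ckernel (\<lambda>z. \<bar>k z\<bar>)"
  unfolding ckernel_def by (auto intro: continuous_on_rabs)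

lemma ckernel_integrable: "ckernel k \<Longrightarrow> integrable lebesgue k"
proof -
  assume k: "ckernel k"
  obtain B where "\<And>z. \<bar>k z\<bar> \<le> B" using ckernel_bounded[OF k] by auto
  moreover obtain R where "\<And>z. k z \<noteq> 0 \<Longrightarrow> norm z \<le> R" using k by (auto simp: ckernel_def)
  ultimately show ?thesis by (intro integrable_lebesgue_bounded_support[OF ckernel_lebesgue[OF k]])
qed

lemma ckernel_L2: "ckernel k \<Longrightarrow> k \<in> L2 UNIV"
  unfolding L2_UNIV_iff power2_eq_square
  by (intro conjI ckernel_lebesgue ckernel_integrable ckernel_mult_continuous) (auto simp: ckernel_def)

lemma ckernel_reflect:
  assumes "ckernel k" shows "ckernel (\<lambda>y. k (x - y))"
proof -
  obtain R where R: "\<And>z. k z \<noteq> 0 \<Longrightarrow> norm z \<le> R" using assms by (auto simp: ckernel_def)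
  have "norm y \<le> norm x + R" if "k (x - y) \<noteq> 0" for y
    using R[OF that] norm_triangle_ineq4[of x "x - y"] by simp
  moreover have "continuous_on UNIV (\<lambda>y. k (x - y))"
    using assms by (intro continuous_on_compose2[of UNIV k UNIV "\<lambda>y. x - y"] continuous_intros)
      (auto simp: ckernel_def)
  ultimately show ?thesis unfolding ckernel_def by blast
qed

lemma ckernel_uminus: "ckernel k \<Longrightarrow> ckernel (\<lambda>y. k (- y))"
  using ckernel_reflect[of k 0] by simp

section \<open>Double integrals against a difference kernel\<close>

lemma measurable_lebesgue_borel: "(\<lambda>x::'a::euclidean_space. x) \<in> borel_measurable lebesgue"
  by (rule measurable_completion) simp

lemma fst_borel_lebesgue:
  "fst \<in> borel_measurable (lebesgue \<Otimes>\<^sub>M (lebesgue :: 'b::euclidean_space measure) :: ('a::euclidean_space \<times> 'b) measure)"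
  by (rule measurable_compose[OF measurable_fst measurable_lebesgue_borel])

lemma snd_borel_lebesgue:
  "snd \<in> borel_measurable ((lebesgue :: 'a::euclidean_space measure) \<Otimes>\<^sub>M lebesgue :: ('a \<times> 'b::euclidean_space) measure)"
  by (rule measurable_compose[OF measurable_snd measurable_lebesgue_borel])

text \<open>A product of two completed measures, not the completed measure of the product space.
  Difference kernels stay measurable because they are Borel and the projections are measurable into
  the Borel space.\<close>

abbreviation lebesgue2 :: "('a::euclidean_space \<times> 'a) measure" where
  "lebesgue2 \<equiv> lebesgue \<Otimes>\<^sub>M lebesgue"

lemma ckernel_diff_measurable:
  assumes "ckernel k" shows "(\<lambda>p. k (fst p - snd p)) \<in> borel_measurable lebesgue2"
  by (rule measurable_compose[OF borel_measurable_diff[OF fst_borel_lebesgue snd_borel_lebesgue] ckernel_borel[OF assms]])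

lemma ckernel_integrable_fst:
  fixes k :: "'a::euclidean_space \<Rightarrow> real"
  assumes k: "ckernel k" and G: "integrable lebesgue G"
  shows "integrable lebesgue2 (\<lambda>p. k (fst p - snd p) * G (fst p))" (is ?I)
    and "(\<integral>p. k (fst p - snd p) * G (fst p) \<partial>lebesgue2) = (\<integral>x. k x \<partial>lebesgue) * (\<integral>x. G x \<partial>lebesgue)" (is ?E)
proof -
  have Gm [measurable]: "G \<in> borel_measurable lebesgue" using G by simp
  have [measurable]: "(\<lambda>p. k (fst p - snd p)) \<in> borel_measurable lebesgue2"
    by (rule ckernel_diff_measurable[OF k])
  have int: "(\<integral>y. k (x - y) \<partial>lebesgue) = (\<integral>y. k y \<partial>lebesgue)" "(\<integral>y. \<bar>k (x - y)\<bar> \<partial>lebesgue) = (\<integral>y. \<bar>k y\<bar> \<partial>lebesgue)" for x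
    using integral_lebesgue_reflect[OF ckernel_borel[OF k]] integral_lebesgue_reflect[OF ckernel_borel[OF ckernel_abs[OF k]]]
    by auto
  show I: ?I
  proof (rule lebesgue_pair.Fubini_integrable)
    have "integrable lebesgue (\<lambda>x. (\<integral>y. \<bar>k y\<bar> \<partial>lebesgue) * \<bar>G x\<bar>)"
      using G by (intro integrable_mult_right integrable_abs)
    then show "integrable lebesgue (\<lambda>x. \<integral>y. norm (k (fst (x, y) - snd (x, y)) * G (fst (x, y))) \<partial>lebesgue)"
      by (simp add: abs_mult int)
    show "AE x in lebesgue. integrable lebesgue (\<lambda>y. k (fst (x, y) - snd (x, y)) * G (fst (x, y)))"
      using ckernel_integrable[OF ckernel_reflect[OF k]] by simp
  qed measurable
  have "(\<integral>p. k (fst p - snd p) * G (fst p) \<partial>lebesgue2) = (\<integral>x. \<integral>y. k (x - y) * G x \<partial>lebesgue \<partial>lebesgue)"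
    using lebesgue_pair.integral_fst'[OF I] by simp
  then show ?E by (simp add: int)
qed

lemma ckernel_integrable_snd:
  fixes k :: "'a::euclidean_space \<Rightarrow> real"
  assumes k: "ckernel k" and G: "integrable lebesgue G"
  shows "integrable lebesgue2 (\<lambda>p. k (fst p - snd p) * G (snd p))" (is ?I)
    and "(\<integral>p. k (fst p - snd p) * G (snd p) \<partial>lebesgue2) = (\<integral>x. k x \<partial>lebesgue) * (\<integral>x. G x \<partial>lebesgue)" (is ?E)
proof -
  note fst = ckernel_integrable_fst[OF ckernel_uminus[OF k] G]
  have eq: "(\<lambda>(x, y). (\<lambda>p. k (- (fst p - snd p)) * G (fst p)) (y, x)) = (\<lambda>p. k (fst p - snd p) * G (snd p))"
    by (auto simp: fun_eq_iff)
  show ?I using lebesgue_pair.integrable_product_swap[OF fst(1)] unfolding eq .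
  show ?E
    using lebesgue_pair.integral_product_swap[OF borel_measurable_integrable[OF fst(1)]] fst(2)
      integral_lebesgue_reflect[OF ckernel_borel[OF k], of 0]
    unfolding eq by simp
qed

lemma ckernel_integrable_cross:
  fixes k :: "'a::euclidean_space \<Rightarrow> real"
  assumes k: "ckernel k" and u: "u \<in> L2 UNIV" "v \<in> L2 UNIV"
  shows "integrable lebesgue2 (\<lambda>p. k (fst p - snd p) * (u (snd p) * v (fst p)))"
proof (rule Bochner_Integration.integrable_bound)
  have [measurable]: "u \<in> borel_measurable lebesgue" "v \<in> borel_measurable lebesgue"
    "(\<lambda>p. k (fst p - snd p)) \<in> borel_measurable lebesgue2"
    using u k by (auto simp: L2_UNIV_iff ckernel_diff_measurable)
  show "integrable lebesgue2 (\<lambda>p. \<bar>k (fst p - snd p)\<bar> * (u (snd p))\<^sup>2 + \<bar>k (fst p - snd p)\<bar> * (v (fst p))\<^sup>2)"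
    using u by (intro Bochner_Integration.integrable_add ckernel_integrable_fst ckernel_integrable_snd ckernel_abs k)
      (auto simp: L2_UNIV_iff)
  show "(\<lambda>p. k (fst p - snd p) * (u (snd p) * v (fst p))) \<in> borel_measurable lebesgue2"
    by measurable
  show "AE p in lebesgue2. norm (k (fst p - snd p) * (u (snd p) * v (fst p)))
    \<le> norm (\<bar>k (fst p - snd p)\<bar> * (u (snd p))\<^sup>2 + \<bar>k (fst p - snd p)\<bar> * (v (fst p))\<^sup>2)"
  proof (intro AE_I2)
    fix p :: "'a \<times> 'a"
    have "norm (k (fst p - snd p) * (u (snd p) * v (fst p))) = \<bar>k (fst p - snd p)\<bar> * \<bar>u (snd p) * v (fst p)\<bar>"
      by (simp add: abs_mult)
    also have "\<dots> \<le> \<bar>k (fst p - snd p)\<bar> * ((u (snd p))\<^sup>2 + (v (fst p))\<^sup>2)"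
      by (intro mult_left_mono abs_mult_le_sum_sq) auto
    finally show "norm (k (fst p - snd p) * (u (snd p) * v (fst p)))
      \<le> norm (\<bar>k (fst p - snd p)\<bar> * (u (snd p))\<^sup>2 + \<bar>k (fst p - snd p)\<bar> * (v (fst p))\<^sup>2)"
      by (simp add: distrib_left)
  qed
qed

section \<open>Convolution as an operator on classes\<close>

definition conv :: "('a::euclidean_space \<Rightarrow> real) \<Rightarrow> ('a \<Rightarrow> real) \<Rightarrow> 'a \<Rightarrow> real" where
  "conv k u x = (\<integral>y. k (x - y) * u y \<partial>lebesgue)"

lemma conv_eq_inner:
  assumes "ckernel k" "u \<in> L2 UNIV"
  shows "conv k u x = cls (\<lambda>y. k (x - y)) \<bullet> cls u"
  unfolding conv_def using assms by (simp add: inner_cls ckernel_L2 ckernel_reflect)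

lemma conv_integrable:
  assumes "ckernel k" "u \<in> L2 UNIV"
  shows "integrable lebesgue (\<lambda>y. k (x - y) * u y)"
  using assms by (intro L2_integrable_mult[OF ckernel_L2[OF ckernel_reflect]])

lemma conv_measurable:
  assumes k: "ckernel k" and u: "u \<in> L2 UNIV"
  shows "conv k u \<in> borel_measurable lebesgue"
proof -
  have [measurable]: "u \<in> borel_measurable lebesgue"
    "(\<lambda>p. k (fst p - snd p)) \<in> borel_measurable lebesgue2"
    using u k by (auto simp: L2_UNIV_iff ckernel_diff_measurable)
  have "(\<lambda>p. k (fst p - snd p) * u (snd p)) \<in> borel_measurable lebesgue2"
    by measurable
  then have "case_prod (\<lambda>x y. k (x - y) * u y) \<in> borel_measurable lebesgue2"
    by (simp add: case_prod_beta')
  from lebesgue.borel_measurable_lebesgue_integral[OF this] show ?thesis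
    by (simp add: conv_def[abs_def])
qed

text \<open>Pointwise half of Young's inequality: Cauchy-Schwarz after splitting the kernel into two
  factors of size \<open>sqrt \<bar>k\<bar>\<close>. Integrating the bound in \<open>x\<close> gives
  square integrability of the convolution.\<close>

lemma conv_sq_le:
  assumes k: "ckernel k" and u: "u \<in> L2 UNIV"
  shows "(conv k u x)\<^sup>2 \<le> (\<integral>z. \<bar>k z\<bar> \<partial>lebesgue) * (\<integral>y. \<bar>k (x - y)\<bar> * (u y)\<^sup>2 \<partial>lebesgue)"
proof -
  have [measurable]: "u \<in> borel_measurable lebesgue" "(\<lambda>y. k (x - y)) \<in> borel_measurable lebesgue"
    using u k by (auto simp: L2_UNIV_iff ckernel_lebesgue ckernel_reflect)
  \<comment> \<open>The sign of the kernel goes into \<open>p\<close>, so that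
    \<open>p y * q y\<close> is the integrand itself.\<close>
  define p where "p y = (if k (x - y) < 0 then - 1 else 1) * sqrt \<bar>k (x - y)\<bar>" for y
  define q where "q y = sqrt \<bar>k (x - y)\<bar> * u y" for y
  have p2: "(p y)\<^sup>2 = \<bar>k (x - y)\<bar>" and q2: "(q y)\<^sup>2 = \<bar>k (x - y)\<bar> * (u y)\<^sup>2" and pq: "p y * q y = k (x - y) * u y" for y
    by (auto simp: p_def q_def power_mult_distrib)
  obtain B where B: "\<And>z. \<bar>k z\<bar> \<le> B" using ckernel_bounded[OF k] by auto
  have [measurable]: "p \<in> borel_measurable lebesgue"
    unfolding p_def by measurable
  have p: "p \<in> L2 UNIV"
    unfolding L2_UNIV_iff p2 using ckernel_integrable[OF ckernel_abs[OF ckernel_reflect[OF k]]]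
    by auto
  have "integrable lebesgue (\<lambda>y. \<bar>k (x - y)\<bar> * (u y)\<^sup>2)"
  proof (rule Bochner_Integration.integrable_bound)
    show "integrable lebesgue (\<lambda>y. B * (u y)\<^sup>2)"
      using u by (auto simp: L2_UNIV_iff)
    show "AE y in lebesgue. norm (\<bar>k (x - y)\<bar> * (u y)\<^sup>2) \<le> norm (B * (u y)\<^sup>2)"
    proof (intro AE_I2)
      fix y
      have "\<bar>k (x - y)\<bar> * (u y)\<^sup>2 \<le> \<bar>B\<bar> * (u y)\<^sup>2"
        using B[of "x - y"] by (intro mult_right_mono) auto
      then show "norm (\<bar>k (x - y)\<bar> * (u y)\<^sup>2) \<le> norm (B * (u y)\<^sup>2)" by (simp add: abs_mult)
    qed
  qed measurable
  moreover have "q \<in> borel_measurable lebesgue"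
    unfolding q_def by measurable
  ultimately have q: "q \<in> L2 UNIV"
    unfolding L2_UNIV_iff q2 by auto
  have "(conv k u x)\<^sup>2 = (cls p \<bullet> cls q)\<^sup>2"
    using p q by (simp add: inner_cls conv_def pq)
  also have "\<dots> \<le> (cls p \<bullet> cls p) * (cls q \<bullet> cls q)"
    by (rule Cauchy_Schwarz_ineq)
  also have "\<dots> = (\<integral>y. \<bar>k (x - y)\<bar> \<partial>lebesgue) * (\<integral>y. \<bar>k (x - y)\<bar> * (u y)\<^sup>2 \<partial>lebesgue)"
    using p q by (simp add: inner_cls power2_eq_square[symmetric] p2 q2)
  also have "(\<integral>y. \<bar>k (x - y)\<bar> \<partial>lebesgue) = (\<integral>y. \<bar>k y\<bar> \<partial>lebesgue)"
    using integral_lebesgue_reflect[OF ckernel_borel[OF ckernel_abs[OF k]]] .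
  finally show ?thesis .
qed

lemma conv_L2:
  assumes k: "ckernel k" and u: "u \<in> L2 UNIV"
  shows "conv k u \<in> L2 UNIV"
  unfolding L2_UNIV_iff
proof (intro conjI conv_measurable assms)
  show "integrable lebesgue (\<lambda>x. (conv k u x)\<^sup>2)"
  proof (rule Bochner_Integration.integrable_bound)
    have "integrable lebesgue2 (\<lambda>p. \<bar>k (fst p - snd p)\<bar> * (u (snd p))\<^sup>2)"
      using u by (intro ckernel_integrable_snd ckernel_abs k) (auto simp: L2_UNIV_iff)
    from lebesgue_pair.integrable_fst'[OF this]
    show "integrable lebesgue (\<lambda>x. (\<integral>z. \<bar>k z\<bar> \<partial>lebesgue) * (\<integral>y. \<bar>k (x - y)\<bar> * (u y)\<^sup>2 \<partial>lebesgue))"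
      by (intro integrable_mult_right) simp
    show "AE x in lebesgue. norm ((conv k u x)\<^sup>2) \<le>
      norm ((\<integral>z. \<bar>k z\<bar> \<partial>lebesgue) * (\<integral>y. \<bar>k (x - y)\<bar> * (u y)\<^sup>2 \<partial>lebesgue))"
      using conv_sq_le[OF k u] by (intro AE_I2) (smt (verit) real_norm_def zero_le_power2)
  qed (use conv_measurable[OF k u] in measurable)
qed

lemma conv_inner:
  assumes k: "ckernel k" and u: "u \<in> L2 UNIV" and v: "v \<in> L2 UNIV"
  shows "(\<integral>x. conv k u x * v x \<partial>lebesgue) = (\<integral>p. k (fst p - snd p) * (u (snd p) * v (fst p)) \<partial>lebesgue2)"
proof -
  have "(\<integral>p. k (fst p - snd p) * (u (snd p) * v (fst p)) \<partial>lebesgue2)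
     = (\<integral>x. \<integral>y. k (x - y) * u y * v x \<partial>lebesgue \<partial>lebesgue)"
    using lebesgue_pair.integral_fst'[OF ckernel_integrable_cross[OF k u v]] by (simp add: mult.assoc)
  also have "\<dots> = (\<integral>x. conv k u x * v x \<partial>lebesgue)"
    by (simp add: conv_def)
  finally show ?thesis by simp
qed

definition Conv :: "('a::euclidean_space \<Rightarrow> real) \<Rightarrow> 'a l2 \<Rightarrow> 'a l2" where
  "Conv k u = cls (conv k (fn u))"

lemma Conv_inner:
  assumes "ckernel k"
  shows "Conv k u \<bullet> v = (\<integral>p. k (fst p - snd p) * (fn u (snd p) * fn v (fst p)) \<partial>lebesgue2)"
proof -
  have "Conv k u \<bullet> v = Conv k u \<bullet> cls (fn v)" by simp
  also have "\<dots> = (\<integral>x. conv k (fn u) x * fn v x \<partial>lebesgue)"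
    unfolding Conv_def using assms by (subst inner_cls) (auto intro: conv_L2)
  finally show ?thesis using assms by (simp add: conv_inner)
qed

text \<open>Each value \<open>conv k u x\<close> is an inner product with the class of
  \<open>u\<close>, so changing the representative alters the convolution at no point at all, not
  merely outside a null set.\<close>

lemma Conv_cls:
  assumes k: "ckernel k" and u: "u \<in> L2 UNIV"
  shows "Conv k (cls u) = cls (conv k u)"
proof -
  have "conv k (fn (cls u)) = conv k u"
    using u by (auto simp: fun_eq_iff conv_eq_inner[OF k])
  then show ?thesis by (simp add: Conv_def)
qed

lemma Conv_linear:
  assumes k: "ckernel k" shows "linear (Conv k)"
proof (rule linearI)
  fix u v :: "'a l2" and c :: real
  have fnadd: "cls (fn (u + v)) = cls (fn u) + cls (fn v)" and fnsc: "cls (fn (c *\<^sub>R u)) = c *\<^sub>R cls (fn u)"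
    by simp_all
  have "conv k (fn (u + v)) = (\<lambda>x. conv k (fn u) x + conv k (fn v) x)"
    by (auto simp: conv_eq_inner[OF k] inner_simps)
  then show "Conv k (u + v) = Conv k u + Conv k v"
    by (simp add: Conv_def cls_add conv_L2[OF k])
  have "conv k (fn (c *\<^sub>R u)) = (\<lambda>x. c * conv k (fn u) x)"
    by (auto simp: conv_eq_inner[OF k] inner_simps)
  then show "Conv k (c *\<^sub>R u) = c *\<^sub>R Conv k u"
    by (simp add: Conv_def cls_cmult conv_L2[OF k])
qed

lemma Conv_adjoint:
  assumes k: "ckernel k"
  shows "Conv k u \<bullet> v = u \<bullet> Conv (\<lambda>z. k (- z)) v"
proof -
  have eq: "(\<lambda>(x, y). (\<lambda>p. k (- (fst p - snd p)) * (fn v (snd p) * fn u (fst p))) (y, x)) =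
    (\<lambda>p. k (fst p - snd p) * (fn u (snd p) * fn v (fst p)))"
    by (auto simp: fun_eq_iff)
  have "Conv (\<lambda>z. k (- z)) v \<bullet> u = (\<integral>p. k (- (fst p - snd p)) * (fn v (snd p) * fn u (fst p)) \<partial>lebesgue2)"
    by (rule Conv_inner[OF ckernel_uminus[OF k]])
  also have "\<dots> = (\<integral>p. k (fst p - snd p) * (fn u (snd p) * fn v (fst p)) \<partial>lebesgue2)"
    using lebesgue_pair.integral_product_swap[OF borel_measurable_integrable[OF
      ckernel_integrable_cross[OF ckernel_uminus[OF k] fn_L2[of v] fn_L2[of u]]]]
    unfolding eq by simp
  finally show ?thesis
    by (simp only: Conv_inner[OF k, of u v] inner_commute[of u])
qed

lemma norm_fn_sq: "(\<integral>x. (fn u x)\<^sup>2 \<partial>lebesgue) = (norm u)\<^sup>2"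
  using norm_cls_sq[OF fn_L2[of u]] by simp

lemma ckernel_integral_fst_sq:
  "ckernel k \<Longrightarrow> (\<integral>p. k (fst p - snd p) * (fn u (fst p))\<^sup>2 \<partial>lebesgue2) = (\<integral>z. k z \<partial>lebesgue) * (norm u)\<^sup>2"
  using ckernel_integrable_fst(2)[of k "\<lambda>x. (fn u x)\<^sup>2"] by (simp add: L2_integrable_sq norm_fn_sq)

lemma ckernel_integral_snd_sq:
  "ckernel k \<Longrightarrow> (\<integral>p. k (fst p - snd p) * (fn u (snd p))\<^sup>2 \<partial>lebesgue2) = (\<integral>z. k z \<partial>lebesgue) * (norm u)\<^sup>2"
  using ckernel_integrable_snd(2)[of k "\<lambda>x. (fn u x)\<^sup>2"] by (simp add: L2_integrable_sq norm_fn_sq)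

text \<open>Schur's test with constant weight:
  \<open>2 * \<bar>a * b\<bar> \<le> a\<^sup>2 + b\<^sup>2\<close> under the kernel, both of whose
  marginals have the mass of \<open>\<bar>k\<bar>\<close>.\<close>

lemma Conv_inner_le:
  assumes k: "ckernel k"
  shows "\<bar>Conv k u \<bullet> v\<bar> \<le> (\<integral>z. \<bar>k z\<bar> \<partial>lebesgue) * ((norm u)\<^sup>2 + (norm v)\<^sup>2) / 2"
proof -
  let ?g = "\<lambda>p. (\<bar>k (fst p - snd p)\<bar> * (fn u (snd p))\<^sup>2 + \<bar>k (fst p - snd p)\<bar> * (fn v (fst p))\<^sup>2) / 2"
  have I: "integrable lebesgue2 (\<lambda>p. \<bar>k (fst p - snd p)\<bar> * (fn u (snd p))\<^sup>2)"
     "integrable lebesgue2 (\<lambda>p. \<bar>k (fst p - snd p)\<bar> * (fn v (fst p))\<^sup>2)"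
    by (auto intro!: ckernel_integrable_fst ckernel_integrable_snd ckernel_abs k L2_integrable_sq)
  note cross = ckernel_integrable_cross[OF k fn_L2[of u] fn_L2[of v]]
  have "\<bar>Conv k u \<bullet> v\<bar> \<le> (\<integral>p. norm (k (fst p - snd p) * (fn u (snd p) * fn v (fst p))) \<partial>lebesgue2)"
    unfolding Conv_inner[OF k] real_norm_def[symmetric] by (rule integral_norm_bound)
  also have "\<dots> \<le> (\<integral>p. ?g p \<partial>lebesgue2)"
  proof (rule integral_mono[OF integrable_norm[OF cross]])
    show "integrable lebesgue2 ?g"
      using I by auto
    fix p :: "'a \<times> 'a"
    have "norm (k (fst p - snd p) * (fn u (snd p) * fn v (fst p))) = \<bar>k (fst p - snd p)\<bar> * \<bar>fn u (snd p) * fn v (fst p)\<bar>"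
      by (simp add: abs_mult)
    also have "\<dots> \<le> \<bar>k (fst p - snd p)\<bar> * (((fn u (snd p))\<^sup>2 + (fn v (fst p))\<^sup>2) / 2)"
      using zero_le_power2[of "\<bar>fn u (snd p)\<bar> - \<bar>fn v (fst p)\<bar>"]
      by (intro mult_left_mono) (simp_all add: power2_diff abs_mult)
    finally show "norm (k (fst p - snd p) * (fn u (snd p) * fn v (fst p))) \<le> ?g p"
      by (simp add: algebra_simps)
  qed
  also have "\<dots> = (\<integral>z. \<bar>k z\<bar> \<partial>lebesgue) * ((norm u)\<^sup>2 + (norm v)\<^sup>2) / 2"
    using I by (simp add: ckernel_integral_fst_sq[OF ckernel_abs[OF k]] ckernel_integral_snd_sq[OF ckernel_abs[OF k]]
      distrib_left)
  finally show ?thesis .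
qed

text \<open>The quadratic bound is homogenised and then tested with \<open>Conv k u\<close>
  itself.\<close>

lemma Conv_norm_le:
  assumes k: "ckernel k"
  shows "norm (Conv k u) \<le> (\<integral>z. \<bar>k z\<bar> \<partial>lebesgue) * norm u"
proof -
  have lin: "linear (Conv k)" by (rule Conv_linear[OF k])
  have "\<bar>Conv k u \<bullet> Conv k u\<bar> \<le> (\<integral>z. \<bar>k z\<bar> \<partial>lebesgue) * norm u * norm (Conv k u)"
  proof (rule bilinear_bound_of_quadratic[where B = "\<lambda>u v. Conv k u \<bullet> v" and P = "\<lambda>_. True" and Q = "\<lambda>_. True"])
    show "\<bar>Conv k u \<bullet> v\<bar> \<le> (\<integral>z. \<bar>k z\<bar> \<partial>lebesgue) * ((norm u)\<^sup>2 + (norm v)\<^sup>2) / 2" for u v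
      by (rule Conv_inner_le[OF k])
  qed (auto simp: linear_cmul[OF lin])
  then have "norm (Conv k u) * norm (Conv k u) \<le> (\<integral>z. \<bar>k z\<bar> \<partial>lebesgue) * norm u * norm (Conv k u)"
    by (simp add: power2_norm_eq_inner[symmetric] power2_eq_square)
  then show ?thesis
    by (cases "norm (Conv k u) = 0") (auto intro!: mult_nonneg_nonneg)
qed


section \<open>Restriction to a set, and the spectral gap of restricted convolution\<close>

definition Res :: "'a::euclidean_space set \<Rightarrow> 'a l2 \<Rightarrow> 'a l2" where
  "Res S u = cls (\<lambda>x. indicator S x * fn u x)"

lemma L2_indicator:
  fixes f :: "'a::euclidean_space \<Rightarrow> real"
  assumes S: "S \<in> sets lebesgue" and f: "f \<in> L2 UNIV"
  shows "(\<lambda>x. indicator S x * f x) \<in> L2 UNIV"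
  unfolding L2_UNIV_iff
proof
  have [measurable]: "f \<in> borel_measurable lebesgue" "S \<in> sets lebesgue"
    using f S by (auto simp: L2_UNIV_iff)
  show "(\<lambda>x. indicator S x * f x) \<in> borel_measurable lebesgue" by measurable
  show "integrable lebesgue (\<lambda>x. (indicator S x * f x)\<^sup>2)"
  proof (rule Bochner_Integration.integrable_bound[OF L2_integrable_sq[OF f]])
    show "AE x in lebesgue. norm ((indicator S x * f x)\<^sup>2) \<le> norm ((f x)\<^sup>2)"
      by (intro AE_I2) (simp add: indicator_def)
  qed measurable
qed

lemma Res_cls:
  fixes f :: "'a::euclidean_space \<Rightarrow> real"
  assumes S: "S \<in> sets lebesgue" and f: "f \<in> L2 UNIV"
  shows "Res S (cls f) = cls (\<lambda>x. indicator S x * f x)"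
  unfolding Res_def
  by (subst cls_eq_iff) (use fn_cls_AE[OF f] L2_indicator[OF S] f in auto)

lemma Res_inner:
  assumes S: "S \<in> sets lebesgue"
  shows "Res S u \<bullet> v = (\<integral>x. indicator S x * (fn u x * fn v x) \<partial>lebesgue)"
  using inner_cls[OF L2_indicator[OF S fn_L2[of u]] fn_L2[of v]] by (simp add: Res_def mult.assoc)

lemma Res_inner_commute:
  assumes S: "S \<in> sets lebesgue"
  shows "Res S u \<bullet> v = u \<bullet> Res S v"
  using Res_inner[OF S, of u v] Res_inner[OF S, of v u]
  by (simp add: inner_commute mult.commute)

lemma Res_linear:
  assumes S: "S \<in> sets lebesgue"
  shows "linear (Res S)"
proof (rule linearI)
  fix u v :: "'a l2" and c :: real
  have "cls (\<lambda>x. fn u x + fn v x) = u + v" "cls (\<lambda>x. c * fn u x) = c *\<^sub>R u"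
    by (simp_all add: cls_add cls_cmult)
  then show "Res S (u + v) = Res S u + Res S v" "Res S (c *\<^sub>R u) = c *\<^sub>R Res S u"
    using Res_cls[OF S L2_add[of "fn u" "fn v"]] Res_cls[OF S L2_cmult[of "fn u" c]]
      cls_add[OF L2_indicator[OF S fn_L2[of u]] L2_indicator[OF S fn_L2[of v]]]
      cls_cmult[OF L2_indicator[OF S fn_L2[of u]], of c]
    by (simp_all add: Res_def distrib_left mult.left_commute)
qed

lemma Res_Res:
  assumes S: "S \<in> sets lebesgue" "T \<in> sets lebesgue"
  shows "Res S (Res T u) = Res (S \<inter> T) u"
  unfolding Res_def[of T] Res_cls[OF S(1) L2_indicator[OF S(2) fn_L2]]
  by (simp add: Res_def indicator_inter_arith mult.assoc)

lemma Res_norm_le: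
  assumes S: "S \<in> sets lebesgue"
  shows "norm (Res S u) \<le> norm u"
proof -
  have "(norm (Res S u))\<^sup>2 = Res S (Res S u) \<bullet> u"
    by (simp add: power2_norm_eq_inner Res_inner_commute[OF S])
  also have "\<dots> \<le> norm (Res S u) * norm u"
    using S by (simp add: Res_Res norm_cauchy_schwarz)
  finally show ?thesis
    by (cases "norm (Res S u) = 0") (auto simp: power2_eq_square)
qed

text \<open>The weight \<open>h\<close> is a strict supersolution: convolving \<open>R\<^sup>2 - \<bar>x\<bar>\<^sup>2\<close> with an even kernel of mass one
  lowers it by the second moment. The cut-off at zero is invisible from the ball of radius \<open>r\<close>.\<close>

lemma ckernel_weight_bound:
  fixes k :: "'a::euclidean_space \<Rightarrow> real"
  assumes k: "ckernel k" and k0: "\<And>z. 0 \<le> k z" and even: "\<And>z. k (- z) = k z" and k1: "(\<integral>z. k z \<partial>lebesgue) = 1"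
    and supp: "\<And>z. k z \<noteq> 0 \<Longrightarrow> norm z \<le> \<rho>" and r: "0 \<le> r" "r < R" "r + \<rho> \<le> R"
    and v: "v \<in> L2 UNIV" "\<And>x. v x \<noteq> 0 \<Longrightarrow> norm x \<le> r"
  defines "h \<equiv> \<lambda>y::'a. max 0 (R\<^sup>2 - (norm y)\<^sup>2)"
  shows "integrable lebesgue2 (\<lambda>p. k (fst p - snd p) * ((v (fst p))\<^sup>2 / h (fst p) * h (snd p)))" (is ?I)
    and "(\<integral>p. k (fst p - snd p) * ((v (fst p))\<^sup>2 / h (fst p) * h (snd p)) \<partial>lebesgue2)
      \<le> (1 - (\<integral>z. k z * (norm z)\<^sup>2 \<partial>lebesgue) / R\<^sup>2) * (\<integral>x. (v x)\<^sup>2 \<partial>lebesgue)" (is ?E)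
proof -
  let ?M = "\<integral>z. k z * (norm z)\<^sup>2 \<partial>lebesgue"
  have vm: "v \<in> borel_measurable lebesgue" using v by (simp add: L2_UNIV_iff)
  have hc: "continuous_on UNIV h" unfolding h_def by (intro continuous_intros)
  have hm: "h \<in> borel_measurable lebesgue"
    using hc by (intro measurable_completion) (simp add: borel_measurable_continuous_onI)
  have hx: "h x = R\<^sup>2 - (norm x)\<^sup>2" "R\<^sup>2 - r\<^sup>2 \<le> h x" "0 < R\<^sup>2 - r\<^sup>2" if "norm x \<le> r" for x
  proof -
    have "(norm x)\<^sup>2 \<le> r\<^sup>2" "r\<^sup>2 < R\<^sup>2" using that r by (auto intro: power_mono power_strict_mono)
    then show "h x = R\<^sup>2 - (norm x)\<^sup>2" "R\<^sup>2 - r\<^sup>2 \<le> h x" "0 < R\<^sup>2 - r\<^sup>2" by (auto simp: h_def)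
  qed
  have hR: "h y \<le> R\<^sup>2" "0 \<le> h y" for y by (auto simp: h_def)
  \<comment> \<open>Where \<open>v\<close> is nonzero, \<open>h\<close> is at least
    \<open>R\<^sup>2 - r\<^sup>2\<close>; elsewhere \<open>G\<close> is zero, even where
    \<open>h\<close> vanishes.\<close>
  define G where "G x = (v x)\<^sup>2 / h x" for x
  have Gm: "G \<in> borel_measurable lebesgue" unfolding G_def using vm hm by measurable
  have R2: "0 < R\<^sup>2" using r by auto
  have G: "integrable lebesgue G"
  proof (rule Bochner_Integration.integrable_bound[OF _ Gm])
    show "integrable lebesgue (\<lambda>x. (v x)\<^sup>2 / (R\<^sup>2 - r\<^sup>2))" using v by (auto simp: L2_UNIV_iff)
    show "AE x in lebesgue. norm (G x) \<le> norm ((v x)\<^sup>2 / (R\<^sup>2 - r\<^sup>2))"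
    proof (intro AE_I2)
      fix x show "norm (G x) \<le> norm ((v x)\<^sup>2 / (R\<^sup>2 - r\<^sup>2))"
        using v(2)[of x] hx[of x] by (cases "v x = 0") (auto simp: G_def intro!: divide_left_mono)
    qed
  qed
  have km: "(\<lambda>p. k (fst p - snd p)) \<in> borel_measurable lebesgue2" by (rule ckernel_diff_measurable[OF k])
  show I: ?I
  proof (rule Bochner_Integration.integrable_bound)
    show "integrable lebesgue2 (\<lambda>p. R\<^sup>2 * (k (fst p - snd p) * G (fst p)))"
      by (intro integrable_mult_right ckernel_integrable_fst k G)
    show "(\<lambda>p. k (fst p - snd p) * ((v (fst p))\<^sup>2 / h (fst p) * h (snd p))) \<in> borel_measurable lebesgue2"
      using km vm hm by measurable
    show "AE p in lebesgue2. norm (k (fst p - snd p) * ((v (fst p))\<^sup>2 / h (fst p) * h (snd p)))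
       \<le> norm (R\<^sup>2 * (k (fst p - snd p) * G (fst p)))"
    proof (intro AE_I2)
      fix p :: "'a \<times> 'a"
      have "\<bar>k (fst p - snd p)\<bar> * \<bar>G (fst p)\<bar> * \<bar>h (snd p)\<bar> \<le> \<bar>k (fst p - snd p)\<bar> * \<bar>G (fst p)\<bar> * R\<^sup>2"
        using hR[of "snd p"] by (intro mult_left_mono) auto
      then show "norm (k (fst p - snd p) * ((v (fst p))\<^sup>2 / h (fst p) * h (snd p)))
       \<le> norm (R\<^sup>2 * (k (fst p - snd p) * G (fst p)))"
        by (simp add: G_def abs_mult mult_ac)
    qed
  qed
  have inner: "(\<integral>y. k (x - y) * h y \<partial>lebesgue) = h x - ?M" if x: "norm x \<le> r" for x
  proof -
    have "(\<integral>y. k (x - y) * h y \<partial>lebesgue) = (\<integral>z. k z * h (x - z) \<partial>lebesgue)"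
      using integral_lebesgue_reflect[of "\<lambda>y. k (x - y) * h y" x] ckernel_borel[OF ckernel_reflect[OF k]]
        borel_measurable_continuous_onI[OF hc] by simp
    also have "\<dots> = (\<integral>z. (R\<^sup>2 - (norm x)\<^sup>2) * k z + 2 * (k z * (x \<bullet> z)) - k z * (norm z)\<^sup>2 \<partial>lebesgue)"
    proof (rule Bochner_Integration.integral_cong[OF refl])
      fix z
      show "k z * h (x - z) = (R\<^sup>2 - (norm x)\<^sup>2) * k z + 2 * (k z * (x \<bullet> z)) - k z * (norm z)\<^sup>2"
      proof (cases "k z = 0")
        case False
        have "norm (x - z) \<le> R"
          using norm_triangle_ineq4[of x z] supp[OF False] x r by linarith
        then have "(norm (x - z))\<^sup>2 \<le> R\<^sup>2" by (intro power_mono) auto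
        then have "h (x - z) = R\<^sup>2 - (norm (x - z))\<^sup>2" by (simp add: h_def)
        also have "(norm (x - z))\<^sup>2 = (norm x)\<^sup>2 - 2 * (x \<bullet> z) + (norm z)\<^sup>2"
          by (simp add: power2_norm_eq_inner inner_simps inner_commute)
        finally have h: "h (x - z) = R\<^sup>2 - ((norm x)\<^sup>2 - 2 * (x \<bullet> z) + (norm z)\<^sup>2)" .
        show ?thesis unfolding h by (simp add: algebra_simps)
      qed simp
    qed
    also have "\<dots> = (R\<^sup>2 - (norm x)\<^sup>2) * 1 + 2 * (\<integral>z. k z * (x \<bullet> z) \<partial>lebesgue) - ?M"
      using k by (simp add: k1[symmetric] ckernel_integrable ckernel_mult_continuous continuous_intros)
    also have "(\<integral>z. k z * (x \<bullet> z) \<partial>lebesgue) = 0"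
    proof -
      have "(\<integral>z. k z * (x \<bullet> z) \<partial>lebesgue) = (\<integral>z. - (k z * (x \<bullet> z)) \<partial>lebesgue)"
        using integral_lebesgue_reflect[of "\<lambda>z. k z * (x \<bullet> z)" 0]
          ckernel_borel[OF ckernel_mult_continuous[OF k, of "\<lambda>z. x \<bullet> z"]]
        by (simp add: even continuous_intros)
      then show ?thesis by simp
    qed
    finally show ?thesis using hx[OF x] by simp
  qed
  have "(\<integral>p. k (fst p - snd p) * ((v (fst p))\<^sup>2 / h (fst p) * h (snd p)) \<partial>lebesgue2)
    = (\<integral>x. \<integral>y. k (x - y) * (G x * h y) \<partial>lebesgue \<partial>lebesgue)"
    using lebesgue_pair.integral_fst'[OF I] by (simp add: G_def)
  also have "\<dots> = (\<integral>x. G x * (\<integral>y. k (x - y) * h y \<partial>lebesgue) \<partial>lebesgue)"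
    by (simp add: mult.left_commute)
  also have "\<dots> = (\<integral>x. (v x)\<^sup>2 - ?M * G x \<partial>lebesgue)"
  proof (rule Bochner_Integration.integral_cong[OF refl])
    fix x show "G x * (\<integral>y. k (x - y) * h y \<partial>lebesgue) = (v x)\<^sup>2 - ?M * G x"
    proof (cases "v x = 0")
      case False
      then have x: "norm x \<le> r" by (rule v(2))
      show ?thesis unfolding inner[OF x] using hx(2,3)[OF x] by (simp add: G_def field_simps)
    qed (simp add: G_def)
  qed
  \<comment> \<open>The \<open>R\<^sup>2\<close> in the gap is the maximum of \<open>h\<close>: on
    the support of \<open>v\<close> the quotient \<open>1 / h\<close> is at least
    \<open>1 / R\<^sup>2\<close>.\<close>
  also have "\<dots> \<le> (\<integral>x. (1 - ?M / R\<^sup>2) * (v x)\<^sup>2 \<partial>lebesgue)"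
  proof (rule integral_mono)
    have M: "0 \<le> ?M" by (intro Bochner_Integration.integral_nonneg) (simp add: k0)
    fix x
    have "(v x)\<^sup>2 / R\<^sup>2 \<le> G x"
      using v(2)[of x] hx[of x] hR[of x] R2 by (cases "v x = 0") (auto simp: G_def intro!: divide_left_mono)
    from mult_left_mono[OF this M] show "(v x)\<^sup>2 - ?M * G x \<le> (1 - ?M / R\<^sup>2) * (v x)\<^sup>2"
      by (simp add: algebra_simps)
  qed (use v G in \<open>auto simp: L2_UNIV_iff\<close>)
  finally show ?E by simp
qed

text \<open>Schur's test with the weight \<open>h\<close>. Under the kernel
  \<open>\<bar>f y * g x\<bar>\<close> is at most half of
  \<open>(f y)\<^sup>2 * h x / h y + (g x)\<^sup>2 * h y / h x\<close>, and
  \<open>ckernel_weight_bound\<close> controls both terms. A constant weight would only give the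
  factor 1.\<close>

lemma Conv_Res_le:
  fixes k :: "'a::euclidean_space \<Rightarrow> real"
  assumes k: "ckernel k" and k0: "\<And>z. 0 \<le> k z" and even: "\<And>z. k (- z) = k z" and k1: "(\<integral>z. k z \<partial>lebesgue) = 1"
    and supp: "\<And>z. k z \<noteq> 0 \<Longrightarrow> norm z \<le> \<rho>" and r: "0 \<le> r" "r < R" "r + \<rho> \<le> R"
    and S: "S \<in> sets lebesgue" "S \<subseteq> cball 0 r"
  defines "l \<equiv> 1 - (\<integral>z. k z * (norm z)\<^sup>2 \<partial>lebesgue) / R\<^sup>2"
  shows "\<bar>Conv k (Res S u) \<bullet> Res S v\<bar> \<le> l * norm (Res S u) * norm (Res S v)"
proof -
  have quad: "\<bar>Conv k (Res S u) \<bullet> Res S v\<bar> \<le> l * ((norm (Res S u))\<^sup>2 + (norm (Res S v))\<^sup>2) / 2" for u v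
  proof -
    define h where "h y = max 0 (R\<^sup>2 - (norm y)\<^sup>2)" for y :: 'a
    define f where "f x = indicator S x * fn u x" for x
    define g where "g x = indicator S x * fn v x" for x
    have L: "f \<in> L2 UNIV" "g \<in> L2 UNIV"
      unfolding f_def g_def by (auto intro: L2_indicator S)
    have fs: "f x \<noteq> 0 \<Longrightarrow> norm x \<le> r" and gs: "g x \<noteq> 0 \<Longrightarrow> norm x \<le> r" for x
      using S(2) by (auto simp: f_def g_def indicator_def split: if_splits)
    note wf = ckernel_weight_bound[OF k k0 even k1 supp r L(1) fs, folded h_def l_def]
    note wg = ckernel_weight_bound[OF k k0 even k1 supp r L(2) gs, folded h_def l_def]
    have eq: "(\<lambda>(x, y). (\<lambda>p. k (fst p - snd p) * ((f (fst p))\<^sup>2 / h (fst p) * h (snd p))) (y, x))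
       = (\<lambda>p. k (fst p - snd p) * ((f (snd p))\<^sup>2 / h (snd p) * h (fst p)))"
      using even by (auto simp: fun_eq_iff) (metis minus_diff_eq)
    have wf': "integrable lebesgue2 (\<lambda>p. k (fst p - snd p) * ((f (snd p))\<^sup>2 / h (snd p) * h (fst p)))"
       "(\<integral>p. k (fst p - snd p) * ((f (snd p))\<^sup>2 / h (snd p) * h (fst p)) \<partial>lebesgue2) \<le> l * (\<integral>x. (f x)\<^sup>2 \<partial>lebesgue)"
      using lebesgue_pair.integrable_product_swap[OF wf(1)] lebesgue_pair.integral_product_swap[OF borel_measurable_integrable[OF wf(1)]] wf(2)
      unfolding eq by simp_all
    have "\<bar>Conv k (Res S u) \<bullet> Res S v\<bar> = \<bar>\<integral>p. k (fst p - snd p) * (f (snd p) * g (fst p)) \<partial>lebesgue2\<bar>"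
      unfolding Res_def f_def[symmetric] g_def[symmetric] Conv_cls[OF k L(1)]
      by (simp add: inner_cls conv_L2[OF k] L conv_inner[OF k])
    also have "\<dots> \<le> (\<integral>p. norm (k (fst p - snd p) * (f (snd p) * g (fst p))) \<partial>lebesgue2)"
      unfolding real_norm_def[symmetric] by (rule integral_norm_bound)
    also have "\<dots> \<le> (\<integral>p. (k (fst p - snd p) * ((f (snd p))\<^sup>2 / h (snd p) * h (fst p)) + k (fst p - snd p) * ((g (fst p))\<^sup>2 / h (fst p) * h (snd p))) / 2 \<partial>lebesgue2)"
    proof (rule integral_mono)
      show "integrable lebesgue2 (\<lambda>p. norm (k (fst p - snd p) * (f (snd p) * g (fst p))))"
        by (intro integrable_norm ckernel_integrable_cross k L)
      show "integrable lebesgue2 (\<lambda>p. (k (fst p - snd p) * ((f (snd p))\<^sup>2 / h (snd p) * h (fst p)) + k (fst p - snd p) * ((g (fst p))\<^sup>2 / h (fst p) * h (snd p))) / 2)"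
        using wf'(1) wg(1) by auto
      fix p :: "'a \<times> 'a"
      have h0: "0 \<le> h y" for y by (simp add: h_def)
      have hpos: "0 < h y" if "norm y \<le> r" for y
      proof -
        have "(norm y)\<^sup>2 \<le> r\<^sup>2" "r\<^sup>2 < R\<^sup>2" using that r by (auto intro: power_mono power_strict_mono)
        then show ?thesis by (simp add: h_def)
      qed
      have "\<bar>f (snd p) * g (fst p)\<bar> \<le> ((f (snd p))\<^sup>2 / h (snd p) * h (fst p) + (g (fst p))\<^sup>2 / h (fst p) * h (snd p)) / 2"
      proof (cases "f (snd p) = 0 \<or> g (fst p) = 0")
        case True then show ?thesis using h0[of "fst p"] h0[of "snd p"] by auto
      next
        case False
        \<comment> \<open>Young's inequality with the ratio of the weights as parameter.\<close>
        define a where "a = h (fst p) / h (snd p)"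
        have hp: "0 < h (fst p)" "0 < h (snd p)" using False fs gs hpos by auto
        have a: "a > 0" using hp by (simp add: a_def)
        have "0 \<le> (\<bar>f (snd p)\<bar> * a - \<bar>g (fst p)\<bar>)\<^sup>2" by simp
        then have "2 * \<bar>f (snd p) * g (fst p)\<bar> * a \<le> (f (snd p))\<^sup>2 * a\<^sup>2 + (g (fst p))\<^sup>2"
          by (simp add: power2_diff power_mult_distrib abs_mult mult_ac)
        then have "2 * \<bar>f (snd p) * g (fst p)\<bar> \<le> ((f (snd p))\<^sup>2 * a\<^sup>2 + (g (fst p))\<^sup>2) / a"
          using a by (simp add: field_simps)
        also have "\<dots> = (f (snd p))\<^sup>2 / h (snd p) * h (fst p) + (g (fst p))\<^sup>2 / h (fst p) * h (snd p)"
          using hp by (simp add: a_def field_simps power2_eq_square)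
        finally show ?thesis by simp
      qed
      from mult_left_mono[OF this k0[of "fst p - snd p"]]
      show "norm (k (fst p - snd p) * (f (snd p) * g (fst p)))
        \<le> (k (fst p - snd p) * ((f (snd p))\<^sup>2 / h (snd p) * h (fst p)) + k (fst p - snd p) * ((g (fst p))\<^sup>2 / h (fst p) * h (snd p))) / 2"
        using k0[of "fst p - snd p"] by (simp add: abs_mult algebra_simps)
    qed
    also have "\<dots> \<le> (l * (\<integral>x. (f x)\<^sup>2 \<partial>lebesgue) + l * (\<integral>x. (g x)\<^sup>2 \<partial>lebesgue)) / 2"
      using wf' wg by simp
    also have "(\<integral>x. (f x)\<^sup>2 \<partial>lebesgue) = (norm (Res S u))\<^sup>2"
      using norm_cls_sq[OF L(1)] by (simp add: Res_def f_def[symmetric])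
    also have "(\<integral>x. (g x)\<^sup>2 \<partial>lebesgue) = (norm (Res S v))\<^sup>2"
      using norm_cls_sq[OF L(2)] by (simp add: Res_def g_def[symmetric])
    finally show ?thesis by (simp add: distrib_left)
  qed
  \<comment> \<open>Functions supported in \<open>S\<close>, as the fixed points of the projection;
    the quadratic bound is homogenised on this subspace.\<close>
  let ?P = "\<lambda>u. Res S u = u"
  have RR: "Res S (Res S u) = Res S u" for u using S(1) by (simp add: Res_Res)
  show ?thesis
  proof (rule bilinear_bound_of_quadratic[where B = "\<lambda>u v. Conv k u \<bullet> v" and P = ?P and Q = ?P])
    fix u v assume "Res S u = u" "Res S v = v"
    with quad[of u v] show "\<bar>Conv k u \<bullet> v\<bar> \<le> l * ((norm u)\<^sup>2 + (norm v)\<^sup>2) / 2" by simp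
  qed (auto simp: RR linear_cmul[OF Conv_linear[OF k]] linear_cmul[OF Res_linear[OF S(1)]])
qed

text \<open>Because \<open>q\<close> has integral zero, \<open>u x\<close> may be replaced by the
  increment \<open>u x - u y\<close> in the pairing. Young's inequality with parameter
  \<open>s\<close> then meets the energy: the double integral of
  \<open>k (x - y) * (u x - u y)\<^sup>2\<close> equals
  \<open>2 * ((norm u)\<^sup>2 - Conv k u \<bullet> u)\<close>, whence the factor
  \<open>2 / s\<close>.\<close>

lemma Conv_odd_energy_bound:
  fixes k q :: "'a::euclidean_space \<Rightarrow> real"
  assumes k: "ckernel k" and q: "ckernel q" and le: "\<And>z. \<bar>q z\<bar> \<le> c * k z" and q0: "(\<integral>z. q z \<partial>lebesgue) = 0"
    and k1: "(\<integral>z. k z \<partial>lebesgue) = 1" and s: "0 < s"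
  shows "\<bar>Conv q v \<bullet> u\<bar> \<le> c * (s * (norm v)\<^sup>2 + 2 / s * ((norm u)\<^sup>2 - Conv k u \<bullet> u)) / 2"
proof -
  let ?u = "fn u" and ?v = "fn v"
  have I1: "integrable lebesgue2 (\<lambda>p. q (fst p - snd p) * (?v (snd p) * ?u (fst p)))"
    and I2: "integrable lebesgue2 (\<lambda>p. q (fst p - snd p) * (?v (snd p) * ?u (snd p)))"
    and I3: "integrable lebesgue2 (\<lambda>p. k (fst p - snd p) * (?v (snd p))\<^sup>2)"
    and I4: "integrable lebesgue2 (\<lambda>p. k (fst p - snd p) * (?u (snd p))\<^sup>2)"
    and I5: "integrable lebesgue2 (\<lambda>p. k (fst p - snd p) * (?u (fst p))\<^sup>2)"
    and I6: "integrable lebesgue2 (\<lambda>p. k (fst p - snd p) * (?u (snd p) * ?u (fst p)))"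
    using ckernel_integrable_cross[OF q, of ?v ?u] ckernel_integrable_snd(1)[OF q L2_integrable_mult[of ?v ?u]]
      ckernel_integrable_snd(1)[OF k L2_integrable_sq[of ?v]] ckernel_integrable_snd(1)[OF k L2_integrable_sq[of ?u]]
      ckernel_integrable_fst(1)[OF k L2_integrable_sq[of ?u]] ckernel_integrable_cross[OF k, of ?u ?u]
    by auto
  have z: "(\<integral>p. q (fst p - snd p) * (?v (snd p) * ?u (snd p)) \<partial>lebesgue2) = 0"
    using ckernel_integrable_snd(2)[OF q L2_integrable_mult[of ?v ?u]] q0 by simp
  have "Conv q v \<bullet> u = (\<integral>p. q (fst p - snd p) * (?v (snd p) * ?u (fst p)) - q (fst p - snd p) * (?v (snd p) * ?u (snd p)) \<partial>lebesgue2)"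
    unfolding Conv_inner[OF q] Bochner_Integration.integral_diff[OF I1 I2] z by simp
  then have "\<bar>Conv q v \<bullet> u\<bar> \<le> (\<integral>p. norm (q (fst p - snd p) * (?v (snd p) * ?u (fst p)) - q (fst p - snd p) * (?v (snd p) * ?u (snd p))) \<partial>lebesgue2)"
    unfolding real_norm_def[symmetric] by (simp only: integral_norm_bound)
  also have "\<dots> \<le> (\<integral>p. c / 2 * (s * (k (fst p - snd p) * (?v (snd p))\<^sup>2) + (1 / s) * (k (fst p - snd p) * (?u (fst p))\<^sup>2
     + k (fst p - snd p) * (?u (snd p))\<^sup>2 - 2 * (k (fst p - snd p) * (?u (snd p) * ?u (fst p))))) \<partial>lebesgue2)"
  proof (rule integral_mono)
    fix p :: "'a \<times> 'a"
    let ?a = "?v (snd p)" and ?d = "?u (fst p) - ?u (snd p)"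
    have "0 \<le> (s * \<bar>?a\<bar> - \<bar>?d\<bar>)\<^sup>2" by simp
    then have "2 * \<bar>?a * ?d\<bar> * s \<le> s\<^sup>2 * ?a\<^sup>2 + ?d\<^sup>2"
      by (simp add: power2_diff power_mult_distrib abs_mult mult_ac)
    then have "\<bar>?a * ?d\<bar> \<le> (s * ?a\<^sup>2 + (1 / s) * ?d\<^sup>2) / 2"
      using s by (simp add: field_simps power2_eq_square)
    then have "\<bar>q (fst p - snd p)\<bar> * \<bar>?a * ?d\<bar> \<le> (c * k (fst p - snd p)) * ((s * ?a\<^sup>2 + (1 / s) * ?d\<^sup>2) / 2)"
      by (intro mult_mono le) (use le[of "fst p - snd p"] in \<open>auto intro: order_trans[OF abs_ge_zero]\<close>)
    also have "\<dots> = c / 2 * (s * (k (fst p - snd p) * ?a\<^sup>2) + (1 / s) * (k (fst p - snd p) * (?u (fst p))\<^sup>2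
     + k (fst p - snd p) * (?u (snd p))\<^sup>2 - 2 * (k (fst p - snd p) * (?u (snd p) * ?u (fst p)))))"
      using s by (simp add: power2_diff field_simps)
    finally show "norm (q (fst p - snd p) * (?v (snd p) * ?u (fst p)) - q (fst p - snd p) * (?v (snd p) * ?u (snd p))) \<le>
      c / 2 * (s * (k (fst p - snd p) * (?v (snd p))\<^sup>2) + (1 / s) * (k (fst p - snd p) * (?u (fst p))\<^sup>2
     + k (fst p - snd p) * (?u (snd p))\<^sup>2 - 2 * (k (fst p - snd p) * (?u (snd p) * ?u (fst p)))))"
      by (simp add: abs_mult[symmetric] right_diff_distrib[symmetric])
  qed (use I1 I2 I3 I4 I5 I6 in auto)
  also have "\<dots> = c / 2 * (s * (norm v)\<^sup>2 + (1 / s) * ((norm u)\<^sup>2 + (norm u)\<^sup>2 - 2 * (Conv k u \<bullet> u)))"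
    using I3 I4 I5 I6 by (simp add: ckernel_integral_fst_sq[OF k] ckernel_integral_snd_sq[OF k] k1 Conv_inner[OF k])
  also have "\<dots> = c * (s * (norm v)\<^sup>2 + 2 / s * ((norm u)\<^sup>2 - Conv k u \<bullet> u)) / 2"
    using s by (simp add: field_simps)
  finally show ?thesis .
qed

section \<open>Moments of a radial kernel\<close>

lemma prod_Basis_cart: "(\<Prod>b\<in>Basis. w \<bullet> b) = (\<Prod>i\<in>UNIV. (w :: real^'n) $ i)"
proof -
  have B: "(Basis :: (real^'n) set) = range (\<lambda>i. axis i 1)"
    by (auto simp: Basis_vec_def)
  have "inj (\<lambda>i::'n. axis i (1::real))" by (auto simp: inj_on_def axis_eq_axis)
  then show ?thesis unfolding B by (simp add: prod.reindex cart_eq_inner_axis)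
qed

text \<open>Lebesgue measure is determined by its values on boxes, and a signed permutation pulls a
  box back to a box: coordinates are relabelled, and a negative sign swaps the two endpoints and
  negates them.\<close>

lemma lborel_signed_permutation:
  fixes \<pi> :: "'n::finite \<Rightarrow> 'n" and s :: "'n \<Rightarrow> real"
  assumes \<pi>: "bij \<pi>" and s: "\<And>i. s i = 1 \<or> s i = - 1"
  defines "T \<equiv> \<lambda>x :: real^'n. \<chi> i. s i * x $ \<pi> i"
  shows "distr lborel borel T = lborel"
proof (rule lborel_eqI[symmetric])
  have T: "T \<in> borel_measurable borel"
    unfolding T_def by (intro borel_measurable_continuous_onI continuous_intros)
  fix l u :: "real^'n" assume le: "\<And>b. b \<in> Basis \<Longrightarrow> l \<bullet> b \<le> u \<bullet> b"
  have le': "l $ i \<le> u $ i" for i using le[of "axis i 1"] by (simp add: cart_eq_inner_axis axis_in_Basis_iff)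
  define l' where "l' = (\<chi> i. if s (inv \<pi> i) = 1 then l $ inv \<pi> i else - u $ inv \<pi> i)"
  define u' where "u' = (\<chi> i. if s (inv \<pi> i) = 1 then u $ inv \<pi> i else - l $ inv \<pi> i)"
  have inv: "inv \<pi> (\<pi> i) = i" "\<pi> (inv \<pi> i) = i" for i
    using \<pi> by (simp_all add: bij_is_inj bij_is_surj surj_f_inv_f)
  have "T -` box l u = box l' u'"
  proof (rule set_eqI)
    fix x
    have "x \<in> T -` box l u \<longleftrightarrow> (\<forall>i. l $ i < s i * x $ \<pi> i \<and> s i * x $ \<pi> i < u $ i)"
      by (auto simp: T_def mem_box_cart)
    also have "\<dots> \<longleftrightarrow> (\<forall>i. l' $ \<pi> i < x $ \<pi> i \<and> x $ \<pi> i < u' $ \<pi> i)"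
    proof (rule all_cong1)
      fix i show "(l $ i < s i * x $ \<pi> i \<and> s i * x $ \<pi> i < u $ i) = (l' $ \<pi> i < x $ \<pi> i \<and> x $ \<pi> i < u' $ \<pi> i)"
        using s[of i] by (auto simp: l'_def u'_def inv)
    qed
    also have "\<dots> \<longleftrightarrow> (\<forall>i. l' $ i < x $ i \<and> x $ i < u' $ i)"
      by (metis inv(2))
    finally show "x \<in> T -` box l u \<longleftrightarrow> x \<in> box l' u'" by (simp add: mem_box_cart)
  qed
  moreover have "l' \<bullet> b \<le> u' \<bullet> b" if "b \<in> Basis" for b
    using that le' by (auto simp: Basis_vec_def inner_axis l'_def u'_def)
  ultimately have "emeasure (distr lborel borel T) (box l u) = (\<Prod>b\<in>Basis. (u' - l') \<bullet> b)"
    using T by (simp add: emeasure_distr emeasure_lborel_box)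
  also have "(\<Prod>b\<in>Basis. (u' - l') \<bullet> b) = (\<Prod>i\<in>UNIV. (u - l) $ inv \<pi> i)"
    unfolding prod_Basis_cart by (intro prod.cong) (auto simp: l'_def u'_def)
  also have "\<dots> = (\<Prod>i\<in>UNIV. (u - l) $ i)"
    by (rule prod.reindex_bij_betw[of "inv \<pi>" UNIV UNIV "\<lambda>i. (u - l) $ i"]) (simp add: \<pi> bij_imp_bij_inv)
  also have "\<dots> = (\<Prod>b\<in>Basis. (u - l) \<bullet> b)" by (simp only: prod_Basis_cart)
  finally show "emeasure (distr lborel borel T) (box l u) = (\<Prod>b\<in>Basis. (u - l) \<bullet> b)" .
qed simp

lemma integral_signed_permutation:
  fixes \<pi> :: "'n::finite \<Rightarrow> 'n" and s :: "'n \<Rightarrow> real" and f :: "real^'n \<Rightarrow> real"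
  assumes \<pi>: "bij \<pi>" and s: "\<And>i. s i = 1 \<or> s i = - 1" and f: "f \<in> borel_measurable borel"
  shows "(\<integral>x. f (\<chi> i. s i * x $ \<pi> i) \<partial>lebesgue) = (\<integral>x. f x \<partial>lebesgue)"
proof -
  let ?T = "\<lambda>x :: real^'n. \<chi> i. s i * x $ \<pi> i"
  have T: "?T \<in> borel_measurable borel"
    by (intro borel_measurable_continuous_onI continuous_intros)
  have "(\<integral>x. f x \<partial>lebesgue) = (\<integral>x. f x \<partial>lborel)" using f by (intro integral_completion) simp
  also have "\<dots> = (\<integral>x. f x \<partial>distr lborel borel ?T)"
    by (simp add: lborel_signed_permutation[of \<pi> s, OF \<pi> s])
  also have "\<dots> = (\<integral>x. f (?T x) \<partial>lborel)" using f T by (intro integral_distr) auto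
  also have "\<dots> = (\<integral>x. f (?T x) \<partial>lebesgue)"
    using measurable_compose[OF T f] by (intro integral_completion[symmetric]) simp
  finally show ?thesis by simp
qed

lemma norm_signed_permutation:
  fixes \<pi> :: "'n::finite \<Rightarrow> 'n" and s :: "'n \<Rightarrow> real"
  assumes \<pi>: "bij \<pi>" and s: "\<And>i. s i = 1 \<or> s i = - 1"
  shows "norm (\<chi> i. s i * x $ \<pi> i) = norm (x :: real^'n)"
proof -
  have "(\<Sum>i\<in>UNIV. (s i * x $ \<pi> i)\<^sup>2) = (\<Sum>i\<in>UNIV. (x $ \<pi> i)\<^sup>2)"
  proof (rule sum.cong[OF refl])
    fix i show "(s i * x $ \<pi> i)\<^sup>2 = (x $ \<pi> i)\<^sup>2" using s[of i] by auto
  qed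
  also have "\<dots> = (\<Sum>i\<in>UNIV. (x $ i)\<^sup>2)"
    by (rule sum.reindex_bij_betw[of \<pi> UNIV UNIV "\<lambda>i. (x $ i)\<^sup>2"]) (simp add: \<pi>)
  finally show ?thesis by (simp add: norm_vec_def L2_set_def)
qed

section \<open>The rescaled radial kernel and its moments\<close>

definition rescale :: "real \<Rightarrow> (real^'n::finite \<Rightarrow> real) \<Rightarrow> real^'n \<Rightarrow> real" where
  "rescale \<delta> J z = J (z /\<^sub>R \<delta>) / \<delta> ^ CARD('n)"

text \<open>With this number the normalizing constant is \<open>2 / moment2 J k\<close>, so the
  factor \<open>\<delta>\<^sup>2 / C\<close> of the equation becomes
  \<open>\<delta>\<^sup>2 * moment2 J k / 2\<close>.\<close>

definition moment2 :: "(real^'n::finite \<Rightarrow> real) \<Rightarrow> 'n \<Rightarrow> real" where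
  "moment2 J k = (\<integral>x. J x * (x $ k)\<^sup>2 \<partial>lebesgue)"

lemma continuous_on_component_sq: "continuous_on UNIV (\<lambda>x :: real^'n. (x $ i)\<^sup>2)"
  by (intro continuous_on_power continuous_on_component continuous_on_id)

locale radial_kernel =
  fixes J :: "real^'n::finite \<Rightarrow> real" and k :: 'n
  assumes adm: "admissible_kernel J"
begin

lemma J_ckernel: "ckernel J"
proof -
  have c: "continuous_on UNIV J" and "compact (closure {x. J x \<noteq> 0})"
    using adm unfolding admissible_kernel_def by iprover+
  then have "bounded {x. J x \<noteq> 0}"
    by (intro bounded_subset[OF compact_imp_bounded closure_subset])
  then obtain R where "\<forall>x\<in>{x. J x \<noteq> 0}. norm x \<le> R" by (auto simp: bounded_iff)
  then show ?thesis using c unfolding ckernel_def by auto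
qed

lemma J_nonneg: "0 \<le> J z"
  using adm unfolding admissible_kernel_def by (elim conjE) (erule spec)

lemma J_radial: "norm x = norm y \<Longrightarrow> J x = J y"
  using adm unfolding admissible_kernel_def by (elim conjE) iprover

lemma J_0: "0 < J 0" and J_integral: "(\<integral>x. J x \<partial>lebesgue) = 1"
  using adm unfolding admissible_kernel_def by iprover+

text \<open>A support radius of \<open>J\<close>, taken positive so that
  \<open>\<delta> * \<rho>\<close> approaches 0 from the right together with \<delta>.\<close>

definition "\<rho> = (SOME R. R > 0 \<and> (\<forall>z. J z \<noteq> 0 \<longrightarrow> norm z \<le> R))"

lemma rho: "0 < \<rho>" "J z \<noteq> 0 \<Longrightarrow> norm z \<le> \<rho>"
proof -
  obtain R where R: "\<forall>z. J z \<noteq> 0 \<longrightarrow> norm z \<le> R" using J_ckernel by (auto simp: ckernel_def)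
  then have "\<exists>R>0. \<forall>z. J z \<noteq> 0 \<longrightarrow> norm z \<le> R"
    by (intro exI[of _ "max R 1"]) (auto simp: le_max_iff_disj)
  from someI_ex[OF this] show "0 < \<rho>" "J z \<noteq> 0 \<Longrightarrow> norm z \<le> \<rho>"
    unfolding \<rho>_def by auto
qed

abbreviation "m \<equiv> moment2 J k"

text \<open>A radial kernel is invariant under the exchange of coordinates \<open>i\<close> and
  \<open>k\<close>.\<close>

lemma moment_swap: "moment2 J i = m"
proof -
  let ?\<pi> = "Transposition.transpose i k"
  define s :: "'n \<Rightarrow> real" where "s j = 1" for j
  have s: "s j = 1 \<or> s j = - 1" for j by (simp add: s_def)
  have \<pi>: "bij ?\<pi>" by simp
  have meas: "(\<lambda>x. J x * (x $ i)\<^sup>2) \<in> borel_measurable borel"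
    by (intro ckernel_borel ckernel_mult_continuous J_ckernel continuous_on_component_sq)
  have Jh: "J (\<chi> j. s j * z $ ?\<pi> j) * ((\<chi> j. s j * z $ ?\<pi> j) $ i)\<^sup>2 = J z * (z $ k)\<^sup>2" for z
  proof -
    have "J (\<chi> j. s j * z $ ?\<pi> j) = J z"
      by (rule J_radial) (rule norm_signed_permutation[OF \<pi> s])
    then show ?thesis by (simp add: s_def)
  qed
  show ?thesis
    unfolding moment2_def
    using integral_signed_permutation[where \<pi> = ?\<pi> and s = s, OF \<pi> s meas] unfolding Jh by (rule sym)
qed

text \<open>Reflection in the \<open>i\<close>-th coordinate preserves both \<open>J\<close> and the
  measure. It kills the first moments and the mixed second moments at once.\<close>

lemma moment_flip:
  assumes h: "continuous_on UNIV h"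
    and odd: "\<And>x. h (\<chi> j. (if j = i then - 1 else 1) * x $ j) = - h x"
  shows "(\<integral>z. J z * h z \<partial>lebesgue) = 0"
proof -
  define s :: "'n \<Rightarrow> real" where "s j = (if j = i then - 1 else 1)" for j
  have s: "s j = 1 \<or> s j = - 1" for j by (simp add: s_def)
  have meas: "(\<lambda>x. J x * h x) \<in> borel_measurable borel"
    by (intro ckernel_borel ckernel_mult_continuous J_ckernel h)
  have Jh: "J (\<chi> j. s j * z $ id j) * h (\<chi> j. s j * z $ id j) = - (J z * h z)" for z
  proof -
    have "J (\<chi> j. s j * z $ id j) = J z"
      by (rule J_radial) (rule norm_signed_permutation[OF bij_id s])
    moreover have "h (\<chi> j. s j * z $ id j) = - h z" using odd[of z] by (simp add: s_def)
    ultimately show ?thesis by simp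
  qed
  have "(\<integral>z. J z * h z \<partial>lebesgue) = (\<integral>z. - (J z * h z) \<partial>lebesgue)"
    using integral_signed_permutation[where \<pi> = id and s = s, OF bij_id s meas] unfolding Jh by (rule sym)
  then show ?thesis by simp
qed

text \<open>If the moment vanished, the continuous integrand would be zero almost everywhere, hence
  everywhere. But \<open>J\<close> is positive near the origin, so a short nonzero vector along the
  \<open>k\<close>-th axis contradicts this.\<close>

lemma m_pos: "0 < m"
proof -
  have I: "integrable lebesgue (\<lambda>x. J x * (x $ k)\<^sup>2)"
    by (intro ckernel_integrable ckernel_mult_continuous J_ckernel continuous_on_component_sq)
  have nn: "0 \<le> m" unfolding moment2_def by (intro Bochner_Integration.integral_nonneg) (simp add: J_nonneg)
  have "m \<noteq> 0"
  proof
    assume "m = 0"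
    then have ae: "AE x in lebesgue. J x * (x $ k)\<^sup>2 = 0"
      using integral_nonneg_eq_0_iff_AE[OF I] by (simp add: moment2_def J_nonneg)
    have "ckernel (\<lambda>x. J x * (x $ k)\<^sup>2)"
      by (intro ckernel_mult_continuous J_ckernel continuous_on_component_sq)
    then have cont: "continuous_on UNIV (\<lambda>x. J x * (x $ k)\<^sup>2)" by (simp add: ckernel_def)
    have cl: "closed {x. J x * (x $ k)\<^sup>2 = 0}"
      by (rule closed_Collect_eq[OF cont]) simp
    have z: "J x * (x $ k)\<^sup>2 = 0" for x
      using mem_closed_if_AE_lebesgue[OF cl, of x] ae by simp
    have "open {x. 0 < J x}"
      by (rule open_Collect_less) (use J_ckernel in \<open>auto simp: ckernel_def\<close>)
    moreover have "0 \<in> {x. 0 < J x}" by (simp add: J_0)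
    ultimately obtain d where d: "d > 0" "ball 0 d \<subseteq> {x. 0 < J x}"
      by (rule openE)
    define x :: "real^'n" where "x = (d/2) *\<^sub>R axis k 1"
    have "x \<in> ball 0 d" using d(1) by (simp add: x_def norm_axis_1)
    then have "J x \<noteq> 0" using d(2) by auto
    moreover have "x $ k \<noteq> 0" using d(1) by (simp add: x_def)
    ultimately show False using z[of x] by simp
  qed
  then show ?thesis using nn by simp
qed

abbreviation "K \<delta> \<equiv> rescale \<delta> J"

text \<open>Change of variables by the factor \<delta>: every moment of the rescaled kernel reduces
  to one of \<open>J\<close>.\<close>

lemma K_integral:
  assumes \<delta>: "0 < \<delta>" and h: "continuous_on UNIV h"
  shows "(\<integral>z. K \<delta> z * h z \<partial>lebesgue) = (\<integral>z. J z * h (\<delta> *\<^sub>R z) \<partial>lebesgue)"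
proof -
  have hc: "continuous_on UNIV (\<lambda>z. h (\<delta> *\<^sub>R z))"
    by (rule continuous_on_compose2[OF h]) (auto intro!: continuous_intros)
  have "(\<lambda>z. J z * h (\<delta> *\<^sub>R z)) \<in> borel_measurable borel"
    by (intro ckernel_borel ckernel_mult_continuous J_ckernel hc)
  from integral_lebesgue_affine[OF this, of "1 / \<delta>" 0]
  have "(\<integral>z. J z * h (\<delta> *\<^sub>R z) \<partial>lebesgue) = (1 / \<delta>) ^ CARD('n) * (\<integral>z. J (z /\<^sub>R \<delta>) * h z \<partial>lebesgue)"
    using \<delta> by (simp add: inverse_eq_divide)
  also have "\<dots> = (\<integral>z. (1 / \<delta>) ^ CARD('n) * (J (z /\<^sub>R \<delta>) * h z) \<partial>lebesgue)" by simp
  also have "\<dots> = (\<integral>z. K \<delta> z * h z \<partial>lebesgue)"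
    by (intro Bochner_Integration.integral_cong) (auto simp: rescale_def power_divide)
  finally show ?thesis by simp
qed

lemma
  assumes \<delta>: "0 < \<delta>"
  shows K_ckernel: "ckernel (K \<delta>)" and K_nonneg: "0 \<le> K \<delta> z" and K_even: "K \<delta> (- z) = K \<delta> z"
    and K_supp: "K \<delta> z \<noteq> 0 \<Longrightarrow> norm z \<le> \<delta> * \<rho>" and K_1: "(\<integral>z. K \<delta> z \<partial>lebesgue) = 1"
proof -
  show supp: "norm z \<le> \<delta> * \<rho>" if "K \<delta> z \<noteq> 0" for z
    using rho(2)[of "z /\<^sub>R \<delta>"] that \<delta> by (simp add: rescale_def field_simps)
  have "continuous_on UNIV (\<lambda>z. J (z /\<^sub>R \<delta>))"
    by (rule continuous_on_compose2[of UNIV J]) (use J_ckernel in \<open>auto simp: ckernel_def intro!: continuous_intros\<close>)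
  then have "continuous_on UNIV (K \<delta>)"
    unfolding rescale_def using \<delta> by (intro continuous_intros) auto
  then show "ckernel (K \<delta>)" unfolding ckernel_def using supp by blast
  show "0 \<le> K \<delta> z" using \<delta> by (simp add: rescale_def J_nonneg)
  show "K \<delta> (- z) = K \<delta> z" unfolding rescale_def using J_radial[of "(- z) /\<^sub>R \<delta>" "z /\<^sub>R \<delta>"] by simp
  show "(\<integral>z. K \<delta> z \<partial>lebesgue) = 1"
    using K_integral[OF \<delta>, of "\<lambda>_. 1"] by (simp add: J_integral)
qed

lemma K_moment1:
  assumes \<delta>: "0 < \<delta>" shows "(\<integral>z. K \<delta> z * z $ i \<partial>lebesgue) = 0"
proof -
  have "(\<integral>z. J z * (\<delta> *\<^sub>R z) $ i \<partial>lebesgue) = 0"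
    by (rule moment_flip[of _ i]) (auto intro!: continuous_intros)
  then show ?thesis using K_integral[OF \<delta>, of "\<lambda>z. z $ i"] by (simp add: continuous_intros)
qed

lemma K_moment2:
  assumes \<delta>: "0 < \<delta>" shows "(\<integral>z. K \<delta> z * (z $ i * z $ j) \<partial>lebesgue) = (if i = j then \<delta>\<^sup>2 * m else 0)"
proof -
  have "(\<integral>z. J z * ((\<delta> *\<^sub>R z) $ i * (\<delta> *\<^sub>R z) $ j) \<partial>lebesgue) = (if i = j then \<delta>\<^sup>2 * m else 0)"
  proof (cases "i = j")
    case True
    have "(\<integral>z. J z * ((\<delta> *\<^sub>R z) $ i * (\<delta> *\<^sub>R z) $ j) \<partial>lebesgue) = (\<integral>z. \<delta>\<^sup>2 * (J z * (z $ i)\<^sup>2) \<partial>lebesgue)"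
      using True by (intro Bochner_Integration.integral_cong) (auto simp: power2_eq_square)
    also have "\<dots> = \<delta>\<^sup>2 * moment2 J i" by (simp add: moment2_def)
    also have "moment2 J i = m" by (rule moment_swap)
    finally show ?thesis using True by simp
  next
    case False
    have "(\<integral>z. J z * ((\<delta> *\<^sub>R z) $ i * (\<delta> *\<^sub>R z) $ j) \<partial>lebesgue) = 0"
      by (rule moment_flip[of _ i]) (use False in \<open>auto intro!: continuous_intros\<close>)
    then show ?thesis using False by simp
  qed
  then show ?thesis using K_integral[OF \<delta>, of "\<lambda>z. z $ i * z $ j"] by (simp add: continuous_intros)
qed

lemma norm_sq_cart: "(norm (z :: real^'n))\<^sup>2 = (\<Sum>i\<in>UNIV. z $ i * z $ i)"
  by (simp add: norm_vec_def L2_set_def sum_nonneg power2_eq_square)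

lemma K_moment_norm:
  assumes \<delta>: "0 < \<delta>" shows "(\<integral>z. K \<delta> z * (norm z)\<^sup>2 \<partial>lebesgue) = \<delta>\<^sup>2 * (CARD('n) * m)"
proof -
  have "(\<integral>z. K \<delta> z * (norm z)\<^sup>2 \<partial>lebesgue) = (\<integral>z. (\<Sum>i\<in>UNIV. K \<delta> z * (z $ i * z $ i)) \<partial>lebesgue)"
    by (simp add: norm_sq_cart sum_distrib_left)
  also have "\<dots> = (\<Sum>i\<in>(UNIV::'n set). (\<integral>z. K \<delta> z * (z $ i * z $ i) \<partial>lebesgue))"
    by (intro Bochner_Integration.integral_sum ckernel_integrable ckernel_mult_continuous K_ckernel \<delta>)
      (auto intro!: continuous_intros)
  finally show ?thesis by (simp add: K_moment2[OF \<delta>])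
qed

end

section \<open>Test functions\<close>

lemma test_function_C_k: "\<phi> \<in> test_functions \<Omega> \<Longrightarrow> C_k n \<phi>"
  unfolding test_functions_def by auto

lemma test_function_differentiable: "\<phi> \<in> test_functions \<Omega> \<Longrightarrow> \<phi> differentiable (at x)"
  using test_function_C_k[of \<phi> \<Omega> 1] by simp

lemma test_function_continuous: "\<phi> \<in> test_functions \<Omega> \<Longrightarrow> continuous_on UNIV \<phi>"
  using test_function_C_k[of \<phi> \<Omega> 0] by simp

lemma test_function_ckernel: "\<phi> \<in> test_functions \<Omega> \<Longrightarrow> ckernel \<phi>"
proof -
  assume \<phi>: "\<phi> \<in> test_functions \<Omega>"
  then have "compact (closure {x. \<phi> x \<noteq> 0})" by (simp add: test_functions_def)
  then have "bounded {x. \<phi> x \<noteq> 0}"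
    by (intro bounded_subset[OF compact_imp_bounded closure_subset])
  then obtain R where "\<forall>x\<in>{x. \<phi> x \<noteq> 0}. norm x \<le> R" by (auto simp: bounded_iff)
  then show ?thesis using test_function_continuous[OF \<phi>] unfolding ckernel_def by auto
qed

lemma test_function_L2: "\<phi> \<in> test_functions \<Omega> \<Longrightarrow> \<phi> \<in> L2 UNIV"
  by (intro ckernel_L2 test_function_ckernel)

lemma test_function_support:
  assumes "\<phi> \<in> test_functions \<Omega>" "\<phi> x \<noteq> 0" shows "x \<in> \<Omega>"
proof -
  have "x \<in> {x. \<phi> x \<noteq> 0}" using assms(2) by simp
  then have "x \<in> closure {x. \<phi> x \<noteq> 0}" by (rule subsetD[OF closure_subset])
  moreover have "closure {x. \<phi> x \<noteq> 0} \<subseteq> \<Omega>" using assms(1) by (simp add: test_functions_def)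
  ultimately show ?thesis by (rule rev_subsetD)
qed

text \<open>The complement of the closed support is open and the function is zero on it, so the
  derivative vanishes there too.\<close>

lemma partial_deriv_support: "closure {x. partial_deriv i \<phi> x \<noteq> 0} \<subseteq> closure {x. \<phi> x \<noteq> 0}"
proof (rule closure_minimal)
  show "{x. partial_deriv i \<phi> x \<noteq> 0} \<subseteq> closure {x. \<phi> x \<noteq> 0}"
  proof (rule ccontr)
    assume "\<not> ?thesis"
    then obtain x where x: "partial_deriv i \<phi> x \<noteq> 0" "x \<notin> closure {x. \<phi> x \<noteq> 0}" by auto
    have "open (- closure {x. \<phi> x \<noteq> 0})" by (rule open_Compl) (rule closed_closure)
    moreover have "x \<in> - closure {x. \<phi> x \<noteq> 0}" by (rule ComplI) (erule notE[OF x(2)])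
    moreover have "0 = \<phi> y" if "y \<in> - closure {x. \<phi> x \<noteq> 0}" for y
    proof (rule ccontr)
      assume "0 \<noteq> \<phi> y"
      then have "y \<in> {x. \<phi> x \<noteq> 0}" by simp
      then have "y \<in> closure {x. \<phi> x \<noteq> 0}" by (rule subsetD[OF closure_subset])
      then show False by (rule notE[OF ComplD[OF that]])
    qed
    ultimately have "(\<phi> has_derivative (\<lambda>h. 0)) (at x)"
      by (rule has_derivative_transform_within_open[OF has_derivative_const])
    then have "frechet_derivative \<phi> (at x) = (\<lambda>h. 0)" by (rule frechet_derivative_at[symmetric])
    then show False using x(1) by (simp add: partial_deriv_def)
  qed
qed simp

lemma test_function_partial_deriv:
  assumes "\<phi> \<in> test_functions \<Omega>" shows "partial_deriv i \<phi> \<in> test_functions \<Omega>"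
proof -
  have "C_k n (partial_deriv i \<phi>)" for n
    using test_function_C_k[OF assms, of "Suc n"] by simp
  moreover have "compact (closure {x. partial_deriv i \<phi> x \<noteq> 0})"
    using assms closed_Int_compact[OF closed_closure, of "closure {x. \<phi> x \<noteq> 0}" "{x. partial_deriv i \<phi> x \<noteq> 0}"]
      partial_deriv_support[of i \<phi>] by (simp add: test_functions_def Int_absorb2)
  ultimately show ?thesis
    using assms partial_deriv_support[of i \<phi>] by (auto simp: test_functions_def)
qed

section \<open>Taylor expansion with a uniform remainder\<close>

lemma frechet_derivative_partial:
  assumes "\<phi> differentiable (at (x :: real^'n))"
  shows "frechet_derivative \<phi> (at x) h = (\<Sum>i\<in>UNIV. h $ i * partial_deriv i \<phi> x)"
proof -
  interpret linear "frechet_derivative \<phi> (at x)" by (rule linear_frechet_derivative[OF assms])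
  have h: "(\<Sum>i\<in>UNIV. h $ i *\<^sub>R axis i 1) = h" using basis_expansion[of h] by (simp add: scalar_mult_eq_scaleR)
  have "frechet_derivative \<phi> (at x) h = frechet_derivative \<phi> (at x) (\<Sum>i\<in>UNIV. h $ i *\<^sub>R axis i 1)"
    by (simp only: h)
  also have "\<dots> = (\<Sum>i\<in>UNIV. h $ i * partial_deriv i \<phi> x)"
    by (simp add: sum scaleR partial_deriv_def)
  finally show ?thesis .
qed

lemma test_function_line_deriv:
  fixes h :: "real^'n"
  assumes "\<phi> \<in> test_functions \<Omega>"
  shows "((\<lambda>t. \<phi> (x + t *\<^sub>R h)) has_real_derivative (\<Sum>i\<in>UNIV. h $ i * partial_deriv i \<phi> (x + t *\<^sub>R h))) (at t)"
proof -
  have "(\<phi> has_derivative frechet_derivative \<phi> (at (x + t *\<^sub>R h))) (at (x + t *\<^sub>R h))"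
    using test_function_differentiable[OF assms] by (simp add: frechet_derivative_works[symmetric])
  moreover have "frechet_derivative \<phi> (at (x + t *\<^sub>R h)) = (\<lambda>y. \<Sum>i\<in>UNIV. y $ i * partial_deriv i \<phi> (x + t *\<^sub>R h))"
    by (rule ext) (rule frechet_derivative_partial[OF test_function_differentiable[OF assms]])
  ultimately have "(\<phi> has_derivative (\<lambda>y. \<Sum>i\<in>UNIV. y $ i * partial_deriv i \<phi> (x + t *\<^sub>R h))) (at (x + t *\<^sub>R h))"
    by simp
  moreover have "((\<lambda>t. x + t *\<^sub>R h) has_derivative (\<lambda>s. s *\<^sub>R h)) (at t)"
    by (auto intro!: derivative_eq_intros)
  ultimately have "((\<lambda>t. \<phi> (x + t *\<^sub>R h)) has_derivative (\<lambda>s. \<Sum>i\<in>UNIV. (s *\<^sub>R h) $ i * partial_deriv i \<phi> (x + t *\<^sub>R h))) (at t)"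
    by (rule has_derivative_compose[rotated])
  then show ?thesis
    by (rule has_derivative_imp_has_field_derivative) (simp add: sum_distrib_left mult_ac)
qed

text \<open>Uniform continuity phrased as an eventual property, so that finitely many partial
  derivatives can share one radius.\<close>

lemma test_function_uniform:
  assumes "\<phi> \<in> test_functions \<Omega>" "e > 0"
  shows "\<forall>\<^sub>F d in at_right 0. \<forall>x y. dist x y \<le> d \<longrightarrow> \<bar>\<phi> x - \<phi> y\<bar> \<le> e"
proof -
  obtain R where R: "\<And>z. \<phi> z \<noteq> 0 \<Longrightarrow> norm z \<le> R" using test_function_ckernel[OF assms(1)] by (auto simp: ckernel_def)
  \<comment> \<open>The margin 1 serves points at distance below 1: either both lie in the larger
    ball, or both lie off the support and the values agree.\<close>
  have "uniformly_continuous_on (cball 0 (R + 1)) \<phi>"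
    using test_function_continuous[OF assms(1)]
    by (intro compact_uniformly_continuous) (auto intro: continuous_on_subset)
  then obtain d where d: "d > 0" "\<And>x y. x \<in> cball 0 (R+1) \<Longrightarrow> y \<in> cball 0 (R+1) \<Longrightarrow> dist y x < d \<Longrightarrow> dist (\<phi> y) (\<phi> x) < e"
    using assms(2) unfolding uniformly_continuous_on_def by metis
  have main: "\<bar>\<phi> x - \<phi> y\<bar> \<le> e" if "dist x y < min d 1" for x y
  proof (cases "norm x \<le> R \<or> norm y \<le> R")
    case True
    then have "norm x \<le> R + 1" "norm y \<le> R + 1"
      using that norm_triangle_sub[of x y] norm_triangle_sub[of y x] by (auto simp: dist_norm norm_minus_commute)
    then show ?thesis using d(2)[of y x] that by (auto simp: dist_real_def)
  next
    case False
    then have "\<phi> x = 0" "\<phi> y = 0" using R by auto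
    then show ?thesis using assms(2) by simp
  qed
  have "0 < min d 1" using d(1) by simp
  then show ?thesis unfolding eventually_at_right_field
    by (intro exI[of _ "min d 1"]) (auto intro!: main)
qed

lemma component_sum_le: "(\<Sum>i\<in>UNIV. \<bar>h $ i\<bar> * e) \<le> CARD('n) * (norm (h :: real^'n) * e)" if "0 \<le> e"
proof -
  have "(\<Sum>i\<in>UNIV. \<bar>h $ i\<bar> * e) \<le> (\<Sum>i\<in>(UNIV :: 'n set). norm h * e)"
    using that component_le_norm_cart[of h] by (intro sum_mono mult_right_mono) auto
  then show ?thesis by simp
qed

text \<open>Mean value theorem along the segment from \<open>x\<close> to \<open>x + h\<close>; the
  error is the oscillation of the first derivatives, hence small uniformly in
  \<open>x\<close>.\<close>

lemma test_function_taylor1: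
  fixes \<phi> :: "real^'n::finite \<Rightarrow> real"
  assumes \<phi>: "\<phi> \<in> test_functions \<Omega>" and e: "e > 0"
  shows "\<forall>\<^sub>F d in at_right 0. \<forall>x h. norm h \<le> d \<longrightarrow>
    \<bar>\<phi> (x + h) - \<phi> x - (\<Sum>i\<in>UNIV. h $ i * partial_deriv i \<phi> x)\<bar> \<le> e * norm h"
proof -
  \<comment> \<open>Summing over the components costs a factor \<open>CARD('n)\<close>.\<close>
  define e' where "e' = e / CARD('n)"
  have e': "e' > 0" using e by (simp add: e'_def)
  have "\<forall>\<^sub>F d in at_right 0. \<forall>i. \<forall>x y. dist x y \<le> d \<longrightarrow> \<bar>partial_deriv i \<phi> x - partial_deriv i \<phi> y\<bar> \<le> e'"
    by (intro eventually_all_finite test_function_uniform[OF test_function_partial_deriv[OF \<phi>]] e')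
  then show ?thesis
  proof eventually_elim
    case (elim d)
    show ?case
    proof (intro allI impI)
      fix x h :: "real^'n" assume h: "norm h \<le> d"
      obtain t where t: "0 < t" "t < 1" "\<phi> (x + 1 *\<^sub>R h) - \<phi> (x + 0 *\<^sub>R h) = (1 - 0) * (\<Sum>i\<in>UNIV. h $ i * partial_deriv i \<phi> (x + t *\<^sub>R h))"
        using MVT2[of 0 1 "\<lambda>t. \<phi> (x + t *\<^sub>R h)" "\<lambda>t. \<Sum>i\<in>UNIV. h $ i * partial_deriv i \<phi> (x + t *\<^sub>R h)"]
          test_function_line_deriv[OF \<phi>] by auto
      have d: "dist (x + t *\<^sub>R h) x \<le> d"
        using t h by (simp add: dist_norm) (smt (verit) mult_left_le_one_le norm_ge_zero)
      have "\<bar>\<phi> (x + h) - \<phi> x - (\<Sum>i\<in>UNIV. h $ i * partial_deriv i \<phi> x)\<bar>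
        = \<bar>\<Sum>i\<in>UNIV. h $ i * (partial_deriv i \<phi> (x + t *\<^sub>R h) - partial_deriv i \<phi> x)\<bar>"
        using t(3) by (simp add: right_diff_distrib sum_subtractf)
      also have "\<dots> \<le> (\<Sum>i\<in>UNIV. \<bar>h $ i * (partial_deriv i \<phi> (x + t *\<^sub>R h) - partial_deriv i \<phi> x)\<bar>)"
        by (rule sum_abs)
      also have "\<dots> \<le> (\<Sum>i\<in>UNIV. \<bar>h $ i\<bar> * e')"
        unfolding abs_mult by (intro sum_mono mult_left_mono elim[rule_format, OF d]) auto
      also have "\<dots> \<le> CARD('n) * (norm h * e')" using e' by (intro component_sum_le) auto
      also have "\<dots> = e * norm h" by (simp add: e'_def)
      finally show "\<bar>\<phi> (x + h) - \<phi> x - (\<Sum>i\<in>UNIV. h $ i * partial_deriv i \<phi> x)\<bar> \<le> e * norm h" .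
    qed
  qed
qed

text \<open>Maclaurin expansion of order two along the segment, with the oscillation of the second
  derivatives as remainder; the double sum over components is why \<open>e\<close> gets divided by
  the square of the dimension.\<close>

lemma test_function_taylor2:
  fixes \<phi> :: "real^'n::finite \<Rightarrow> real"
  assumes \<phi>: "\<phi> \<in> test_functions \<Omega>" and e: "e > 0"
  shows "\<forall>\<^sub>F d in at_right 0. \<forall>x h. norm h \<le> d \<longrightarrow>
    \<bar>\<phi> (x + h) - \<phi> x - (\<Sum>i\<in>UNIV. h $ i * partial_deriv i \<phi> x)
      - (\<Sum>i\<in>UNIV. \<Sum>j\<in>UNIV. h $ i * h $ j * partial_deriv j (partial_deriv i \<phi>) x) / 2\<bar> \<le> e * (norm h)\<^sup>2"
proof -
  define e' where "e' = e / (CARD('n))\<^sup>2"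
  have e': "e' > 0" using e by (simp add: e'_def)
  have "\<forall>\<^sub>F d in at_right 0. \<forall>i j. \<forall>x y. dist x y \<le> d \<longrightarrow>
      \<bar>partial_deriv j (partial_deriv i \<phi>) x - partial_deriv j (partial_deriv i \<phi>) y\<bar> \<le> e'"
    by (intro eventually_all_finite test_function_uniform[OF test_function_partial_deriv[OF test_function_partial_deriv[OF \<phi>]]] e')
  then show ?thesis
  proof eventually_elim
    case (elim d)
    show ?case
    proof (intro allI impI)
      fix x h :: "real^'n" assume h: "norm h \<le> d"
      let ?D = "\<lambda>i j t. partial_deriv j (partial_deriv i \<phi>) (x + t *\<^sub>R h)"
      \<comment> \<open>The derivatives of order 0, 1 and 2 of \<phi> along the segment.\<close>
      define df where "df n t = (if n = (0::nat) then \<phi> (x + t *\<^sub>R h) else if n = 1 then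
         (\<Sum>i\<in>UNIV. h $ i * partial_deriv i \<phi> (x + t *\<^sub>R h)) else
         (\<Sum>i\<in>UNIV. h $ i * (\<Sum>j\<in>UNIV. h $ j * ?D i j t)))" for n t
      have "\<exists>t>0. t < 1 \<and> df 0 1 = (\<Sum>n<2. df n 0 / fact n * 1 ^ n) + df 2 t / fact 2 * 1 ^ 2"
      proof (rule Maclaurin)
        show "\<forall>n t. n < 2 \<and> 0 \<le> t \<and> t \<le> 1 \<longrightarrow> (df n has_real_derivative df (Suc n) t) (at t)"
        proof (intro allI impI)
          fix n :: nat and t :: real assume "n < 2 \<and> 0 \<le> t \<and> t \<le> 1"
          then consider "n = 0" | "n = 1" by linarith
          then show "(df n has_real_derivative df (Suc n) t) (at t)"
          proof cases
            case 1
            then show ?thesis using test_function_line_deriv[OF \<phi>, of x h t] by (simp add: df_def[abs_def])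
          next
            case 2
            have "((\<lambda>t. \<Sum>i\<in>UNIV. h $ i * partial_deriv i \<phi> (x + t *\<^sub>R h)) has_real_derivative
               (\<Sum>i\<in>UNIV. h $ i * (\<Sum>j\<in>UNIV. h $ j * ?D i j t))) (at t)"
              by (intro DERIV_sum DERIV_cmult test_function_line_deriv[OF test_function_partial_deriv[OF \<phi>]])
            then show ?thesis using 2 by (simp add: df_def[abs_def])
          qed
        qed
      qed auto
      then obtain t where t: "0 < t" "t < 1" and eq: "df 0 1 = (\<Sum>n<2. df n 0 / fact n * 1 ^ n) + df 2 t / fact 2 * 1 ^ 2"
        by auto
      have d: "dist (x + t *\<^sub>R h) x \<le> d"
        using t h by (simp add: dist_norm) (smt (verit) mult_left_le_one_le norm_ge_zero)
      have main: "\<phi> (x + h) - \<phi> x - (\<Sum>i\<in>UNIV. h $ i * partial_deriv i \<phi> x)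
          - (\<Sum>i\<in>UNIV. \<Sum>j\<in>UNIV. h $ i * h $ j * ?D i j 0) / 2
        = (\<Sum>i\<in>UNIV. \<Sum>j\<in>UNIV. h $ i * h $ j * (?D i j t - ?D i j 0)) / 2"
        using eq by (simp add: df_def numeral_2_eq_2 right_diff_distrib sum_subtractf sum_distrib_left diff_divide_distrib mult.assoc)
      have "\<bar>(\<Sum>i\<in>UNIV. \<Sum>j\<in>UNIV. h $ i * h $ j * (?D i j t - ?D i j 0)) / 2\<bar> \<le> (\<Sum>i\<in>UNIV. \<Sum>j\<in>UNIV. \<bar>h $ i * h $ j * (?D i j t - ?D i j 0)\<bar>) / 2"
      proof -
        have "\<bar>\<Sum>i\<in>UNIV. \<Sum>j\<in>UNIV. h $ i * h $ j * (?D i j t - ?D i j 0)\<bar>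
           \<le> (\<Sum>i\<in>UNIV. \<bar>\<Sum>j\<in>UNIV. h $ i * h $ j * (?D i j t - ?D i j 0)\<bar>)" by (rule sum_abs)
        also have "\<dots> \<le> (\<Sum>i\<in>UNIV. \<Sum>j\<in>UNIV. \<bar>h $ i * h $ j * (?D i j t - ?D i j 0)\<bar>)"
          by (intro sum_mono sum_abs)
        finally show ?thesis by simp
      qed
      also have "\<dots> \<le> (\<Sum>i\<in>(UNIV::'n set). \<Sum>j\<in>(UNIV::'n set). (norm h)\<^sup>2 * e')"
      proof -
        have "\<bar>h $ i * h $ j * (?D i j t - ?D i j 0)\<bar> \<le> (norm h)\<^sup>2 * e'" for i j
        proof -
          have 1: "\<bar>?D i j t - ?D i j 0\<bar> \<le> e'"
            using elim[rule_format, OF d, of j i] by simp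
          have 2: "\<bar>h $ i\<bar> * \<bar>h $ j\<bar> \<le> norm h * norm h"
            by (rule mult_mono) (auto intro: component_le_norm_cart)
          have "\<bar>h $ i * h $ j * (?D i j t - ?D i j 0)\<bar> = (\<bar>h $ i\<bar> * \<bar>h $ j\<bar>) * \<bar>?D i j t - ?D i j 0\<bar>"
            by (simp only: abs_mult)
          also have "\<dots> \<le> (norm h * norm h) * e'"
            by (rule mult_mono[OF 2 1]) auto
          finally show ?thesis by (simp add: power2_eq_square)
        qed
        then have "(\<Sum>i\<in>UNIV. \<Sum>j\<in>UNIV. \<bar>h $ i * h $ j * (?D i j t - ?D i j 0)\<bar>)
           \<le> (\<Sum>i\<in>(UNIV::'n set). \<Sum>j\<in>(UNIV::'n set). (norm h)\<^sup>2 * e')"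
          by (intro sum_mono)
        moreover have "0 \<le> (\<Sum>i\<in>UNIV. \<Sum>j\<in>UNIV. \<bar>h $ i * h $ j * (?D i j t - ?D i j 0)\<bar>)"
          by (intro sum_nonneg) auto
        ultimately show ?thesis by linarith
      qed
      also have "\<dots> = e * (norm h)\<^sup>2" by (simp add: e'_def power2_eq_square)
      finally show "\<bar>\<phi> (x + h) - \<phi> x - (\<Sum>i\<in>UNIV. h $ i * partial_deriv i \<phi> x)
        - (\<Sum>i\<in>UNIV. \<Sum>j\<in>UNIV. h $ i * h $ j * partial_deriv j (partial_deriv i \<phi>) x) / 2\<bar> \<le> e * (norm h)\<^sup>2"
        using main by simp
    qed
  qed
qed

lemma Conv_uminus_kernel: "Conv (\<lambda>z. - q z) u = - Conv q u" if "ckernel q"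
proof -
  have "conv (\<lambda>z. - q z) (fn u) = (\<lambda>x. (- 1) * conv q (fn u) x)" by (auto simp: conv_def)
  then show ?thesis using conv_L2[OF that fn_L2[of u]] by (simp add: Conv_def cls_cmult[of _ "-1", simplified])
qed

lemma conv_reflect:
  assumes "ckernel k" "continuous_on UNIV \<phi>"
  shows "conv k \<phi> x = (\<integral>z. k z * \<phi> (x - z) \<partial>lebesgue)"
proof -
  have "ckernel (\<lambda>y. k (x - y) * \<phi> y)"
    using assms by (intro ckernel_mult_continuous ckernel_reflect)
  from integral_lebesgue_reflect[OF ckernel_borel[OF this], of x]
  show ?thesis by (simp add: conv_def)
qed

lemma norm_cls_le_bounded_support:
  fixes f :: "'a::euclidean_space \<Rightarrow> real"
  assumes f: "f \<in> L2 UNIV" and e: "\<And>x. \<bar>f x\<bar> \<le> e" and R: "\<And>x. f x \<noteq> 0 \<Longrightarrow> norm x \<le> R"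
  shows "(norm (cls f))\<^sup>2 \<le> e\<^sup>2 * measure lebesgue (cball (0::'a) R)"
proof -
  have "(norm (cls f))\<^sup>2 = (\<integral>x. (f x)\<^sup>2 \<partial>lebesgue)" by (rule norm_cls_sq[OF f])
  also have "\<dots> \<le> (\<integral>x. e\<^sup>2 * indicator (cball (0::'a) R) x \<partial>lebesgue)"
  proof (rule integral_mono[OF L2_integrable_sq[OF f]])
    have "cball (0::'a) R \<in> lmeasurable" by simp
    then show "integrable lebesgue (\<lambda>x. e\<^sup>2 * indicator (cball (0::'a) R) x)"
      by (intro integrable_mult_right) (simp add: lmeasurable_iff_integrable)
    fix x
    have "(f x)\<^sup>2 \<le> e\<^sup>2" using e[of x] by (intro abs_le_square_iff[THEN iffD1]) auto
    then show "(f x)\<^sup>2 \<le> e\<^sup>2 * indicator (cball 0 R) x"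
      using R[of x] by (cases "f x = 0") auto
  qed
  finally show ?thesis by simp
qed

text \<open>On a fixed ball uniform convergence dominates convergence in norm; the common radius
  \<open>R\<close> prevents mass from escaping.\<close>

lemma cls_tendsto_uniform:
  fixes f :: "'i \<Rightarrow> 'a::euclidean_space \<Rightarrow> real"
  assumes f: "\<forall>\<^sub>F d in F. f d \<in> L2 UNIV" and g: "g \<in> L2 UNIV"
    and e: "\<And>e. e > 0 \<Longrightarrow> \<forall>\<^sub>F d in F. \<forall>x. \<bar>f d x - g x\<bar> \<le> e"
    and R: "\<forall>\<^sub>F d in F. \<forall>x. f d x - g x \<noteq> 0 \<longrightarrow> norm x \<le> R"
  shows "((\<lambda>d. cls (f d)) \<longlongrightarrow> cls g) F"
proof (rule tendstoI)
  fix e :: real assume "e > 0"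
  \<comment> \<open>The added 1 makes \<open>M\<close> positive even if the ball is a null
    set.\<close>
  define M where "M = measure lebesgue (cball (0::'a) R) + 1"
  have M: "M > 0" by (simp add: M_def add_nonneg_pos)
  define e' where "e' = e / 2 / sqrt M"
  have "e' > 0" using \<open>e > 0\<close> M by (simp add: e'_def)
  from e[OF this] f R show "\<forall>\<^sub>F d in F. dist (cls (f d)) (cls g) < e"
  proof eventually_elim
    case (elim d)
    have L: "(\<lambda>x. f d x - g x) \<in> L2 UNIV" using elim g by (intro L2_diff)
    have "(norm (cls (f d) - cls g))\<^sup>2 \<le> e'\<^sup>2 * measure lebesgue (cball (0::'a) R)"
      using norm_cls_le_bounded_support[OF L, of e' R] elim by (simp add: cls_diff[OF elim(2) g])
    also have "\<dots> \<le> e'\<^sup>2 * M" by (intro mult_left_mono) (auto simp: M_def)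
    also have "\<dots> = (e/2)\<^sup>2" using M by (simp add: e'_def power_divide)
    finally have "norm (cls (f d) - cls g) \<le> e / 2"
      using \<open>e > 0\<close> by (simp add: power2_le_iff_abs_le)
    then show ?case using \<open>e > 0\<close> by (simp add: dist_norm)
  qed
qed

definition laplace :: "(real^'n::finite \<Rightarrow> real) \<Rightarrow> real^'n \<Rightarrow> real" where
  "laplace \<phi> x = (\<Sum>i\<in>UNIV. partial_deriv i (partial_deriv i \<phi>) x)"

lemma L2_sum:
  fixes f :: "'i \<Rightarrow> 'a::euclidean_space \<Rightarrow> real"
  assumes "finite I" "\<And>i. i \<in> I \<Longrightarrow> f i \<in> L2 UNIV"
  shows "(\<lambda>x. \<Sum>i\<in>I. f i x) \<in> L2 UNIV" "cls (\<lambda>x. \<Sum>i\<in>I. f i x) = (\<Sum>i\<in>I. cls (f i))"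
proof -
  have "(\<lambda>x. \<Sum>i\<in>I. f i x) \<in> L2 UNIV \<and> cls (\<lambda>x. \<Sum>i\<in>I. f i x) = (\<Sum>i\<in>I. cls (f i))"
    using assms by (induction I rule: finite_induct) (auto intro: L2_add simp: cls_add)
  then show "(\<lambda>x. \<Sum>i\<in>I. f i x) \<in> L2 UNIV" "cls (\<lambda>x. \<Sum>i\<in>I. f i x) = (\<Sum>i\<in>I. cls (f i))" by auto
qed

lemma laplace_L2:
  assumes "\<phi> \<in> test_functions \<Omega>"
  shows "laplace \<phi> \<in> L2 UNIV" "cls (laplace \<phi>) = (\<Sum>i\<in>UNIV. cls (partial_deriv i (partial_deriv i \<phi>)))"
  using L2_sum[of UNIV "\<lambda>i. partial_deriv i (partial_deriv i \<phi>)"]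
    test_function_L2[OF test_function_partial_deriv[OF test_function_partial_deriv[OF assms]]]
  unfolding laplace_def[abs_def] by auto

lemma conv_support:
  assumes "conv k \<phi> x \<noteq> 0" "\<And>z. k z \<noteq> 0 \<Longrightarrow> norm z \<le> r" "\<And>z. \<phi> z \<noteq> 0 \<Longrightarrow> norm z \<le> R"
  shows "norm x \<le> R + r"
proof (rule ccontr)
  assume *: "\<not> norm x \<le> R + r"
  have "k (x - y) * \<phi> y = 0" for y
  proof (rule ccontr)
    assume "k (x - y) * \<phi> y \<noteq> 0"
    then have "norm (x - y) \<le> r" "norm y \<le> R" using assms by auto
    then show False using * norm_triangle_sub[of x y] by linarith
  qed
  then have "(\<lambda>y. k (x - y) * \<phi> y) = (\<lambda>y. 0)" by (rule ext)
  then have "conv k \<phi> x = 0" unfolding conv_def by simp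
  then show False using assms(1) by simp
qed

section \<open>Consistency of the nonlocal Laplacian and of the discrete gradient\<close>

context radial_kernel
begin

text \<open>Estimates Taylor remainders: whatever is quadratically small on the support of the
  kernel integrates to the order of the second moment.\<close>

lemma K_abs_le:
  assumes \<delta>: "0 < \<delta>" and h: "continuous_on UNIV h" and le: "\<And>z. K \<delta> z \<noteq> 0 \<Longrightarrow> \<bar>h z\<bar> \<le> c * (norm z)\<^sup>2"
  shows "\<bar>\<integral>z. K \<delta> z * h z \<partial>lebesgue\<bar> \<le> c * (\<delta>\<^sup>2 * (CARD('n) * m))"
proof -
  have I: "integrable lebesgue (\<lambda>z. K \<delta> z * h z)" "integrable lebesgue (\<lambda>z. K \<delta> z * (c * (norm z)\<^sup>2))"
    by (auto intro!: ckernel_integrable ckernel_mult_continuous K_ckernel \<delta> h continuous_intros)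
  have "\<bar>\<integral>z. K \<delta> z * h z \<partial>lebesgue\<bar> \<le> (\<integral>z. norm (K \<delta> z * h z) \<partial>lebesgue)"
    unfolding real_norm_def[symmetric] by (rule integral_norm_bound)
  also have "\<dots> \<le> (\<integral>z. K \<delta> z * (c * (norm z)\<^sup>2) \<partial>lebesgue)"
  proof (rule integral_mono[OF integrable_norm[OF I(1)] I(2)])
    fix z show "norm (K \<delta> z * h z) \<le> K \<delta> z * (c * (norm z)\<^sup>2)"
      using le[of z] K_nonneg[OF \<delta>, of z] by (cases "K \<delta> z = 0") (auto simp: abs_mult intro!: mult_left_mono)
  qed
  also have "\<dots> = c * (\<integral>z. K \<delta> z * (norm z)\<^sup>2 \<partial>lebesgue)" by (simp add: mult.left_commute)
  finally show ?thesis by (simp add: K_moment_norm[OF \<delta>])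
qed

lemma K_lin_integrable:
  assumes \<delta>: "0 < \<delta>" and h: "continuous_on UNIV h"
  shows "integrable lebesgue (\<lambda>z. K \<delta> z * h z)"
  by (intro ckernel_integrable ckernel_mult_continuous K_ckernel \<delta> h)

lemma K_integral_sum1:
  assumes \<delta>: "0 < \<delta>"
  shows "(\<integral>z. K \<delta> z * (\<Sum>i\<in>UNIV. z $ i * a i) \<partial>lebesgue) = 0"
proof -
  have "(\<integral>z. K \<delta> z * (\<Sum>i\<in>UNIV. z $ i * a i) \<partial>lebesgue) = (\<integral>z. (\<Sum>i\<in>UNIV. a i * (K \<delta> z * z $ i)) \<partial>lebesgue)"
    by (simp add: sum_distrib_left mult_ac)
  also have "\<dots> = (\<Sum>i\<in>UNIV. (\<integral>z. a i * (K \<delta> z * z $ i) \<partial>lebesgue))"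
    by (intro Bochner_Integration.integral_sum integrable_mult_right K_lin_integrable \<delta> continuous_on_component continuous_on_id)
  finally show ?thesis by (simp add: K_moment1[OF \<delta>])
qed

lemma K_integral_sum2:
  assumes \<delta>: "0 < \<delta>"
  shows "(\<integral>z. K \<delta> z * (z $ i * (\<Sum>j\<in>UNIV. z $ j * a j)) \<partial>lebesgue) = \<delta>\<^sup>2 * m * a i"
proof -
  have "(\<integral>z. K \<delta> z * (z $ i * (\<Sum>j\<in>UNIV. z $ j * a j)) \<partial>lebesgue) = (\<integral>z. (\<Sum>j\<in>UNIV. a j * (K \<delta> z * (z $ i * z $ j))) \<partial>lebesgue)"
    by (simp add: sum_distrib_left mult_ac)
  also have "\<dots> = (\<Sum>j\<in>UNIV. (\<integral>z. a j * (K \<delta> z * (z $ i * z $ j)) \<partial>lebesgue))"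
    by (intro Bochner_Integration.integral_sum integrable_mult_right K_lin_integrable \<delta> continuous_on_mult continuous_on_component continuous_on_id)
  also have "\<dots> = \<delta>\<^sup>2 * m * a i" by (simp add: K_moment2[OF \<delta>] if_distrib cong: if_cong)
  finally show ?thesis .
qed

lemma K_integral_sum22:
  assumes \<delta>: "0 < \<delta>"
  shows "(\<integral>z. K \<delta> z * (\<Sum>i\<in>UNIV. z $ i * (\<Sum>j\<in>UNIV. z $ j * b i j)) \<partial>lebesgue) = \<delta>\<^sup>2 * m * (\<Sum>i\<in>UNIV. b i i)"
proof -
  have "(\<integral>z. K \<delta> z * (\<Sum>i\<in>UNIV. z $ i * (\<Sum>j\<in>UNIV. z $ j * b i j)) \<partial>lebesgue)
    = (\<integral>z. (\<Sum>i\<in>UNIV. K \<delta> z * (z $ i * (\<Sum>j\<in>UNIV. z $ j * b i j))) \<partial>lebesgue)"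
    by (simp add: sum_distrib_left)
  also have "\<dots> = (\<Sum>i\<in>UNIV. (\<integral>z. K \<delta> z * (z $ i * (\<Sum>j\<in>UNIV. z $ j * b i j)) \<partial>lebesgue))"
    by (intro Bochner_Integration.integral_sum K_lin_integrable \<delta> continuous_on_mult continuous_on_sum
        continuous_on_component continuous_on_id continuous_on_const)
  also have "\<dots> = (\<Sum>i\<in>UNIV. \<delta>\<^sup>2 * m * b i i)" by (simp only: K_integral_sum2[OF \<delta>])
  finally show ?thesis by (simp only: sum_distrib_left)
qed

lemma filterlim_mult_rho: "filterlim (\<lambda>\<delta>. \<delta> * \<rho>) (at_right 0) (at_right 0)"
proof (rule filterlim_at_withinI)
  have "((\<lambda>\<delta>. \<delta> * \<rho>) \<longlongrightarrow> 0 * \<rho>) (at_right 0)" by (intro tendsto_intros)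
  then show "((\<lambda>\<delta>. \<delta> * \<rho>) \<longlongrightarrow> 0) (at_right 0)" by simp
  show "\<forall>\<^sub>F \<delta> in at_right 0. \<delta> * \<rho> \<in> {0<..} - {0}"
    using eventually_at_right_less[of 0] by eventually_elim (use rho(1) in auto)
qed

text \<open>Expand \<open>\<phi> (x - z)\<close> under the kernel: mass one reproduces
  \<open>\<phi> x\<close>, the first moments vanish, the isotropic second moments give
  \<open>\<delta>\<^sup>2 * m / 2\<close> times the Laplacian, and the remainder is an arbitrarily
  small multiple of \<open>\<delta>\<^sup>2\<close>.\<close>

lemma K_laplace_uniform:
  assumes \<phi>: "\<phi> \<in> test_functions \<Omega>" and e: "e > 0"
  shows "\<forall>\<^sub>F \<delta> in at_right 0. \<forall>x. \<bar>2 / (m * \<delta>\<^sup>2) * (conv (K \<delta>) \<phi> x - \<phi> x) - laplace \<phi> x\<bar> \<le> e"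
proof -
  \<comment> \<open>Chosen so that the factor \<open>2 / (m * \<delta>\<^sup>2)\<close> times the
    remainder bound \<open>e' * (\<delta>\<^sup>2 * (CARD('n) * m))\<close> is
    \<open>e\<close>.\<close>
  define e' where "e' = e / (2 * CARD('n))"
  have e': "e' > 0" using e by (simp add: e'_def)
  note ev = filterlim_mult_rho[unfolded filterlim_iff, rule_format, OF test_function_taylor2[OF \<phi> e']]
  from ev eventually_at_right_less[of 0]
  show ?thesis
  proof eventually_elim
    case (elim \<delta>)
    have \<delta>: "0 < \<delta>" using elim by simp
    show ?case
    proof
      fix x
      have \<phi>c: "continuous_on UNIV \<phi>" by (rule test_function_continuous[OF \<phi>])
      define A where "A z = (\<Sum>i\<in>UNIV. z $ i * partial_deriv i \<phi> x)" for z
      define B where "B z = (\<Sum>i\<in>UNIV. z $ i * (\<Sum>j\<in>UNIV. z $ j * partial_deriv j (partial_deriv i \<phi>) x))" for z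
      \<comment> \<open>The increment is \<open>- z\<close>, so in the remainder the linear term
        \<open>A\<close> enters with a plus sign, while the quadratic term is unaffected by the
        sign.\<close>
      define E where "E z = \<phi> (x - z) - \<phi> x + A z - B z / 2" for z
      have cA: "continuous_on UNIV A" unfolding A_def
        by (intro continuous_on_mult continuous_on_sum continuous_on_component continuous_on_id continuous_on_const)
      have cB: "continuous_on UNIV B" unfolding B_def
        by (intro continuous_on_mult continuous_on_sum continuous_on_component continuous_on_id continuous_on_const)
      have c\<phi>: "continuous_on UNIV (\<lambda>z. \<phi> (x - z))"
        by (rule continuous_on_compose2[OF \<phi>c]) (auto intro!: continuous_intros)
      have cE: "continuous_on UNIV E" unfolding E_def
        by (intro continuous_on_diff continuous_on_add continuous_on_divide continuous_on_const cA cB c\<phi>) auto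
      have Eb: "\<bar>E z\<bar> \<le> e' * (norm z)\<^sup>2" if "K \<delta> z \<noteq> 0" for z
      proof -
        have "norm (- z) \<le> \<delta> * \<rho>" using K_supp[OF \<delta> that] by simp
        from elim(1)[rule_format, OF this, of x] show ?thesis
          by (simp add: E_def A_def B_def sum_negf mult.assoc sum_distrib_left)
      qed
      have "conv (K \<delta>) \<phi> x = (\<integral>z. K \<delta> z * \<phi> (x - z) \<partial>lebesgue)"
        by (rule conv_reflect[OF K_ckernel[OF \<delta>] \<phi>c])
      also have "\<dots> = (\<integral>z. \<phi> x * K \<delta> z - K \<delta> z * A z + (1/2) * (K \<delta> z * B z) + K \<delta> z * E z \<partial>lebesgue)"
        by (intro Bochner_Integration.integral_cong refl) (simp add: E_def algebra_simps)
      also have "\<dots> = \<phi> x - (\<integral>z. K \<delta> z * A z \<partial>lebesgue) + (1/2) * (\<integral>z. K \<delta> z * B z \<partial>lebesgue) + (\<integral>z. K \<delta> z * E z \<partial>lebesgue)"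
        using K_lin_integrable[OF \<delta> cA] K_lin_integrable[OF \<delta> cB] K_lin_integrable[OF \<delta> cE] ckernel_integrable[OF K_ckernel[OF \<delta>]]
        by (simp add: K_1[OF \<delta>])
      also have "(\<integral>z. K \<delta> z * A z \<partial>lebesgue) = 0" unfolding A_def by (rule K_integral_sum1[OF \<delta>])
      also have "(\<integral>z. K \<delta> z * B z \<partial>lebesgue) = \<delta>\<^sup>2 * m * laplace \<phi> x"
        unfolding B_def laplace_def by (rule K_integral_sum22[OF \<delta>])
      finally have "conv (K \<delta>) \<phi> x - \<phi> x = \<delta>\<^sup>2 * m / 2 * laplace \<phi> x + (\<integral>z. K \<delta> z * E z \<partial>lebesgue)" by simp
      then have "2 / (m * \<delta>\<^sup>2) * (conv (K \<delta>) \<phi> x - \<phi> x) - laplace \<phi> x = 2 / (m * \<delta>\<^sup>2) * (\<integral>z. K \<delta> z * E z \<partial>lebesgue)"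
        using m_pos \<delta> by (simp add: field_simps)
      also have "\<bar>2 / (m * \<delta>\<^sup>2) * (\<integral>z. K \<delta> z * E z \<partial>lebesgue)\<bar> \<le> 2 / (m * \<delta>\<^sup>2) * (e' * (\<delta>\<^sup>2 * (CARD('n) * m)))"
        using K_abs_le[OF \<delta> cE Eb] m_pos \<delta> unfolding abs_mult by (intro mult_mono) auto
      also have "\<dots> = e" using m_pos \<delta> by (simp add: e'_def)
      finally show "\<bar>2 / (m * \<delta>\<^sup>2) * (conv (K \<delta>) \<phi> x - \<phi> x) - laplace \<phi> x\<bar> \<le> e" .
    qed
  qed
qed

text \<open>First-moment kernel. To first order \<open>\<phi> (x - z)\<close> is
  \<open>\<phi> x - z \<bullet> grad \<phi> x\<close>, so convolution with this kernel is about
  \<open>- m * \<delta>\<^sup>2\<close> times the \<open>i\<close>-th partial derivative; this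
  explains the factor \<open>- 1 / (m * \<delta>\<^sup>2)\<close> below.\<close>

definition Q :: "real \<Rightarrow> 'n \<Rightarrow> real^'n \<Rightarrow> real" where
  "Q \<delta> i z = K \<delta> z * z $ i"

lemma Q_ckernel: "0 < \<delta> \<Longrightarrow> ckernel (Q \<delta> i)"
  unfolding Q_def by (intro ckernel_mult_continuous K_ckernel continuous_on_component continuous_on_id)

lemma Q_odd: "0 < \<delta> \<Longrightarrow> Q \<delta> i (- z) = - Q \<delta> i z"
  by (simp add: Q_def K_even)

text \<open>A first-order expansion suffices: the factor \<open>z $ i\<close> of the kernel supplies
  the second power of \<open>norm z\<close>, so the remainder is again of the order of the second
  moment.\<close>

lemma Q_grad_uniform:
  assumes \<phi>: "\<phi> \<in> test_functions \<Omega>" and e: "e > 0"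
  shows "\<forall>\<^sub>F \<delta> in at_right 0. \<forall>x. \<bar>- 1 / (m * \<delta>\<^sup>2) * conv (Q \<delta> i) \<phi> x - partial_deriv i \<phi> x\<bar> \<le> e"
proof -
  define e' where "e' = e / CARD('n)"
  have e': "e' > 0" using e by (simp add: e'_def)
  note ev = filterlim_mult_rho[unfolded filterlim_iff, rule_format, OF test_function_taylor1[OF \<phi> e']]
  from ev eventually_at_right_less[of 0]
  show ?thesis
  proof eventually_elim
    case (elim \<delta>)
    have \<delta>: "0 < \<delta>" using elim by simp
    show ?case
    proof
      fix x
      have \<phi>c: "continuous_on UNIV \<phi>" by (rule test_function_continuous[OF \<phi>])
      define A where "A z = (\<Sum>i\<in>UNIV. z $ i * partial_deriv i \<phi> x)" for z
      define E where "E z = \<phi> (x - z) - \<phi> x + A z" for z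
      have ci: "continuous_on UNIV (\<lambda>z :: real^'n. z $ i)" by (intro continuous_on_component continuous_on_id)
      have cA: "continuous_on UNIV A" unfolding A_def
        by (intro continuous_on_mult continuous_on_sum continuous_on_component continuous_on_id continuous_on_const)
      have c\<phi>: "continuous_on UNIV (\<lambda>z. \<phi> (x - z))"
        by (rule continuous_on_compose2[OF \<phi>c]) (auto intro!: continuous_intros)
      have cE: "continuous_on UNIV E" unfolding E_def
        by (intro continuous_on_diff continuous_on_add continuous_on_const cA c\<phi>)
      have ciA: "continuous_on UNIV (\<lambda>z. z $ i * A z)" and ciE: "continuous_on UNIV (\<lambda>z. z $ i * E z)"
        by (intro continuous_on_mult ci cA cE)+
      have Eb: "\<bar>z $ i * E z\<bar> \<le> e' * (norm z)\<^sup>2" if "K \<delta> z \<noteq> 0" for z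
      proof -
        have "norm (- z) \<le> \<delta> * \<rho>" using K_supp[OF \<delta> that] by simp
        from elim(1)[rule_format, OF this, of x] have "\<bar>E z\<bar> \<le> e' * norm z"
          by (simp add: E_def A_def sum_negf)
        then have "\<bar>z $ i\<bar> * \<bar>E z\<bar> \<le> norm z * (e' * norm z)"
          by (intro mult_mono component_le_norm_cart) auto
        then show ?thesis by (simp add: abs_mult power2_eq_square mult_ac)
      qed
      have "conv (Q \<delta> i) \<phi> x = (\<integral>z. Q \<delta> i z * \<phi> (x - z) \<partial>lebesgue)"
        by (rule conv_reflect[OF Q_ckernel[OF \<delta>] \<phi>c])
      also have "\<dots> = (\<integral>z. \<phi> x * (K \<delta> z * z $ i) - K \<delta> z * (z $ i * A z) + K \<delta> z * (z $ i * E z) \<partial>lebesgue)"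
        by (intro Bochner_Integration.integral_cong refl) (simp add: Q_def E_def algebra_simps)
      also have "\<dots> = \<phi> x * (\<integral>z. K \<delta> z * z $ i \<partial>lebesgue) - (\<integral>z. K \<delta> z * (z $ i * A z) \<partial>lebesgue) + (\<integral>z. K \<delta> z * (z $ i * E z) \<partial>lebesgue)"
        using K_lin_integrable[OF \<delta> ci] K_lin_integrable[OF \<delta> ciA] K_lin_integrable[OF \<delta> ciE]
        by simp
      also have "(\<integral>z. K \<delta> z * (z $ i * A z) \<partial>lebesgue) = \<delta>\<^sup>2 * m * partial_deriv i \<phi> x"
        unfolding A_def by (rule K_integral_sum2[OF \<delta>])
      finally have "conv (Q \<delta> i) \<phi> x = - \<delta>\<^sup>2 * m * partial_deriv i \<phi> x + (\<integral>z. K \<delta> z * (z $ i * E z) \<partial>lebesgue)"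
        by (simp add: K_moment1[OF \<delta>])
      then have c: "conv (Q \<delta> i) \<phi> x = - (m * \<delta>\<^sup>2) * partial_deriv i \<phi> x + (\<integral>z. K \<delta> z * (z $ i * E z) \<partial>lebesgue)" by simp
      have "m * \<delta>\<^sup>2 \<noteq> 0" using m_pos \<delta> by simp
      then have "- 1 / (m * \<delta>\<^sup>2) * conv (Q \<delta> i) \<phi> x - partial_deriv i \<phi> x = - 1 / (m * \<delta>\<^sup>2) * (\<integral>z. K \<delta> z * (z $ i * E z) \<partial>lebesgue)"
        unfolding c distrib_left by simp
      also have "\<bar>- 1 / (m * \<delta>\<^sup>2) * (\<integral>z. K \<delta> z * (z $ i * E z) \<partial>lebesgue)\<bar> \<le> 1 / (m * \<delta>\<^sup>2) * (e' * (\<delta>\<^sup>2 * (CARD('n) * m)))"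
        using K_abs_le[OF \<delta> ciE Eb] m_pos \<delta> unfolding abs_mult by (intro mult_mono) auto
      also have "\<dots> = e" using m_pos \<delta> by (simp add: e'_def)
      finally show "\<bar>- 1 / (m * \<delta>\<^sup>2) * conv (Q \<delta> i) \<phi> x - partial_deriv i \<phi> x\<bar> \<le> e" .
    qed
  qed
qed

lemma K_laplace_tendsto:
  assumes \<phi>: "\<phi> \<in> test_functions \<Omega>"
  shows "((\<lambda>\<delta>. (2 / (m * \<delta>\<^sup>2)) *\<^sub>R (Conv (K \<delta>) (cls \<phi>) - cls \<phi>)) \<longlongrightarrow> cls (laplace \<phi>)) (at_right 0)"
proof -
  note \<phi>L = test_function_L2[OF \<phi>]
  obtain R where R: "\<And>z. \<phi> z \<noteq> 0 \<Longrightarrow> norm z \<le> R" using test_function_ckernel[OF \<phi>] by (auto simp: ckernel_def)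
  have "\<exists>R. \<forall>z. partial_deriv i (partial_deriv i \<phi>) z \<noteq> 0 \<longrightarrow> norm z \<le> R" for i
    using test_function_ckernel[OF test_function_partial_deriv[OF test_function_partial_deriv[OF \<phi>]]] by (auto simp: ckernel_def)
  then obtain Ri where Ri: "\<And>i z. partial_deriv i (partial_deriv i \<phi>) z \<noteq> 0 \<Longrightarrow> norm z \<le> Ri i" by metis
  \<comment> \<open>A common radius: for \<delta> below 1 convolution enlarges the support of \<phi>
    by at most \<rho>, and the second derivatives have their own radii.\<close>
  define R' where "R' = Max (insert (\<bar>R\<bar> + \<rho>) (range Ri))"
  have R'1: "\<bar>R\<bar> + \<rho> \<le> R'" and R'2: "Ri i \<le> R'" for i unfolding R'_def by (rule Max_ge; simp)+
  have "((\<lambda>\<delta>. cls (\<lambda>x. 2 / (m * \<delta>\<^sup>2) * (conv (K \<delta>) \<phi> x - \<phi> x))) \<longlongrightarrow> cls (laplace \<phi>)) (at_right 0)"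
  proof (rule cls_tendsto_uniform[where R = R'])
    show "\<forall>\<^sub>F \<delta> in at_right 0. (\<lambda>x. 2 / (m * \<delta>\<^sup>2) * (conv (K \<delta>) \<phi> x - \<phi> x)) \<in> L2 UNIV"
      using eventually_at_right_less[of 0]
      by eventually_elim (intro L2_cmult L2_diff conv_L2 K_ckernel \<phi>L)
    show "laplace \<phi> \<in> L2 UNIV" by (rule laplace_L2[OF \<phi>])
    show "\<forall>\<^sub>F \<delta> in at_right 0. \<forall>x. \<bar>2 / (m * \<delta>\<^sup>2) * (conv (K \<delta>) \<phi> x - \<phi> x) - laplace \<phi> x\<bar> \<le> e" if "e > 0" for e
      by (rule K_laplace_uniform[OF \<phi> that])
    show "\<forall>\<^sub>F \<delta> in at_right 0. \<forall>x. 2 / (m * \<delta>\<^sup>2) * (conv (K \<delta>) \<phi> x - \<phi> x) - laplace \<phi> x \<noteq> 0 \<longrightarrow> norm x \<le> R'"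
      using eventually_at_right_real[of 0 1, OF zero_less_one]
    proof (rule eventually_mono)
      fix \<delta> :: real assume \<delta>: "\<delta> \<in> {0<..<1}"
      show "\<forall>x. 2 / (m * \<delta>\<^sup>2) * (conv (K \<delta>) \<phi> x - \<phi> x) - laplace \<phi> x \<noteq> 0 \<longrightarrow> norm x \<le> R'"
      proof (intro allI impI, rule ccontr)
        fix x assume *: "2 / (m * \<delta>\<^sup>2) * (conv (K \<delta>) \<phi> x - \<phi> x) - laplace \<phi> x \<noteq> 0" "\<not> norm x \<le> R'"
        have "partial_deriv i (partial_deriv i \<phi>) x = 0" for i
          using Ri[of i x] R'2[of i] *(2) by linarith
        then have "laplace \<phi> x = 0" by (simp add: laplace_def)
        moreover have "\<phi> x = 0" using R[of x] R'1 *(2) rho(1) by linarith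
        moreover have "conv (K \<delta>) \<phi> x = 0"
        proof (rule ccontr)
          assume "conv (K \<delta>) \<phi> x \<noteq> 0"
          then have "norm x \<le> R + \<delta> * \<rho>"
            using \<delta> by (intro conv_support[of "K \<delta>" \<phi>] K_supp R) auto
          moreover have "\<delta> * \<rho> \<le> 1 * \<rho>" using \<delta> rho(1) by (intro mult_right_mono) auto
          ultimately show False using *(2) R'1 by linarith
        qed
        ultimately show False using *(1) by simp
      qed
    qed
  qed
  then show ?thesis
  proof (rule tendsto_cong[THEN iffD1, rotated])
    show "\<forall>\<^sub>F \<delta> in at_right 0. cls (\<lambda>x. 2 / (m * \<delta>\<^sup>2) * (conv (K \<delta>) \<phi> x - \<phi> x)) = (2 / (m * \<delta>\<^sup>2)) *\<^sub>R (Conv (K \<delta>) (cls \<phi>) - cls \<phi>)"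
      using eventually_at_right_less[of 0]
    proof eventually_elim
      case (elim \<delta>)
      note c = conv_L2[OF K_ckernel[OF elim] \<phi>L]
      show ?case
        by (simp only: cls_cmult[OF L2_diff[OF c \<phi>L]] cls_diff[OF c \<phi>L] Conv_cls[OF K_ckernel[OF elim] \<phi>L])
    qed
  qed
qed

lemma Q_grad_tendsto:
  assumes \<phi>: "\<phi> \<in> test_functions \<Omega>"
  shows "((\<lambda>\<delta>. (- 1 / (m * \<delta>\<^sup>2)) *\<^sub>R Conv (Q \<delta> i) (cls \<phi>)) \<longlongrightarrow> cls (partial_deriv i \<phi>)) (at_right 0)"
proof -
  note \<phi>L = test_function_L2[OF \<phi>]
  obtain R where R: "\<And>z. \<phi> z \<noteq> 0 \<Longrightarrow> norm z \<le> R" using test_function_ckernel[OF \<phi>] by (auto simp: ckernel_def)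
  obtain R1 where R1: "\<And>z. partial_deriv i \<phi> z \<noteq> 0 \<Longrightarrow> norm z \<le> R1"
    using test_function_ckernel[OF test_function_partial_deriv[OF \<phi>]] by (force simp: ckernel_def)
  have "((\<lambda>\<delta>. cls (\<lambda>x. - 1 / (m * \<delta>\<^sup>2) * conv (Q \<delta> i) \<phi> x)) \<longlongrightarrow> cls (partial_deriv i \<phi>)) (at_right 0)"
  proof (rule cls_tendsto_uniform[where R = "max R1 (R + \<rho>)"])
    show "\<forall>\<^sub>F \<delta> in at_right 0. (\<lambda>x. - 1 / (m * \<delta>\<^sup>2) * conv (Q \<delta> i) \<phi> x) \<in> L2 UNIV"
      using eventually_at_right_less[of 0]
      by eventually_elim (intro L2_cmult conv_L2 Q_ckernel \<phi>L)
    show "partial_deriv i \<phi> \<in> L2 UNIV" by (rule test_function_L2[OF test_function_partial_deriv[OF \<phi>]])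
    show "\<forall>\<^sub>F \<delta> in at_right 0. \<forall>x. \<bar>- 1 / (m * \<delta>\<^sup>2) * conv (Q \<delta> i) \<phi> x - partial_deriv i \<phi> x\<bar> \<le> e" if "e > 0" for e
      by (rule Q_grad_uniform[OF \<phi> that])
    show "\<forall>\<^sub>F \<delta> in at_right 0. \<forall>x. - 1 / (m * \<delta>\<^sup>2) * conv (Q \<delta> i) \<phi> x - partial_deriv i \<phi> x \<noteq> 0 \<longrightarrow> norm x \<le> max R1 (R + \<rho>)"
      using eventually_at_right_real[of 0 1, OF zero_less_one]
    proof (rule eventually_mono)
      fix \<delta> :: real assume \<delta>: "\<delta> \<in> {0<..<1}"
      show "\<forall>x. - 1 / (m * \<delta>\<^sup>2) * conv (Q \<delta> i) \<phi> x - partial_deriv i \<phi> x \<noteq> 0 \<longrightarrow> norm x \<le> max R1 (R + \<rho>)"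
      proof (intro allI impI, rule ccontr)
        fix x assume *: "- 1 / (m * \<delta>\<^sup>2) * conv (Q \<delta> i) \<phi> x - partial_deriv i \<phi> x \<noteq> 0" "\<not> norm x \<le> max R1 (R + \<rho>)"
        have "partial_deriv i \<phi> x = 0" using R1[of x] *(2) by linarith
        moreover have "conv (Q \<delta> i) \<phi> x = 0"
        proof (rule ccontr)
          assume "conv (Q \<delta> i) \<phi> x \<noteq> 0"
          then have "norm x \<le> R + \<delta> * \<rho>"
            using \<delta> by (intro conv_support[of "Q \<delta> i" \<phi>] R K_supp) (auto simp: Q_def)
          moreover have "\<delta> * \<rho> \<le> 1 * \<rho>" using \<delta> rho(1) by (intro mult_right_mono) auto
          ultimately show False using *(2) by linarith
        qed
        ultimately show False using *(1) by simp
      qed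
    qed
  qed
  then show ?thesis
  proof (rule tendsto_cong[THEN iffD1, rotated])
    show "\<forall>\<^sub>F \<delta> in at_right 0. cls (\<lambda>x. - 1 / (m * \<delta>\<^sup>2) * conv (Q \<delta> i) \<phi> x) = (- 1 / (m * \<delta>\<^sup>2)) *\<^sub>R Conv (Q \<delta> i) (cls \<phi>)"
      using eventually_at_right_less[of 0]
    proof eventually_elim
      case (elim \<delta>)
      show ?case
        by (simp only: cls_cmult[OF conv_L2[OF Q_ckernel[OF elim] \<phi>L]] Conv_cls[OF Q_ckernel[OF elim] \<phi>L])
    qed
  qed
qed

lemma Conv_Q_antisymmetric:
  assumes "0 < \<delta>" shows "Conv (Q \<delta> i) u \<bullet> v = - (u \<bullet> Conv (Q \<delta> i) v)"
  unfolding Conv_adjoint[OF Q_ckernel[OF assms]] Q_odd[OF assms] Conv_uminus_kernel[OF Q_ckernel[OF assms]]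
  by simp

lemma Conv_K_symmetric:
  assumes "0 < \<delta>" shows "Conv (K \<delta>) u \<bullet> v = u \<bullet> Conv (K \<delta>) v"
  unfolding Conv_adjoint[OF K_ckernel[OF assms]] K_even[OF assms] ..

text \<open>Integration by parts as a limit: convolution with the odd kernel \<open>Q\<close> is
  antisymmetric for every \<delta>, and on test functions its rescaling converges in norm to the
  partial derivative.\<close>

lemma test_function_ibp:
  fixes \<phi> \<psi> :: "real^'n \<Rightarrow> real"
  assumes \<phi>: "\<phi> \<in> test_functions \<Omega>" and \<psi>: "\<psi> \<in> test_functions \<Omega>'"
  shows "cls (partial_deriv i \<phi>) \<bullet> cls \<psi> = - (cls \<phi> \<bullet> cls (partial_deriv i \<psi>))"
proof (rule tendsto_unique[OF trivial_limit_at_right_real])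
  show "((\<lambda>\<delta>. ((- 1 / (m * \<delta>\<^sup>2)) *\<^sub>R Conv (Q \<delta> i) (cls \<phi>)) \<bullet> cls \<psi>) \<longlongrightarrow> cls (partial_deriv i \<phi>) \<bullet> cls \<psi>) (at_right 0)"
    by (intro tendsto_inner Q_grad_tendsto[OF \<phi>] tendsto_const)
  have "((\<lambda>\<delta>. - (cls \<phi> \<bullet> ((- 1 / (m * \<delta>\<^sup>2)) *\<^sub>R Conv (Q \<delta> i) (cls \<psi>)))) \<longlongrightarrow> - (cls \<phi> \<bullet> cls (partial_deriv i \<psi>))) (at_right 0)"
    by (intro tendsto_minus tendsto_inner Q_grad_tendsto[OF \<psi>] tendsto_const)
  then show "((\<lambda>\<delta>. ((- 1 / (m * \<delta>\<^sup>2)) *\<^sub>R Conv (Q \<delta> i) (cls \<phi>)) \<bullet> cls \<psi>) \<longlongrightarrow> - (cls \<phi> \<bullet> cls (partial_deriv i \<psi>))) (at_right 0)"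
  proof (rule tendsto_cong[THEN iffD1, rotated])
    show "\<forall>\<^sub>F \<delta> in at_right 0. - (cls \<phi> \<bullet> ((- 1 / (m * \<delta>\<^sup>2)) *\<^sub>R Conv (Q \<delta> i) (cls \<psi>))) = ((- 1 / (m * \<delta>\<^sup>2)) *\<^sub>R Conv (Q \<delta> i) (cls \<phi>)) \<bullet> cls \<psi>"
      using eventually_at_right_less[of 0]
      by eventually_elim (simp add: Conv_Q_antisymmetric)
  qed
qed

end

section \<open>Periodic perforations\<close>

definition lat :: "real \<Rightarrow> (real^'n::finite) set" where
  "lat \<epsilon> = {a. \<forall>i. \<exists>m::int. a $ i = 2 * \<epsilon> * of_int m}"

text \<open>Half-open, so that the translates by \<open>lat \<epsilon>\<close> cover each point
  exactly once.\<close>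

definition cell :: "real \<Rightarrow> (real^'n::finite) set" where
  "cell \<epsilon> = {t. \<forall>i. - \<epsilon> \<le> t $ i \<and> t $ i < \<epsilon>}"

text \<open>Balls around all lattice points, whether or not they fit into the domain; exact
  periodicity makes their density computable.\<close>

definition balls :: "real \<Rightarrow> real \<Rightarrow> (real^'n::finite) set" where
  "balls \<epsilon> r = (\<Union>a\<in>lat \<epsilon>. cball a r)"

lemma countable_lat: "countable (lat \<epsilon> :: (real^'n::finite) set)"
proof -
  have "lat \<epsilon> \<subseteq> range (\<lambda>m :: 'n \<Rightarrow> int. \<chi> i. 2 * \<epsilon> * of_int (m i))"
  proof
    fix a :: "real^'n" assume "a \<in> lat \<epsilon>"
    then have "\<forall>i. \<exists>m::int. a $ i = 2 * \<epsilon> * of_int m" by (simp add: lat_def)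
    then obtain m :: "'n \<Rightarrow> int" where "\<forall>i. a $ i = 2 * \<epsilon> * of_int (m i)" by (auto simp: choice_iff)
    then have "a = (\<chi> i. 2 * \<epsilon> * of_int (m i))" by (simp add: vec_eq_iff)
    then show "a \<in> range (\<lambda>m :: 'n \<Rightarrow> int. \<chi> i. 2 * \<epsilon> * of_int (m i))" by blast
  qed
  then show ?thesis by (rule countable_subset) (intro countable_image countableI_type)
qed

lemma lat_cell_ex:
  assumes \<epsilon>: "0 < \<epsilon>" shows "\<exists>a\<in>lat \<epsilon>. (x :: real^'n::finite) - a \<in> cell \<epsilon>"
proof
  let ?m = "\<lambda>i. \<lfloor>(x $ i + \<epsilon>) / (2 * \<epsilon>)\<rfloor>"
  show "(\<chi> i. 2 * \<epsilon> * of_int (?m i)) \<in> lat \<epsilon>" by (auto simp: lat_def)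
  have "- \<epsilon> \<le> x $ i - 2 * \<epsilon> * of_int (?m i) \<and> x $ i - 2 * \<epsilon> * of_int (?m i) < \<epsilon>" for i
  proof -
    have "of_int (?m i) \<le> (x $ i + \<epsilon>) / (2 * \<epsilon>)" "(x $ i + \<epsilon>) / (2 * \<epsilon>) < of_int (?m i) + 1" by linarith+
    then have "of_int (?m i) * (2 * \<epsilon>) \<le> x $ i + \<epsilon>" "x $ i + \<epsilon> < (of_int (?m i) + 1) * (2 * \<epsilon>)"
      using \<epsilon> by (simp_all only: pos_le_divide_eq pos_divide_less_eq mult_pos_pos zero_less_numeral)
    then show ?thesis by (simp add: algebra_simps)
  qed
  then show "x - (\<chi> i. 2 * \<epsilon> * of_int (?m i)) \<in> cell \<epsilon>" by (simp add: cell_def)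
qed

lemma lat_cell_unique:
  assumes \<epsilon>: "0 < \<epsilon>" and a: "a \<in> lat \<epsilon>" "b \<in> lat \<epsilon>" "x - a \<in> cell \<epsilon>" "(x :: real^'n::finite) - b \<in> cell \<epsilon>"
  shows "a = b"
proof (rule vec_eq_iff[THEN iffD2], rule)
  fix i
  obtain m :: int where m1: "a $ i = 2 * \<epsilon> * of_int m"
    using a(1) unfolding lat_def by blast
  obtain n :: int where m2: "b $ i = 2 * \<epsilon> * of_int n"
    using a(2) unfolding lat_def by blast
  note m = m1 m2
  have "- \<epsilon> \<le> (x - a) $ i" "(x - a) $ i < \<epsilon>" "- \<epsilon> \<le> (x - b) $ i" "(x - b) $ i < \<epsilon>"
    using a(3,4) unfolding cell_def by blast+
  then have "\<bar>a $ i - b $ i\<bar> < 2 * \<epsilon>" by simp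
  then have "2 * \<epsilon> * \<bar>of_int (m - n)\<bar> < 2 * \<epsilon> * 1"
    unfolding m using \<epsilon> by (simp add: right_diff_distrib[symmetric] abs_mult)
  then have "\<bar>of_int (m - n) :: real\<bar> < 1" using \<epsilon> by (simp only: mult_less_cancel_left_pos mult_pos_pos zero_less_numeral)
  then have "m = n" by linarith
  then show "a $ i = b $ i" using m by simp
qed

lemma lat_uminus: "a \<in> lat \<epsilon> \<Longrightarrow> - a \<in> lat \<epsilon>"
  unfolding lat_def mem_Collect_eq
proof
  fix i assume "\<forall>i. \<exists>m::int. a $ i = 2 * \<epsilon> * of_int m"
  then obtain m :: int where "a $ i = 2 * \<epsilon> * of_int m" by blast
  then show "\<exists>m::int. (- a) $ i = 2 * \<epsilon> * of_int m" by (intro exI[of _ "- m"]) simp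
qed

lemma cell_borel [measurable]: "(cell \<epsilon> :: (real^'n::finite) set) \<in> sets borel"
proof -
  have "(cell \<epsilon> :: (real^'n) set) = (\<Inter>i\<in>UNIV. {t. - \<epsilon> \<le> t $ i} \<inter> {t. t $ i < \<epsilon>})" by (auto simp: cell_def)
  moreover have "{t. - \<epsilon> \<le> t $ i} \<in> sets borel" "{t. t $ i < \<epsilon>} \<in> sets borel" for i :: 'n
    by (auto intro!: borel_closed borel_open closed_Collect_le open_Collect_less continuous_intros)
  ultimately show ?thesis by (auto intro!: sets.finite_INT)
qed

lemma balls_borel [measurable]: "balls \<epsilon> r \<in> sets borel"
  unfolding balls_def by (intro sets.countable_UN'' countable_lat) simp

lemma emeasure_cell:
  assumes \<epsilon>: "0 < \<epsilon>"
  shows "emeasure lborel (cell \<epsilon> :: (real^'n::finite) set) = ennreal ((2 * \<epsilon>) ^ CARD('n))"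
proof -
  let ?l = "(\<chi> i. - \<epsilon>) :: real^'n" and ?u = "(\<chi> i. \<epsilon>) :: real^'n"
  have le: "?l \<bullet> b \<le> ?u \<bullet> b" if "b \<in> Basis" for b
    using that \<epsilon> by (auto simp: Basis_vec_def inner_axis)
  have pr: "(\<Prod>b\<in>Basis. (?u - ?l) \<bullet> b) = (2 * \<epsilon>) ^ CARD('n)"
    unfolding prod_Basis_cart by simp
  have "emeasure lborel (box ?l ?u) \<le> emeasure lborel (cell \<epsilon> :: (real^'n) set)"
    by (intro emeasure_mono) (auto simp: mem_box_cart cell_def less_imp_le)
  moreover have "emeasure lborel (cell \<epsilon> :: (real^'n) set) \<le> emeasure lborel (cbox ?l ?u)"
    by (intro emeasure_mono) (auto simp: mem_box_cart cell_def less_imp_le)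
  ultimately show ?thesis
    using emeasure_lborel_box[of ?l ?u, OF le] emeasure_lborel_cbox[of ?l ?u, OF le] unfolding pr by simp
qed

lemma emeasure_lborel_translate:
  assumes "A \<in> sets borel" shows "emeasure lborel {t. s + t \<in> A} = emeasure lborel (A :: 'a::euclidean_space set)"
proof -
  have "emeasure lborel A = emeasure (distr lborel borel ((+) s)) A" by (simp add: lborel_distr_plus)
  also have "\<dots> = emeasure lborel ((+) s -` A)" using assms by (subst emeasure_distr) auto
  also have "(+) s -` A = {t. s + t \<in> A}" by auto
  finally show ?thesis by simp
qed

text \<open>The measure of the balls seen through a cell does not depend on the position of the cell: cut
  the cell along the lattice translates of the ball, and cut the ball along the translates of the cell.\<close>

lemma emeasure_cell_balls:
  fixes s :: "real^'n::finite"
  assumes \<epsilon>: "0 < \<epsilon>" "r < \<epsilon>"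
  shows "emeasure lborel {t \<in> cell \<epsilon>. s + t \<in> balls \<epsilon> r} = emeasure lborel (cball (0 :: real^'n) r)"
proof -
  \<comment> \<open>As \<open>r < \<epsilon>\<close>, a ball lies in the cell around its centre;
    hence no point belongs to two balls.\<close>
  have sub: "y \<in> cell \<epsilon>" if "y \<in> cball (0 :: real^'n) r" for y
  proof -
    have "\<bar>y $ i\<bar> < \<epsilon>" for i using component_le_norm_cart[of y i] that \<epsilon> by simp
    then show ?thesis unfolding cell_def by (auto simp: abs_less_iff less_imp_le) (smt (verit))
  qed
  define A where "A a = {t \<in> cell \<epsilon>. s + t \<in> cball a r}" for a :: "real^'n"
  define B where "B a = {y \<in> cball 0 r. y + a - s \<in> cell \<epsilon>}" for a :: "real^'n"
  have [measurable]: "A a \<in> sets borel" "B a \<in> sets borel" for a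
  proof -
    have "A a = cell \<epsilon> \<inter> (\<lambda>t. s + t) -` cball a r" by (auto simp: A_def)
    moreover have "(\<lambda>t. s + t) -` cball a r \<in> sets borel"
      using measurable_sets[of "\<lambda>t. s + t" borel borel "cball a r"] by simp
    ultimately show "A a \<in> sets borel" by auto
    have "B a = cball 0 r \<inter> (\<lambda>y. y + a - s) -` cell \<epsilon>" by (auto simp: B_def)
    moreover have "(\<lambda>y. y + a - s) -` cell \<epsilon> \<in> sets borel"
      using measurable_sets[of "\<lambda>y. y + a - s" borel borel "cell \<epsilon>"] by simp
    ultimately show "B a \<in> sets borel" by auto
  qed
  have "{t \<in> cell \<epsilon>. s + t \<in> balls \<epsilon> r} = (\<Union>a\<in>lat \<epsilon>. A a)"
    by (auto simp: A_def balls_def)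
  moreover have "disjoint_family_on A (lat \<epsilon>)"
  proof (unfold disjoint_family_on_def, intro ballI impI)
    fix a b :: "real^'n" assume ab: "a \<in> lat \<epsilon>" "b \<in> lat \<epsilon>" "a \<noteq> b"
    show "A a \<inter> A b = {}"
    proof (rule ccontr)
      assume "A a \<inter> A b \<noteq> {}"
      then obtain t where "s + t \<in> cball a r" "s + t \<in> cball b r" by (auto simp: A_def)
      then have "(s + t) - a \<in> cell \<epsilon>" "(s + t) - b \<in> cell \<epsilon>"
        by (auto intro!: sub simp: dist_norm norm_minus_commute)
      then show False using lat_cell_unique[OF \<epsilon>(1) ab(1,2)] ab(3) by blast
    qed
  qed
  ultimately have 1: "emeasure lborel {t \<in> cell \<epsilon>. s + t \<in> balls \<epsilon> r} = (\<integral>\<^sup>+a. emeasure lborel (A a) \<partial>count_space (lat \<epsilon>))"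
    by (simp add: emeasure_UN_countable countable_lat)
  have "cball 0 r = (\<Union>a\<in>lat \<epsilon>. B a)"
  proof -
    have "\<exists>a\<in>lat \<epsilon>. y + a - s \<in> cell \<epsilon>" for y :: "real^'n"
    proof -
      obtain a where "a \<in> lat \<epsilon>" "(y - s) - a \<in> cell \<epsilon>" using lat_cell_ex[OF \<epsilon>(1)] by blast
      then show ?thesis using lat_uminus[of a \<epsilon>] by (intro bexI[of _ "- a"]) (auto simp: algebra_simps)
    qed
    then show ?thesis by (auto simp: B_def)
  qed
  moreover have "disjoint_family_on B (lat \<epsilon>)"
  proof (unfold disjoint_family_on_def, intro ballI impI)
    fix a b :: "real^'n" assume ab: "a \<in> lat \<epsilon>" "b \<in> lat \<epsilon>" "a \<noteq> b"
    show "B a \<inter> B b = {}"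
    proof (rule ccontr)
      assume "B a \<inter> B b \<noteq> {}"
      then obtain y where "y + a - s \<in> cell \<epsilon>" "y + b - s \<in> cell \<epsilon>" by (auto simp: B_def)
      then have "(y - s) - (- a) \<in> cell \<epsilon>" "(y - s) - (- b) \<in> cell \<epsilon>" by (auto simp: algebra_simps)
      then show False using lat_cell_unique[OF \<epsilon>(1) lat_uminus[OF ab(1)] lat_uminus[OF ab(2)]] ab(3) by auto
    qed
  qed
  ultimately have 2: "emeasure lborel (cball (0 :: real^'n) r) = (\<integral>\<^sup>+a. emeasure lborel (B a) \<partial>count_space (lat \<epsilon>))"
    by (simp add: emeasure_UN_countable countable_lat)
  have "emeasure lborel (A a) = emeasure lborel (B a)" for a
  proof -
    \<comment> \<open>The translation \<open>t \<mapsto> s + t - a\<close> carries the piece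
      \<open>A a\<close> of the cell onto the piece \<open>B a\<close> of the ball.\<close>
    have "A a = {t. (s - a) + t \<in> B a}"
      by (auto simp: A_def B_def dist_norm norm_minus_commute algebra_simps)
    then show ?thesis by (simp add: emeasure_lborel_translate)
  qed
  then show ?thesis by (simp add: 1 2)
qed

lemma integral_lborel_translate:
  fixes f :: "'a::euclidean_space \<Rightarrow> real"
  assumes "f \<in> borel_measurable borel"
  shows "(\<integral>x. f (x + t) \<partial>lborel) = (\<integral>x. f x \<partial>lborel)"
proof -
  have "(\<integral>x. f x \<partial>lborel) = (\<integral>x. f x \<partial>distr lborel borel ((+) t))" by (simp add: lborel_distr_plus)
  also have "\<dots> = (\<integral>x. f (t + x) \<partial>lborel)" using assms by (intro integral_distr) auto
  finally show ?thesis by (simp add: add.commute)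
qed

lemma integrable_lborel_translate:
  fixes f :: "'a::euclidean_space \<Rightarrow> real"
  assumes "integrable lborel f"
  shows "integrable lborel (\<lambda>x. f (x + t))"
proof -
  have "integrable (distr lborel borel ((+) t)) f" using assms by (simp add: lborel_distr_plus)
  then show ?thesis using assms by (subst (asm) integrable_distr_eq) (auto simp: add.commute)
qed

text \<open>Average over shifts \<open>t\<close> in one cell. Shifting the balls but not
  \<open>g\<close> costs at most \<open>\<eta>\<close>; after exchanging the integrals, the mean
  over \<open>t\<close> replaces the indicator by the volume ratio of ball and cell, which is the
  same at every point by \<open>emeasure_cell_balls\<close>.\<close>

lemma balls_average:
  fixes g :: "real^'n::finite \<Rightarrow> real"
  assumes \<epsilon>: "0 < \<epsilon>" "0 \<le> r" "r < \<epsilon>" and g: "integrable lborel g"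
    and \<eta>: "\<And>t. t \<in> cell \<epsilon> \<Longrightarrow> (\<integral>x. \<bar>g (x + t) - g x\<bar> \<partial>lborel) \<le> \<eta>"
  shows "\<bar>(\<integral>x. indicator (balls \<epsilon> r) x * g x \<partial>lborel)
    - unit_ball_vol CARD('n) / 2 ^ CARD('n) * (r / \<epsilon>) ^ CARD('n) * (\<integral>x. g x \<partial>lborel)\<bar> \<le> \<eta>"
proof -
  define H :: "(real^'n) set" where "H = balls \<epsilon> r"
  define V where "V = (2 * \<epsilon>) ^ CARD('n)"
  have V: "V > 0" using \<epsilon> by (simp add: V_def)
  have [measurable]: "H \<in> sets borel" by (simp add: H_def)
  have gm [measurable]: "g \<in> borel_measurable borel" using g by auto
  define I where "I = (\<integral>x. indicator H x * g x \<partial>lborel)"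
  have gH: "integrable lborel (\<lambda>x. indicator H (x + t) * f x)" if "integrable lborel f" for t and f :: "real^'n \<Rightarrow> real"
  proof (rule Bochner_Integration.integrable_bound[OF that])
    show "(\<lambda>x. indicator H (x + t) * f x) \<in> borel_measurable lborel"
      using that by measurable
  qed (auto simp: indicator_def)
  have step: "\<bar>I - (\<integral>x. indicator H (x + t) * g x \<partial>lborel)\<bar> \<le> \<eta>" if t: "t \<in> cell \<epsilon>" for t
  proof -
    note gt = integrable_lborel_translate[OF g, of t]
    have "I = (\<integral>x. indicator H (x + t) * g (x + t) \<partial>lborel)"
      unfolding I_def by (subst integral_lborel_translate) auto
    then have "\<bar>I - (\<integral>x. indicator H (x + t) * g x \<partial>lborel)\<bar> = \<bar>\<integral>x. indicator H (x + t) * (g (x + t) - g x) \<partial>lborel\<bar>"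
      using gH[OF gt, of t] gH[OF g, of t] by (simp add: right_diff_distrib)
    also have "\<dots> \<le> (\<integral>x. norm (indicator H (x + t) * (g (x + t) - g x)) \<partial>lborel)"
      unfolding real_norm_def[symmetric] by (rule integral_norm_bound)
    also have "\<dots> \<le> (\<integral>x. \<bar>g (x + t) - g x\<bar> \<partial>lborel)"
      using gH[OF Bochner_Integration.integrable_diff[OF gt g], of t] gt g
      by (intro integral_mono) (auto simp: indicator_def)
    finally show ?thesis using \<eta>[OF t] by linarith
  qed
  have cellV: "integrable lborel (indicator (cell \<epsilon>) :: real^'n \<Rightarrow> real)"
    using emeasure_cell[OF \<epsilon>(1), where 'n = 'n] by (intro integrable_real_indicator) auto
  have cellI: "(\<integral>t. indicator (cell \<epsilon> :: (real^'n) set) t \<partial>lborel) = V"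
    using emeasure_cell[OF \<epsilon>(1), where 'n = 'n] \<epsilon> by (simp add: V_def measure_def)
  \<comment> \<open>First component the shift, second the point. Integrating over the shift first
    gives the volume of one ball times \<open>g\<close>.\<close>
  define F where "F p = indicator (cell \<epsilon>) (fst p) * indicator H (snd p + fst p) * g (snd p)" for p :: "(real^'n) \<times> (real^'n)"
  have Fi: "integrable (lborel \<Otimes>\<^sub>M lborel) F"
  proof (rule Bochner_Integration.integrable_bound)
    have "integrable (lborel \<Otimes>\<^sub>M lborel) (\<lambda>p :: (real^'n) \<times> (real^'n). indicator (cell \<epsilon>) (fst p) * g (snd p))"
    proof (rule lborel_pair.Fubini_integrable)
      show "integrable lborel (\<lambda>x :: real^'n. \<integral>y. norm (indicator (cell \<epsilon>) (fst (x, y)) * g (snd (x, y))) \<partial>lborel)"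
        using cellV by (simp add: abs_mult integrable_mult_left)
      show "AE x :: real^'n in lborel. integrable lborel (\<lambda>y. indicator (cell \<epsilon>) (fst (x, y)) * g (snd (x, y)))"
        using g by simp
    qed measurable
    then show "integrable (lborel \<Otimes>\<^sub>M lborel) (\<lambda>p :: (real^'n) \<times> (real^'n). indicator (cell \<epsilon>) (fst p) * g (snd p))" .
    show "F \<in> borel_measurable (lborel \<Otimes>\<^sub>M lborel)" unfolding F_def by measurable
    show "AE p in lborel \<Otimes>\<^sub>M lborel. norm (F p) \<le> norm (indicator (cell \<epsilon>) (fst p) * g (snd p))"
      by (intro AE_I2) (auto simp: F_def indicator_def)
  qed
  define G where "G t = indicator (cell \<epsilon>) t * (I - (\<integral>x. indicator H (x + t) * g x \<partial>lborel))" for t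
  have "integrable lborel G \<and> V * I - measure lborel (cball (0 :: real^'n) r) * (\<integral>x. g x \<partial>lborel)
    = (\<integral>t. G t \<partial>lborel)"
  proof -
    have "(\<integral>t. \<integral>x. F (t, x) \<partial>lborel \<partial>lborel) = (\<integral>x. \<integral>t. F (t, x) \<partial>lborel \<partial>lborel)"
      using lborel_pair.Fubini_integral[of "\<lambda>t x. F (t, x)"] Fi by simp
    also have "\<dots> = (\<integral>x. measure lborel (cball (0 :: real^'n) r) * g x \<partial>lborel)"
    proof (rule Bochner_Integration.integral_cong[OF refl])
      fix x
      have set: "{t \<in> cell \<epsilon>. x + t \<in> H} \<in> sets lborel"
        using measurable_sets[of "\<lambda>t. x + t" borel borel H] by (auto simp: vimage_def Collect_conj_eq)
      have "(\<integral>t. F (t, x) \<partial>lborel) = (\<integral>t. indicator {t \<in> cell \<epsilon>. x + t \<in> H} t * g x \<partial>lborel)"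
        by (intro Bochner_Integration.integral_cong) (auto simp: F_def indicator_def)
      also have "\<dots> = measure lborel {t \<in> cell \<epsilon>. x + t \<in> H} * g x"
        using set by simp
      also have "measure lborel {t \<in> cell \<epsilon>. x + t \<in> H} = measure lborel (cball (0 :: real^'n) r)"
        using emeasure_cell_balls[OF \<epsilon>(1,3), of x] by (simp add: measure_def H_def)
      finally show "(\<integral>t. F (t, x) \<partial>lborel) = measure lborel (cball (0 :: real^'n) r) * g x" .
    qed
    finally have 1: "(\<integral>t. \<integral>x. F (t, x) \<partial>lborel \<partial>lborel) = measure lborel (cball (0 :: real^'n) r) * (\<integral>x. g x \<partial>lborel)"
      by simp
    have 2: "integrable lborel (\<lambda>t. \<integral>x. F (t, x) \<partial>lborel)" by (rule lborel_pair.integrable_fst'[OF Fi])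
    have 3: "(\<integral>x. F (t, x) \<partial>lborel) = indicator (cell \<epsilon>) t * (\<integral>x. indicator H (x + t) * g x \<partial>lborel)" for t
      by (simp add: F_def mult.assoc)
    show ?thesis
      using 1 2 cellV cellI unfolding 3 G_def by (simp add: right_diff_distrib)
  qed
  then have G: "integrable lborel G"
    and eq: "V * I - measure lborel (cball (0 :: real^'n) r) * (\<integral>x. g x \<partial>lborel) = (\<integral>t. G t \<partial>lborel)" by auto
  have "\<bar>\<integral>t. G t \<partial>lborel\<bar> \<le> (\<integral>t. norm (G t) \<partial>lborel)"
    unfolding real_norm_def[symmetric] by (rule integral_norm_bound)
  also have "\<dots> \<le> (\<integral>t. indicator (cell \<epsilon> :: (real^'n) set) t * \<eta> \<partial>lborel)"
  proof (rule integral_mono[OF integrable_norm[OF G]])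
    show "norm (G t) \<le> indicator (cell \<epsilon>) t * \<eta>" for t
      using step[of t] by (simp add: G_def indicator_def)
  qed (use cellV in simp)
  also have "\<dots> = V * \<eta>" using cellI by simp
  finally have "\<bar>V * I - measure lborel (cball (0 :: real^'n) r) * (\<integral>x. g x \<partial>lborel)\<bar> \<le> V * \<eta>"
    unfolding eq .
  moreover have "measure lborel (cball (0 :: real^'n) r) = V * (unit_ball_vol CARD('n) / 2 ^ CARD('n) * (r / \<epsilon>) ^ CARD('n))"
    using \<epsilon> content_cball[OF \<epsilon>(2), of "0 :: real^'n"] by (simp add: V_def power_mult_distrib power_divide)
  ultimately have "\<bar>V * (I - unit_ball_vol CARD('n) / 2 ^ CARD('n) * (r / \<epsilon>) ^ CARD('n) * (\<integral>x. g x \<partial>lborel))\<bar> \<le> V * \<eta>"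
    by (simp add: algebra_simps)
  then show ?thesis using V unfolding abs_mult I_def H_def by simp
qed


text \<open>Dominated convergence: off the sphere of radius \<open>R\<close>, a null set, the
  truncated function is continuous, and bounded shifts keep all supports in one ball.\<close>

lemma translate_continuous_L1:
  fixes c :: "'a::euclidean_space \<Rightarrow> real" and R :: real
  assumes c: "continuous_on UNIV c" and B: "\<And>x. \<bar>c x\<bar> \<le> B"
  defines "g \<equiv> \<lambda>x. indicator (cball 0 R) x * c x"
  shows "((\<lambda>t. \<integral>x. \<bar>g (x + t) - g x\<bar> \<partial>lborel) \<longlongrightarrow> 0) (at 0)"
  unfolding tendsto_at_iff_sequentially
proof (intro allI impI)
  fix X :: "nat \<Rightarrow> 'a" assume X: "X \<longlonglongrightarrow> 0"
  have cm [measurable]: "c \<in> borel_measurable borel" by (rule borel_measurable_continuous_onI[OF c])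
  have gm [measurable]: "g \<in> borel_measurable borel" unfolding g_def
    by (intro borel_measurable_times borel_measurable_indicator cm) simp
  obtain M where M: "\<And>n. norm (X n) \<le> M"
    using X convergent_imp_Bseq[of X] by (auto simp: convergent_def Bseq_def)
  have gB: "\<bar>g x\<bar> \<le> B" "g x \<noteq> 0 \<Longrightarrow> norm x \<le> R" for x
    using B[of x] order_trans[OF abs_ge_zero B[of x]] by (auto simp: g_def indicator_def split: if_splits)
  have "(\<lambda>n. \<integral>x. \<bar>g (x + X n) - g x\<bar> \<partial>lborel) \<longlonglongrightarrow> (\<integral>x. 0 \<partial>(lborel :: 'a measure))"
  proof (rule integral_dominated_convergence[where w = "\<lambda>x. 2 * B * indicator (cball 0 (\<bar>R\<bar> + M)) x"])
    show "integrable lborel (\<lambda>x::'a. 2 * B * indicator (cball 0 (\<bar>R\<bar> + M)) x)"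
      using emeasure_bounded_finite[OF bounded_cball, of "0::'a" "\<bar>R\<bar> + M"]
      by (intro integrable_mult_right integrable_real_indicator) auto
    show "AE x in lborel. norm \<bar>g (x + X n) - g x\<bar> \<le> 2 * B * indicator (cball 0 (\<bar>R\<bar> + M)) x" for n
    proof (intro AE_I2)
      fix x :: 'a
      show "norm \<bar>g (x + X n) - g x\<bar> \<le> 2 * B * indicator (cball 0 (\<bar>R\<bar> + M)) x"
      proof (cases "norm x \<le> \<bar>R\<bar> + M")
        case True
        then show ?thesis using gB(1)[of x] gB(1)[of "x + X n"] by simp
      next
        case False
        have "norm x \<le> norm (x + X n) + norm (X n)" using norm_triangle_ineq4[of "x + X n" "X n"] by simp
        then have "\<not> norm (x + X n) \<le> R" using False M[of n] by linarith
        moreover have "\<not> norm x \<le> R" using False M[of n] norm_ge_zero[of "X n"] by linarith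
        ultimately have "g (x + X n) = 0" "g x = 0" using gB(2) by blast+
        then show ?thesis using False by simp
      qed
    qed
    have "AE x in lebesgue. x \<notin> sphere (0::'a) R"
      using negligible_sphere[of "0::'a" R] by (intro AE_not_in) (simp add: negligible_iff_null_sets)
    then have "AE x in lborel. x \<notin> sphere (0::'a) R" by (simp add: AE_completion_iff)
    then show "AE x in lborel. (\<lambda>n. \<bar>g (x + X n) - g x\<bar>) \<longlonglongrightarrow> 0"
    proof eventually_elim
      case (elim x)
      have lim: "(\<lambda>n. x + X n) \<longlonglongrightarrow> x" using tendsto_add[OF tendsto_const[of x] X] by simp
      have "(\<lambda>n. g (x + X n)) \<longlonglongrightarrow> g x"
      proof (cases "norm x < R")
        case True
        have "\<forall>\<^sub>F n in sequentially. x + X n \<in> ball 0 R"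
          using lim True by (intro topological_tendstoD[OF lim]) auto
        then have "\<forall>\<^sub>F n in sequentially. c (x + X n) = g (x + X n)"
          by eventually_elim (simp add: g_def)
        moreover have "(\<lambda>n. c (x + X n)) \<longlonglongrightarrow> c x"
          using continuous_on_tendsto_compose[OF c lim] by simp
        moreover have "g x = c x" using True by (simp add: g_def)
        ultimately show ?thesis using tendsto_cong by fastforce
      next
        case False
        with elim have x: "norm x > R" by auto
        have "\<forall>\<^sub>F n in sequentially. x + X n \<in> - cball 0 R"
          using x by (intro topological_tendstoD[OF lim]) auto
        then have "\<forall>\<^sub>F n in sequentially. g (x + X n) = 0"
          by eventually_elim (simp add: g_def)
        moreover have "g x = 0" using x by (simp add: g_def)
        ultimately show ?thesis by (simp add: tendsto_eventually)
      qed
      from tendsto_diff[OF this tendsto_const[of "g x"]] show ?case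
        by (intro tendsto_rabs_zero) simp
    qed
  qed measurable
  then show "((\<lambda>t. \<integral>x. \<bar>g (x + t) - g x\<bar> \<partial>lborel) \<circ> X) \<longlonglongrightarrow> 0"
    by (simp add: o_def)
qed

text \<open>Truncate \<open>f\<close> in value and in space, then approximate it almost everywhere
  by continuous functions cut off in the same way; the common bound permits dominated convergence.
  The approximant may jump on a sphere, which \<open>translate_continuous_L1\<close>
  tolerates.\<close>

lemma L1_approx_continuous:
  fixes f :: "'a::euclidean_space \<Rightarrow> real"
  assumes f: "integrable lebesgue f" and e: "0 < e"
  shows "\<exists>c B R. continuous_on UNIV c \<and> (\<forall>x. \<bar>c x\<bar> \<le> B) \<and>
    (\<integral>x. \<bar>f x - indicator (cball 0 R) x * c x\<bar> \<partial>lebesgue) < e"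
proof -
  have fm [measurable]: "f \<in> borel_measurable lebesgue" using f by auto
  have cb [measurable]: "cball (0::'a) R \<in> sets lebesgue" for R by simp
  \<comment> \<open>Clamping to \<open>[- k, k]\<close>. It is continuous and moves no value by more
    than its own size, which gives the majorant \<open>\<bar>f x\<bar>\<close>.\<close>
  define cl where "cl k y = max (- real k) (min (real k) y)" for k :: nat and y :: real
  have clb: "\<bar>cl k y\<bar> \<le> real k" for k y by (auto simp: cl_def)
  have clc: "continuous_on UNIV (cl k)" for k unfolding cl_def by (intro continuous_intros)
  have cle: "\<bar>y - cl k y\<bar> \<le> \<bar>y\<bar>" for k y by (auto simp: cl_def)
  have clm: "(\<lambda>x. cl k (h x)) \<in> borel_measurable lebesgue" if "h \<in> borel_measurable lebesgue" for k and h :: "'a \<Rightarrow> real"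
    using that unfolding cl_def by measurable
  define F where "F k x = indicator (cball 0 (real k)) x * cl k (f x)" for k and x :: 'a
  have Fm [measurable]: "F k \<in> borel_measurable lebesgue" for k
    unfolding F_def using clm[OF fm, of k] by measurable
  have "(\<lambda>k. \<integral>x. \<bar>f x - F k x\<bar> \<partial>lebesgue) \<longlonglongrightarrow> (\<integral>x. 0 \<partial>(lebesgue :: 'a measure))"
  proof (rule integral_dominated_convergence[where w = "\<lambda>x. \<bar>f x\<bar>"])
    show "AE x in lebesgue. norm \<bar>f x - F k x\<bar> \<le> \<bar>f x\<bar>" for k
      using cle by (intro AE_I2) (auto simp: F_def indicator_def)
    show "AE x in lebesgue. (\<lambda>k. \<bar>f x - F k x\<bar>) \<longlonglongrightarrow> 0"
    proof (intro AE_I2 tendsto_eventually)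
      fix x
      obtain N :: nat where N: "max \<bar>f x\<bar> (norm x) \<le> real N" using real_arch_simple by blast
      show "\<forall>\<^sub>F k in sequentially. \<bar>f x - F k x\<bar> = 0"
        using eventually_ge_at_top[of N]
      proof eventually_elim
        case (elim k)
        then have "max \<bar>f x\<bar> (norm x) \<le> real k" using N by (meson of_nat_mono order_trans)
        then show ?case by (auto simp: F_def cl_def)
      qed
    qed
  qed (use f in auto)
  then have "(\<lambda>k. \<integral>x. \<bar>f x - F k x\<bar> \<partial>lebesgue) \<longlonglongrightarrow> 0" by simp
  then have "\<forall>\<^sub>F k in sequentially. (\<integral>x. \<bar>f x - F k x\<bar> \<partial>lebesgue) < e / 2"
    using e by (intro order_tendstoD(2)) auto
  then obtain k where k: "(\<integral>x. \<bar>f x - F k x\<bar> \<partial>lebesgue) < e / 2"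
    using eventually_happens'[OF sequentially_bot] by blast
  \<comment> \<open>Lebesgue measurability yields continuous functions converging to
    \<open>f\<close> off a negligible set, with no control of their size; clamping supplies that
    control.\<close>
  have "f measurable_on UNIV" by (rule lebesgue_measurable_imp_measurable_on[OF fm]) simp
  then obtain N h where N: "negligible N" and h: "\<And>n::nat. continuous_on UNIV (h n)"
    and lim: "\<And>x. x \<notin> N \<Longrightarrow> (\<lambda>n. h n x) \<longlonglongrightarrow> f x"
    unfolding measurable_on_def by auto
  define G where "G n x = indicator (cball 0 (real k)) x * cl k (h n x)" for n and x :: 'a
  have hm [measurable]: "h n \<in> borel_measurable lebesgue" for n
    using borel_measurable_continuous_onI[OF h[of n]] by (intro measurable_completion) simp
  have Gm [measurable]: "G n \<in> borel_measurable lebesgue" for n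
    unfolding G_def using clm[OF hm, of k n] by measurable
  have bounded_int: "integrable lebesgue (\<lambda>x. real k * indicator (cball (0::'a) (real k)) x)"
  proof -
    have "cball (0::'a) (real k) \<in> lmeasurable" by simp
    then show ?thesis by (intro integrable_mult_right) (simp add: lmeasurable_iff_integrable)
  qed
  have "(\<lambda>n. \<integral>x. \<bar>F k x - G n x\<bar> \<partial>lebesgue) \<longlonglongrightarrow> (\<integral>x. 0 \<partial>(lebesgue :: 'a measure))"
  proof (rule integral_dominated_convergence[where w = "\<lambda>x. 2 * (real k * indicator (cball (0::'a) (real k)) x)"])
    show "integrable lebesgue (\<lambda>x. 2 * (real k * indicator (cball (0::'a) (real k)) x))"
      using bounded_int by (rule integrable_mult_right)
    show "AE x in lebesgue. norm \<bar>F k x - G n x\<bar> \<le> 2 * (real k * indicator (cball (0::'a) (real k)) x)" for n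
    proof (intro AE_I2)
      fix x :: 'a
      show "norm \<bar>F k x - G n x\<bar> \<le> 2 * (real k * indicator (cball (0::'a) (real k)) x)"
        using clb[of k "f x"] clb[of k "h n x"] abs_triangle_ineq4[of "cl k (f x)" "cl k (h n x)"]
        by (cases "norm x \<le> real k") (auto simp: F_def G_def)
    qed
    have "AE x in lebesgue. x \<notin> N" using N by (intro AE_not_in) (simp add: negligible_iff_null_sets)
    then show "AE x in lebesgue. (\<lambda>n. \<bar>F k x - G n x\<bar>) \<longlonglongrightarrow> 0"
    proof eventually_elim
      case (elim x)
      have "(\<lambda>n. cl k (h n x)) \<longlonglongrightarrow> cl k (f x)"
        using continuous_on_tendsto_compose[OF clc lim[OF elim]] by simp
      then have "(\<lambda>n. \<bar>F k x - G n x\<bar>) \<longlonglongrightarrow> \<bar>F k x - indicator (cball 0 (real k)) x * cl k (f x)\<bar>"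
        unfolding G_def by (intro tendsto_intros)
      then show ?case by (simp add: F_def)
    qed
  qed measurable
  then have "(\<lambda>n. \<integral>x. \<bar>F k x - G n x\<bar> \<partial>lebesgue) \<longlonglongrightarrow> 0" by simp
  then have "\<forall>\<^sub>F n in sequentially. (\<integral>x. \<bar>F k x - G n x\<bar> \<partial>lebesgue) < e / 2"
    using e by (intro order_tendstoD(2)) auto
  then obtain n where n: "(\<integral>x. \<bar>F k x - G n x\<bar> \<partial>lebesgue) < e / 2"
    using eventually_happens'[OF sequentially_bot] by blast
  have Fi: "integrable lebesgue (F k)" and Gi: "integrable lebesgue (G n)"
    using clb by (intro Bochner_Integration.integrable_bound[OF bounded_int] Fm Gm AE_I2; auto simp: F_def G_def indicator_def)+
  have "(\<integral>x. \<bar>f x - G n x\<bar> \<partial>lebesgue) \<le> (\<integral>x. \<bar>f x - F k x\<bar> + \<bar>F k x - G n x\<bar> \<partial>lebesgue)"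
    using f Fi Gi by (intro integral_mono) auto
  also have "\<dots> < e" using k n f Fi Gi by simp
  finally have "(\<integral>x. \<bar>f x - G n x\<bar> \<partial>lebesgue) < e" .
  moreover have "continuous_on UNIV (\<lambda>x. cl k (h n x))"
    by (rule continuous_on_compose2[OF clc h]) simp
  ultimately show ?thesis
    unfolding G_def using clb by blast
qed

lemma cell_norm_le: "t \<in> cell \<epsilon> \<Longrightarrow> norm (t :: real^'n::finite) \<le> real CARD('n) * \<epsilon>"
proof -
  assume t: "t \<in> cell \<epsilon>"
  have "\<bar>t $ i\<bar> \<le> \<epsilon>" for i
  proof -
    have "- \<epsilon> \<le> t $ i" "t $ i < \<epsilon>" using t unfolding cell_def by blast+
    then show ?thesis by linarith
  qed
  then have "(\<Sum>i\<in>UNIV. \<bar>t $ i\<bar>) \<le> (\<Sum>i\<in>(UNIV :: 'n set). \<epsilon>)" by (intro sum_mono)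
  then show ?thesis using norm_le_l1_cart[of t] by simp
qed

lemma integrable_indicator_mult:
  fixes f :: "'a \<Rightarrow> real"
  assumes "integrable M f" "A \<in> sets M"
  shows "integrable M (\<lambda>x. indicator A x * f x)"
proof (rule Bochner_Integration.integrable_bound[OF assms(1)])
  show "(\<lambda>x. indicator A x * f x) \<in> borel_measurable M" using assms by measurable
qed (auto simp: indicator_def)

text \<open>For an approximant \<open>g\<close> of \<open>f\<close> the averaging estimate applies
  once every shift within a cell moves \<open>g\<close> by at most \<open>e'\<close> in mean.
  Replacing \<open>f\<close> by \<open>g\<close> costs little uniformly in \<epsilon>, because
  indicators and densities are bounded.\<close>

lemma balls_weak_limit:
  fixes f :: "real^'n::finite \<Rightarrow> real"
  assumes f: "integrable lebesgue f" and r: "\<forall>\<^sub>F \<epsilon> in at_right 0. 0 \<le> r \<epsilon> \<and> r \<epsilon> < \<epsilon>"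
    and s: "((\<lambda>\<epsilon>. r \<epsilon> / \<epsilon>) \<longlongrightarrow> s) (at_right 0)"
  shows "((\<lambda>\<epsilon>. \<integral>x. indicator (balls \<epsilon> (r \<epsilon>)) x * f x \<partial>lebesgue)
    \<longlongrightarrow> unit_ball_vol CARD('n) / 2 ^ CARD('n) * s ^ CARD('n) * (\<integral>x. f x \<partial>lebesgue)) (at_right 0)"
proof -
  define C where "C t = unit_ball_vol CARD('n) / 2 ^ CARD('n) * t ^ CARD('n)" for t :: real
  let ?I = "\<lambda>\<epsilon> f. \<integral>x. indicator (balls \<epsilon> (r \<epsilon>)) x * f x \<partial>lebesgue"
  have bl [measurable]: "balls \<epsilon> \<rho> \<in> sets lebesgue" for \<epsilon> \<rho> using balls_borel[of \<epsilon> \<rho>] by auto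
  have lim0: "((\<lambda>\<epsilon>. ?I \<epsilon> f - C (r \<epsilon> / \<epsilon>) * (\<integral>x. f x \<partial>lebesgue)) \<longlongrightarrow> 0) (at_right 0)"
  proof (rule tendstoI)
    fix e :: real assume e: "e > 0"
    \<comment> \<open>Eventually \<open>r \<epsilon> / \<epsilon> < max 0 s + 1\<close>, so
      \<open>K\<close> dominates the density; as \<open>K\<close> is at least 1, the errors
      \<open>e'\<close>, \<open>e'\<close> and \<open>K * e'\<close> are each at most
      \<open>e / 3\<close>.\<close>
    define K where "K = max 1 (C (max 0 s + 1))"
    have K: "K \<ge> 1" by (simp add: K_def)
    define e' where "e' = e / (3 * K)"
    have e': "e' > 0" using e K by (simp add: e'_def)
    obtain c B R where c: "continuous_on UNIV c" "\<And>x. \<bar>c x\<bar> \<le> B"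
      and app: "(\<integral>x. \<bar>f x - indicator (cball 0 R) x * c x\<bar> \<partial>lebesgue) < e'"
      using L1_approx_continuous[OF f e'] by blast
    define g where "g x = indicator (cball 0 R) x * c x" for x
    have cm: "c \<in> borel_measurable borel" by (rule borel_measurable_continuous_onI[OF c(1)])
    have gm [measurable]: "g \<in> borel_measurable borel" unfolding g_def
      by (intro borel_measurable_times borel_measurable_indicator cm) simp
    have gi: "integrable lebesgue g"
    proof (rule integrable_lebesgue_bounded_support)
      show "g \<in> borel_measurable lebesgue" by (intro measurable_completion) simp
      show "\<bar>g x\<bar> \<le> \<bar>B\<bar>" for x using c(2)[of x] by (auto simp: g_def indicator_def)
      show "g x \<noteq> 0 \<Longrightarrow> norm x \<le> R" for x by (auto simp: g_def indicator_def split: if_splits)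
    qed
    have gi': "integrable lborel g" using gi integrable_completion[of g lborel] by simp
    have "((\<lambda>t. \<integral>x. \<bar>g (x + t) - g x\<bar> \<partial>lborel) \<longlongrightarrow> 0) (at 0)"
      unfolding g_def by (rule translate_continuous_L1[OF c])
    then have "\<forall>\<^sub>F t in at 0. dist (\<integral>x. \<bar>g (x + t) - g x\<bar> \<partial>lborel) 0 < e'"
      using e' by (rule tendstoD)
    then obtain d where d: "d > 0" "\<And>t. t \<noteq> 0 \<Longrightarrow> dist t 0 < d \<Longrightarrow> dist (\<integral>x. \<bar>g (x + t) - g x\<bar> \<partial>lborel) 0 < e'"
      unfolding eventually_at by blast
    have d': "(\<integral>x. \<bar>g (x + t) - g x\<bar> \<partial>lborel) \<le> e'" if "norm t < d" for t
      using d(2)[of t] that e' by (cases "t = 0") auto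
    have "\<forall>\<^sub>F \<epsilon> in at_right 0. \<epsilon> \<in> {0<..<d / CARD('n)}"
      using d(1) by (intro eventually_at_right_real) simp
    moreover have "\<forall>\<^sub>F \<epsilon> in at_right 0. r \<epsilon> / \<epsilon> < max 0 s + 1"
      using s by (rule order_tendstoD(2)) simp
    ultimately show "\<forall>\<^sub>F \<epsilon> in at_right 0. dist (?I \<epsilon> f - C (r \<epsilon> / \<epsilon>) * (\<integral>x. f x \<partial>lebesgue)) 0 < e"
      using r
    proof eventually_elim
      case (elim \<epsilon>)
      have \<epsilon>: "0 < \<epsilon>" "\<epsilon> < d / CARD('n)" using elim by auto
      have "norm t < d" if "t \<in> cell \<epsilon>" for t :: "real^'n"
      proof -
        have "real CARD('n) * \<epsilon> < d" using \<epsilon>(2) by (simp add: field_simps)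
        then show ?thesis using cell_norm_le[OF that] by linarith
      qed
      then have "\<bar>(\<integral>x. indicator (balls \<epsilon> (r \<epsilon>)) x * g x \<partial>lborel) - C (r \<epsilon> / \<epsilon>) * (\<integral>x. g x \<partial>lborel)\<bar> \<le> e'"
        using elim \<epsilon> unfolding C_def by (intro balls_average gi' d') auto
      also have "(\<integral>x. indicator (balls \<epsilon> (r \<epsilon>)) x * g x \<partial>lborel) = ?I \<epsilon> g"
        by (intro integral_completion[symmetric]) measurable
      also have "(\<integral>x. g x \<partial>lborel) = (\<integral>x. g x \<partial>lebesgue)"
        by (intro integral_completion[symmetric]) measurable
      finally have 1: "\<bar>?I \<epsilon> g - C (r \<epsilon> / \<epsilon>) * (\<integral>x. g x \<partial>lebesgue)\<bar> \<le> e'" .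
      have fg: "integrable lebesgue (\<lambda>x. f x - g x)" using f gi by auto
      have "\<bar>?I \<epsilon> f - ?I \<epsilon> g\<bar> = \<bar>\<integral>x. indicator (balls \<epsilon> (r \<epsilon>)) x * (f x - g x) \<partial>lebesgue\<bar>"
        using integrable_indicator_mult[OF f bl] integrable_indicator_mult[OF gi bl] by (simp add: right_diff_distrib)
      also have "\<dots> \<le> (\<integral>x. norm (indicator (balls \<epsilon> (r \<epsilon>)) x * (f x - g x)) \<partial>lebesgue)"
        unfolding real_norm_def[symmetric] by (rule integral_norm_bound)
      also have "\<dots> \<le> (\<integral>x. \<bar>f x - g x\<bar> \<partial>lebesgue)"
        using integrable_indicator_mult[OF fg bl] fg by (intro integral_mono) (auto simp: indicator_def)
      finally have 2: "\<bar>?I \<epsilon> f - ?I \<epsilon> g\<bar> < e'" using app by (simp add: g_def)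
      have "\<bar>(\<integral>x. g x \<partial>lebesgue) - (\<integral>x. f x \<partial>lebesgue)\<bar> = \<bar>\<integral>x. f x - g x \<partial>lebesgue\<bar>"
        using f gi by simp
      also have "\<dots> \<le> (\<integral>x. \<bar>f x - g x\<bar> \<partial>lebesgue)"
        using integral_norm_bound[of lebesgue "\<lambda>x. f x - g x"] by simp
      finally have 3: "\<bar>(\<integral>x. g x \<partial>lebesgue) - (\<integral>x. f x \<partial>lebesgue)\<bar> < e'" using app by (simp add: g_def)
      have C: "0 \<le> C (r \<epsilon> / \<epsilon>)" "C (r \<epsilon> / \<epsilon>) \<le> K"
      proof -
        have u: "0 \<le> unit_ball_vol CARD('n) / 2 ^ CARD('n)" by (simp add: unit_ball_vol_nonneg)
        show "0 \<le> C (r \<epsilon> / \<epsilon>)" unfolding C_def using u elim \<epsilon> by (intro mult_nonneg_nonneg) auto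
        have "C (r \<epsilon> / \<epsilon>) \<le> C (max 0 s + 1)" unfolding C_def
          using u elim \<epsilon> by (intro mult_left_mono power_mono) auto
        then show "C (r \<epsilon> / \<epsilon>) \<le> K" by (simp add: K_def)
      qed
      have 4: "\<bar>C (r \<epsilon> / \<epsilon>) * ((\<integral>x. g x \<partial>lebesgue) - (\<integral>x. f x \<partial>lebesgue))\<bar> \<le> K * e'"
        unfolding abs_mult using C 3 e' by (intro mult_mono) auto
      have Ke: "e' \<le> K * e'" using K e' by simp
      have "\<bar>?I \<epsilon> f - C (r \<epsilon> / \<epsilon>) * (\<integral>x. f x \<partial>lebesgue)\<bar> < e' + e' + K * e'"
        using 1 2 4 by (simp only: right_diff_distrib)
      also have "\<dots> \<le> 3 * (K * e')" using Ke by linarith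
      also have "\<dots> = e" using K by (simp add: e'_def)
      finally show ?case by simp
    qed
  qed
  have "((\<lambda>\<epsilon>. C (r \<epsilon> / \<epsilon>) * (\<integral>x. f x \<partial>lebesgue)) \<longlongrightarrow> C s * (\<integral>x. f x \<partial>lebesgue)) (at_right 0)"
    unfolding C_def by (intro tendsto_intros s)
  from tendsto_add[OF lim0 this] show ?thesis by (simp add: C_def)
qed


section \<open>Holes inside the domain\<close>

definition holes :: "(real^'n::finite) set \<Rightarrow> real \<Rightarrow> real \<Rightarrow> (real^'n) set" where
  "holes \<Omega> \<epsilon> \<rho> = (\<Union>a\<in>{a \<in> lat \<epsilon>. a \<in> \<Omega> \<and> cball a \<rho> \<subseteq> \<Omega>}. cball a \<rho>)"

lemma perforated_domain_eq: "perforated_domain \<Omega> \<epsilon> \<rho> = \<Omega> - holes \<Omega> \<epsilon> \<rho>"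
  unfolding perforated_domain_def holes_def lat_def by blast

lemma holes_borel [measurable]: "holes \<Omega> \<epsilon> \<rho> \<in> sets borel"
  unfolding holes_def by (intro sets.countable_UN'' countable_subset[OF _ countable_lat[of \<epsilon>]]) auto

lemma perforated_domain_lebesgue: "open \<Omega> \<Longrightarrow> perforated_domain \<Omega> \<epsilon> \<rho> \<in> sets lebesgue"
  unfolding perforated_domain_eq using holes_borel[of \<Omega> \<epsilon> \<rho>] by (intro sets.Diff) auto

text \<open>A ball of radius below \<epsilon> containing \<open>x\<close> stays within distance
  \<open>2 * \<epsilon>\<close> of \<open>x\<close>, hence inside the domain once \<epsilon> is
  small. The threshold does not depend on the radius, so the radius may vary with
  \<epsilon>.\<close>

lemma holes_eq_balls:
  assumes \<Omega>: "open \<Omega>" "x \<in> \<Omega>"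
  shows "\<forall>\<^sub>F \<epsilon> in at_right 0. \<forall>\<rho>. 0 \<le> \<rho> \<and> \<rho> < \<epsilon> \<longrightarrow> (x \<in> holes \<Omega> \<epsilon> \<rho> \<longleftrightarrow> x \<in> balls \<epsilon> \<rho>)"
proof -
  obtain d where d: "d > 0" "ball x d \<subseteq> \<Omega>" using \<Omega> by (meson openE)
  have "\<forall>\<^sub>F \<epsilon> in at_right 0. \<epsilon> \<in> {0<..<d / 2}" using d(1) by (intro eventually_at_right_real) simp
  then show ?thesis
  proof eventually_elim
    case (elim \<epsilon>)
    show ?case
    proof (intro allI impI iffI)
      fix \<rho> assume \<rho>: "0 \<le> \<rho> \<and> \<rho> < \<epsilon>"
      show "x \<in> balls \<epsilon> \<rho>" if "x \<in> holes \<Omega> \<epsilon> \<rho>" using that by (auto simp: holes_def balls_def)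
      assume "x \<in> balls \<epsilon> \<rho>"
      then obtain a where a: "a \<in> lat \<epsilon>" "x \<in> cball a \<rho>" by (auto simp: balls_def)
      have "cball a \<rho> \<subseteq> ball x d"
      proof
        fix y assume "y \<in> cball a \<rho>"
        then have "dist x y \<le> \<rho> + \<rho>" using a(2) dist_triangle[of x y a] by (simp add: dist_commute)
        then show "y \<in> ball x d" using \<rho> elim by simp
      qed
      then have "cball a \<rho> \<subseteq> \<Omega>" using d(2) by blast
      moreover have "a \<in> cball a \<rho>" using \<rho> by simp
      ultimately have "a \<in> \<Omega>" "cball a \<rho> \<subseteq> \<Omega>" by blast+
      then show "x \<in> holes \<Omega> \<epsilon> \<rho>" using a unfolding holes_def by blast
    qed
  qed
qed

text \<open>Balls that do not fit into the domain are not removed, so holes and periodic balls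
  differ near the boundary. At each point of the domain they agree for small \<epsilon>, and
  dominated convergence removes the difference.\<close>

lemma perforated_weak_limit:
  fixes f :: "real^'n::finite \<Rightarrow> real"
  assumes \<Omega>: "open \<Omega>" and f: "integrable lebesgue f"
    and r: "\<forall>\<^sub>F \<epsilon> in at_right 0. 0 \<le> r \<epsilon> \<and> r \<epsilon> < \<epsilon>"
    and s: "((\<lambda>\<epsilon>. r \<epsilon> / \<epsilon>) \<longlongrightarrow> s) (at_right 0)"
  shows "((\<lambda>\<epsilon>. \<integral>x. indicator (perforated_domain \<Omega> \<epsilon> (r \<epsilon>)) x * f x \<partial>lebesgue)
    \<longlongrightarrow> (1 - unit_ball_vol CARD('n) / 2 ^ CARD('n) * s ^ CARD('n)) * (\<integral>x. indicator \<Omega> x * f x \<partial>lebesgue)) (at_right 0)"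
proof -
  define g where "g x = indicator \<Omega> x * f x" for x
  have \<Omega>m: "\<Omega> \<in> sets lebesgue" using \<Omega> by auto
  have g: "integrable lebesgue g" unfolding g_def by (rule integrable_indicator_mult[OF f \<Omega>m])
  have hl: "holes \<Omega> \<epsilon> \<rho> \<in> sets lebesgue" and bl: "balls \<epsilon> \<rho> \<in> sets lebesgue" for \<epsilon> \<rho>
    using holes_borel[of \<Omega> \<epsilon> \<rho>] balls_borel[of \<epsilon> \<rho>] by auto
  let ?H = "\<lambda>\<epsilon> x. indicator (holes \<Omega> \<epsilon> (r \<epsilon>)) x * g x" and ?B = "\<lambda>\<epsilon> x. indicator (balls \<epsilon> (r \<epsilon>)) x * g x"
  have Hi: "integrable lebesgue (?H \<epsilon>)" and Bi: "integrable lebesgue (?B \<epsilon>)" for \<epsilon>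
    by (intro integrable_indicator_mult g hl bl)+
  have diff: "((\<lambda>\<epsilon>. \<integral>x. ?B \<epsilon> x - ?H \<epsilon> x \<partial>lebesgue) \<longlongrightarrow> 0) (at_right 0)"
    unfolding tendsto_at_iff_sequentially
  proof (intro allI impI)
    fix X :: "nat \<Rightarrow> real" assume X: "\<forall>i. X i \<in> {0<..} - {0}" "X \<longlonglongrightarrow> 0"
    have Xf: "filterlim X (at_right 0) sequentially"
      using X unfolding filterlim_at by (simp add: less_imp_neq[symmetric])
    have "(\<lambda>n. \<integral>x. ?B (X n) x - ?H (X n) x \<partial>lebesgue) \<longlonglongrightarrow> (\<integral>x. 0 \<partial>(lebesgue :: (real^'n) measure))"
    proof (rule integral_dominated_convergence[where w = "\<lambda>x. 2 * \<bar>g x\<bar>"])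
      show "(\<lambda>x. ?B (X n) x - ?H (X n) x) \<in> borel_measurable lebesgue" for n
        by (rule borel_measurable_integrable) (intro Bochner_Integration.integrable_diff Hi Bi)
      show "integrable lebesgue (\<lambda>x. 2 * \<bar>g x\<bar>)" using g by simp
      show "AE x in lebesgue. norm (?B (X n) x - ?H (X n) x) \<le> 2 * \<bar>g x\<bar>" for n
        by (intro AE_I2) (auto simp: indicator_def)
      show "AE x in lebesgue. (\<lambda>n. ?B (X n) x - ?H (X n) x) \<longlonglongrightarrow> 0"
      proof (intro AE_I2 tendsto_eventually)
        fix x
        show "\<forall>\<^sub>F n in sequentially. ?B (X n) x - ?H (X n) x = 0"
        proof (cases "x \<in> \<Omega>")
          case True
          have "\<forall>\<^sub>F \<epsilon> in at_right 0. x \<in> holes \<Omega> \<epsilon> (r \<epsilon>) \<longleftrightarrow> x \<in> balls \<epsilon> (r \<epsilon>)"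
            using holes_eq_balls[OF \<Omega> True] r by eventually_elim simp
          then have "\<forall>\<^sub>F n in sequentially. x \<in> holes \<Omega> (X n) (r (X n)) \<longleftrightarrow> x \<in> balls (X n) (r (X n))"
            using Xf unfolding filterlim_iff by blast
          then show ?thesis by eventually_elim (simp add: indicator_def)
        qed (simp add: g_def)
      qed
    qed simp
    then show "((\<lambda>\<epsilon>. \<integral>x. ?B \<epsilon> x - ?H \<epsilon> x \<partial>lebesgue) \<circ> X) \<longlonglongrightarrow> 0" by (simp add: o_def)
  qed
  have eq: "(\<integral>x. indicator (perforated_domain \<Omega> \<epsilon> (r \<epsilon>)) x * f x \<partial>lebesgue)
    = (\<integral>x. g x \<partial>lebesgue) - (\<integral>x. ?B \<epsilon> x \<partial>lebesgue) + (\<integral>x. ?B \<epsilon> x - ?H \<epsilon> x \<partial>lebesgue)" for \<epsilon>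
  proof -
    have "holes \<Omega> \<epsilon> (r \<epsilon>) \<subseteq> \<Omega>" by (auto simp: holes_def)
    then have "indicator (perforated_domain \<Omega> \<epsilon> (r \<epsilon>)) x * f x = g x - ?H \<epsilon> x" for x
      by (auto simp: perforated_domain_eq g_def indicator_def)
    then have "(\<integral>x. indicator (perforated_domain \<Omega> \<epsilon> (r \<epsilon>)) x * f x \<partial>lebesgue) = (\<integral>x. g x - ?H \<epsilon> x \<partial>lebesgue)" by simp
    also have "\<dots> = (\<integral>x. g x \<partial>lebesgue) - (\<integral>x. ?H \<epsilon> x \<partial>lebesgue)"
      by (rule Bochner_Integration.integral_diff[OF g Hi])
    finally show ?thesis using Bochner_Integration.integral_diff[OF Bi[of \<epsilon>] Hi[of \<epsilon>]] by linarith
  qed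
  have "((\<lambda>\<epsilon>. (\<integral>x. g x \<partial>lebesgue) - (\<integral>x. ?B \<epsilon> x \<partial>lebesgue) + (\<integral>x. ?B \<epsilon> x - ?H \<epsilon> x \<partial>lebesgue))
    \<longlongrightarrow> (\<integral>x. g x \<partial>lebesgue) - unit_ball_vol CARD('n) / 2 ^ CARD('n) * s ^ CARD('n) * (\<integral>x. g x \<partial>lebesgue) + 0) (at_right 0)"
    by (intro tendsto_add tendsto_diff tendsto_const balls_weak_limit[OF g r s] diff)
  moreover have "(\<integral>x. g x \<partial>lebesgue) - unit_ball_vol CARD('n) / 2 ^ CARD('n) * s ^ CARD('n) * (\<integral>x. g x \<partial>lebesgue) + 0
     = (1 - unit_ball_vol CARD('n) / 2 ^ CARD('n) * s ^ CARD('n)) * (\<integral>x. indicator \<Omega> x * f x \<partial>lebesgue)"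
    unfolding g_def[symmetric] by (simp add: algebra_simps)
  ultimately show ?thesis unfolding eq by simp
qed

text \<open>The unit ball lies in the cube of side 2; this keeps the volume fraction left by the
  holes nonnegative.\<close>

lemma unit_ball_vol_le: "unit_ball_vol CARD('n::finite) / 2 ^ CARD('n) \<le> 1"
proof -
  let ?l = "(\<chi> i. - 1) :: real^'n" and ?u = "(\<chi> i. 1) :: real^'n"
  have le: "?l \<bullet> b \<le> ?u \<bullet> b" if "b \<in> Basis" for b
    using that by (auto simp: Basis_vec_def inner_axis)
  have sub: "cball 0 1 \<subseteq> cbox ?l ?u"
  proof
    fix x :: "real^'n" assume "x \<in> cball 0 1"
    then have "\<bar>x $ i\<bar> \<le> 1" for i using component_le_norm_cart[of x i] by simp
    then show "x \<in> cbox ?l ?u" by (auto simp: mem_box_cart abs_le_iff minus_le_iff)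
  qed
  have "emeasure lborel (cball (0 :: real^'n) 1) \<le> emeasure lborel (cbox ?l ?u)"
    by (rule emeasure_mono[OF sub]) simp
  then have "ennreal (unit_ball_vol CARD('n)) \<le> ennreal (2 ^ CARD('n))"
    using emeasure_cball[of 1 "0 :: real^'n"] emeasure_lborel_cbox[of ?l ?u, OF le] unfolding prod_Basis_cart by simp
  then show ?thesis by (simp add: ennreal_le_iff)
qed

section \<open>The limit of vanishing perforation period\<close>

text \<open>Duality: test the bilinear bound with the vector itself. Passing from \<open>l\<close>
  to \<open>max 0 l\<close> allows the norms in the bound to be enlarged without knowing the sign of
  \<open>l\<close>.\<close>

lemma norm_Res_Conv_le:
  assumes k: "ckernel k" and S: "S \<in> sets lebesgue"
    and bound: "\<And>u v. \<bar>Conv k (Res S u) \<bullet> Res S v\<bar> \<le> l * norm (Res S u) * norm (Res S v)"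
  shows "norm (Res S (Conv k (Res S u))) \<le> max 0 l * norm u"
proof -
  let ?y = "Res S (Conv k (Res S u))"
  have RR: "Res S (Res S v) = Res S v" for v using S by (simp add: Res_Res)
  have "(norm ?y)\<^sup>2 = Conv k (Res S u) \<bullet> Res S ?y"
    by (simp only: power2_norm_eq_inner Res_inner_commute[OF S])
  also have "\<dots> \<le> l * norm (Res S u) * norm (Res S ?y)" using bound[of u ?y] by simp
  also have "\<dots> \<le> max 0 l * norm u * norm ?y"
    unfolding RR by (intro mult_right_mono mult_mono Res_norm_le S) auto
  finally show ?thesis
    by (cases "norm ?y = 0") (auto simp: power2_eq_square)
qed

text \<open>Values of the convolution are inner products with fixed classes, so weak convergence
  becomes pointwise convergence. These classes have equal norm, which bounds the values, and the
  finite measure of \<open>S\<close> allows dominated convergence.\<close>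

lemma Conv_compact:
  fixes X :: "nat \<Rightarrow> 'a::euclidean_space l2"
  assumes k: "ckernel k" and S: "S \<in> lmeasurable"
    and M: "\<And>n. norm (X n) \<le> M" and weak: "\<And>g. (\<lambda>n. X n \<bullet> g) \<longlonglongrightarrow> 0"
  shows "(\<lambda>n. Res S (Conv k (X n))) \<longlonglongrightarrow> 0"
proof -
  have Sl: "S \<in> sets lebesgue" using S by (rule fmeasurableD)
  \<comment> \<open>By translation invariance this is the squared norm of the class of
    \<open>y \<mapsto> k (x - y)\<close> for every \<open>x\<close>.\<close>
  define c where "c = (\<integral>y. (k y)\<^sup>2 \<partial>lebesgue)"
  have kx: "(norm (cls (\<lambda>y. k (x - y))))\<^sup>2 = c" for x
  proof -
    have "ckernel (\<lambda>y. (k y)\<^sup>2)"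
      unfolding power2_eq_square using k by (intro ckernel_mult_continuous) (auto simp: ckernel_def)
    then show ?thesis
      using norm_cls_sq[OF ckernel_L2[OF ckernel_reflect[OF k]], of x]
        integral_lebesgue_reflect[OF ckernel_borel, of "\<lambda>y. (k y)\<^sup>2" x] by (simp add: c_def)
  qed
  have L: "conv k (fn (X n)) \<in> L2 UNIV" for n by (intro conv_L2 k fn_L2)
  have eq: "(norm (Res S (Conv k (X n))))\<^sup>2 = (\<integral>x. indicator S x * (conv k (fn (X n)) x)\<^sup>2 \<partial>lebesgue)" for n
  proof -
    have "Res S (Conv k (X n)) = cls (\<lambda>x. indicator S x * conv k (fn (X n)) x)"
      unfolding Conv_def by (rule Res_cls[OF Sl L])
    then have "(norm (Res S (Conv k (X n))))\<^sup>2 = (\<integral>x. (indicator S x * conv k (fn (X n)) x)\<^sup>2 \<partial>lebesgue)"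
      by (simp add: norm_cls_sq[OF L2_indicator[OF Sl L]])
    also have "\<dots> = (\<integral>x. indicator S x * (conv k (fn (X n)) x)\<^sup>2 \<partial>lebesgue)"
      by (intro Bochner_Integration.integral_cong) (auto simp: indicator_def)
    finally show ?thesis .
  qed
  have "(\<lambda>n. \<integral>x. indicator S x * (conv k (fn (X n)) x)\<^sup>2 \<partial>lebesgue) \<longlonglongrightarrow> (\<integral>x. 0 \<partial>(lebesgue :: 'a measure))"
  proof (rule integral_dominated_convergence[where w = "\<lambda>x. indicator S x * (c * M\<^sup>2)"])
    have "integrable lebesgue (indicator S :: 'a \<Rightarrow> real)" using S by (simp add: lmeasurable_iff_integrable)
    then show "integrable lebesgue (\<lambda>x. indicator S x * (c * M\<^sup>2))" by (rule integrable_mult_left)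
    show "(\<lambda>x. indicator S x * (conv k (fn (X n)) x)\<^sup>2) \<in> borel_measurable lebesgue" for n
      using L2_measurable[OF L[of n]] Sl by measurable
    show "AE x in lebesgue. norm (indicator S x * (conv k (fn (X n)) x)\<^sup>2) \<le> indicator S x * (c * M\<^sup>2)" for n
    proof (intro AE_I2)
      fix x
      have "(conv k (fn (X n)) x)\<^sup>2 = (cls (\<lambda>y. k (x - y)) \<bullet> X n)\<^sup>2"
        by (simp add: conv_eq_inner[OF k])
      also have "\<dots> \<le> (norm (cls (\<lambda>y. k (x - y))))\<^sup>2 * (norm (X n))\<^sup>2"
        using Cauchy_Schwarz_ineq[of "cls (\<lambda>y. k (x - y))" "X n"] by (simp only: power2_norm_eq_inner)
      also have "\<dots> \<le> c * M\<^sup>2"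
        unfolding kx using M[of n] by (intro mult_left_mono power_mono) (auto simp: c_def)
      finally show "norm (indicator S x * (conv k (fn (X n)) x)\<^sup>2) \<le> indicator S x * (c * M\<^sup>2)"
        by (simp add: indicator_def)
    qed
    show "AE x in lebesgue. (\<lambda>n. indicator S x * (conv k (fn (X n)) x)\<^sup>2) \<longlonglongrightarrow> 0"
    proof (intro AE_I2)
      fix x
      have "(\<lambda>n. conv k (fn (X n)) x) \<longlonglongrightarrow> 0"
        using weak[of "cls (\<lambda>y. k (x - y))"] by (simp add: conv_eq_inner[OF k] inner_commute)
      then have "(\<lambda>n. indicator S x * (conv k (fn (X n)) x)\<^sup>2) \<longlonglongrightarrow> indicator S x * 0\<^sup>2"
        by (intro tendsto_intros)
      then show "(\<lambda>n. indicator S x * (conv k (fn (X n)) x)\<^sup>2) \<longlonglongrightarrow> 0" by simp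
    qed
  qed simp
  then have "(\<lambda>n. (norm (Res S (Conv k (X n))))\<^sup>2) \<longlonglongrightarrow> 0" unfolding eq by simp
  then have "(\<lambda>n. sqrt ((norm (Res S (Conv k (X n))))\<^sup>2)) \<longlonglongrightarrow> sqrt 0" by (intro tendsto_intros)
  then show ?thesis by (simp add: tendsto_norm_zero_iff)
qed

text \<open>The error \<open>e = u \<epsilon> - v\<close> satisfies \<open>e = Res (S \<epsilon>) (Conv k e) + s\<close> with \<open>s\<close> weakly null.
  Since \<open>Conv k\<close> is compact and contractive on \<open>\<Omega>\<close>, \<open>Res \<Omega> (Conv k e)\<close> tends to zero in norm.\<close>

lemma perforation_limit:
  fixes u :: "real \<Rightarrow> 'a::euclidean_space l2"
  assumes k: "ckernel k" and \<Omega>: "\<Omega> \<in> lmeasurable" and l: "l < 1"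
    and bound: "\<And>u v. \<bar>Conv k (Res \<Omega> u) \<bullet> Res \<Omega> v\<bar> \<le> l * norm (Res \<Omega> u) * norm (Res \<Omega> v)"
    and S: "\<And>\<epsilon>. S \<epsilon> \<in> sets lebesgue" "\<And>\<epsilon>. S \<epsilon> \<subseteq> \<Omega>"
    and weak: "\<And>q g. ((\<lambda>\<epsilon>. Res (S \<epsilon>) q \<bullet> g) \<longlongrightarrow> \<theta> * (Res \<Omega> q \<bullet> g)) (at_right 0)"
    and u: "\<forall>\<^sub>F \<epsilon> in at_right 0. u \<epsilon> = Res (S \<epsilon>) (Conv k (u \<epsilon>) - f)"
    and v: "v = \<theta> *\<^sub>R Res \<Omega> (Conv k v - f)"
  shows "((\<lambda>\<epsilon>. u \<epsilon> \<bullet> g) \<longlongrightarrow> v \<bullet> g) (at_right 0)"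
proof -
  have \<Omega>l: "\<Omega> \<in> sets lebesgue" using \<Omega> by (rule fmeasurableD)
  define q where "q = Conv k v - f"
  define s where "s \<epsilon> = Res (S \<epsilon>) q - \<theta> *\<^sub>R Res \<Omega> q" for \<epsilon>
  define z where "z \<epsilon> = Res \<Omega> (Conv k (s \<epsilon>))" for \<epsilon>
  define y where "y \<epsilon> = Res \<Omega> (Conv k (u \<epsilon> - v))" for \<epsilon>
  define L where "L = max 0 l"
  have L: "0 \<le> L" "L < 1" using l by (auto simp: L_def)
  note cl = Conv_linear[OF k] and rl = Res_linear[OF \<Omega>l] and sl = Res_linear[OF S(1)]
  have sweak: "((\<lambda>\<epsilon>. s \<epsilon> \<bullet> g) \<longlongrightarrow> 0) (at_right 0)" for g
  proof -
    have "((\<lambda>\<epsilon>. Res (S \<epsilon>) q \<bullet> g - \<theta> * (Res \<Omega> q \<bullet> g)) \<longlongrightarrow> \<theta> * (Res \<Omega> q \<bullet> g) - \<theta> * (Res \<Omega> q \<bullet> g)) (at_right 0)"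
      by (intro tendsto_diff weak tendsto_const)
    then show ?thesis by (simp add: s_def inner_diff_left)
  qed
  have sbound: "norm (s \<epsilon>) \<le> norm q + \<bar>\<theta>\<bar> * norm q" for \<epsilon>
    unfolding s_def using norm_triangle_ineq4[of "Res (S \<epsilon>) q" "\<theta> *\<^sub>R Res \<Omega> q"] Res_norm_le[OF S(1), of \<epsilon> q]
      mult_left_mono[OF Res_norm_le[OF \<Omega>l, of q], of "\<bar>\<theta>\<bar>"] by simp
  have zlim: "(z \<longlongrightarrow> 0) (at_right 0)"
    unfolding tendsto_at_iff_sequentially
  proof (intro allI impI)
    fix X :: "nat \<Rightarrow> real" assume X: "\<forall>i. X i \<in> {0<..} - {0}" "X \<longlonglongrightarrow> 0"
    have "(\<lambda>n. s (X n) \<bullet> g) \<longlonglongrightarrow> 0" for g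
      using sweak[of g] X unfolding tendsto_at_iff_sequentially by (simp add: o_def)
    from Conv_compact[OF k \<Omega>, of "\<lambda>n. s (X n)", OF sbound this]
    show "(z \<circ> X) \<longlonglongrightarrow> 0" by (simp add: z_def o_def)
  qed
  have e: "\<forall>\<^sub>F \<epsilon> in at_right 0. u \<epsilon> - v = Res (S \<epsilon>) (y \<epsilon>) + s \<epsilon>"
    using u
  proof eventually_elim
    case (elim \<epsilon>)
    \<comment> \<open>Since \<open>S \<epsilon>\<close> lies in the domain, restricting to the
      domain first changes nothing.\<close>
    have SR: "Res (S \<epsilon>) (y \<epsilon>) = Res (S \<epsilon>) (Conv k (u \<epsilon> - v))"
      unfolding y_def using S \<Omega>l by (simp add: Res_Res Int_absorb2)
    have "Conv k (u \<epsilon>) - f = Conv k (u \<epsilon> - v) + q"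
      by (simp add: q_def linear_diff[OF cl])
    then have "Res (S \<epsilon>) (Conv k (u \<epsilon>) - f) = Res (S \<epsilon>) (y \<epsilon>) + Res (S \<epsilon>) q"
      by (simp only: SR linear_add[OF sl])
    then have "u \<epsilon> = Res (S \<epsilon>) (y \<epsilon>) + Res (S \<epsilon>) q"
      by (rule trans[OF elim])
    moreover have "\<theta> *\<^sub>R Res \<Omega> q = v" unfolding q_def by (rule v[symmetric])
    ultimately show ?case by (simp only: s_def) (simp only: add_diff_eq)
  qed
  have ylim: "(y \<longlongrightarrow> 0) (at_right 0)"
  proof (rule Lim_null_comparison)
    show "\<forall>\<^sub>F \<epsilon> in at_right 0. norm (y \<epsilon>) \<le> 1 / (1 - L) * norm (z \<epsilon>)"
      using e
    proof eventually_elim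
      case (elim \<epsilon>)
      have RR: "Res \<Omega> (Res (S \<epsilon>) (y \<epsilon>)) = Res (S \<epsilon>) (y \<epsilon>)"
        using S \<Omega>l by (simp add: Res_Res Int_absorb1)
      have "y \<epsilon> = Res \<Omega> (Conv k (u \<epsilon> - v))" by (rule y_def)
      \<comment> \<open>Inserting the error equation into \<open>y\<close> gives the contraction
        applied to a restriction of \<open>y\<close>, plus \<open>z\<close>. The first term is
        absorbed, at the price of a factor \<open>1 / (1 - L)\<close> independent of
        \<epsilon>.\<close>
      also have "\<dots> = Res \<Omega> (Conv k (Res \<Omega> (Res (S \<epsilon>) (y \<epsilon>)))) + z \<epsilon>"
        by (simp only: elim RR z_def linear_add[OF cl] linear_add[OF rl])
      finally have "norm (y \<epsilon>) \<le> norm (Res \<Omega> (Conv k (Res \<Omega> (Res (S \<epsilon>) (y \<epsilon>))))) + norm (z \<epsilon>)"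
        by (rule ord_eq_le_trans[OF arg_cong[where f = norm] norm_triangle_ineq])
      also have "norm (Res \<Omega> (Conv k (Res \<Omega> (Res (S \<epsilon>) (y \<epsilon>))))) \<le> L * norm (Res (S \<epsilon>) (y \<epsilon>))"
        unfolding L_def by (rule norm_Res_Conv_le[OF k \<Omega>l bound])
      also have "\<dots> \<le> L * norm (y \<epsilon>)" using L by (intro mult_left_mono Res_norm_le S)
      finally have "(1 - L) * norm (y \<epsilon>) \<le> norm (z \<epsilon>)" by (simp add: algebra_simps)
      then show ?case using L by (simp add: field_simps)
    qed
    have "((\<lambda>\<epsilon>. 1 / (1 - L) * norm (z \<epsilon>)) \<longlongrightarrow> 1 / (1 - L) * norm (0 :: 'a l2)) (at_right 0)"
      by (intro tendsto_intros zlim)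
    then show "((\<lambda>\<epsilon>. 1 / (1 - L) * norm (z \<epsilon>)) \<longlongrightarrow> 0) (at_right 0)" by simp
  qed
  have Sy: "((\<lambda>\<epsilon>. Res (S \<epsilon>) (y \<epsilon>) \<bullet> g) \<longlongrightarrow> 0) (at_right 0)"
  proof (rule Lim_null_comparison)
    show "\<forall>\<^sub>F \<epsilon> in at_right 0. norm (Res (S \<epsilon>) (y \<epsilon>) \<bullet> g) \<le> norm (y \<epsilon>) * norm g"
    proof (rule always_eventually, rule allI)
      fix \<epsilon>
      show "norm (Res (S \<epsilon>) (y \<epsilon>) \<bullet> g) \<le> norm (y \<epsilon>) * norm g"
        using Cauchy_Schwarz_ineq2[of "Res (S \<epsilon>) (y \<epsilon>)" g] mult_right_mono[OF Res_norm_le[OF S(1), of \<epsilon> "y \<epsilon>"] norm_ge_zero[of g]]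
        by simp
    qed
    have "((\<lambda>\<epsilon>. norm (y \<epsilon>) * norm g) \<longlongrightarrow> norm (0 :: 'a l2) * norm g) (at_right 0)"
      by (intro tendsto_intros ylim)
    then show "((\<lambda>\<epsilon>. norm (y \<epsilon>) * norm g) \<longlongrightarrow> 0) (at_right 0)" by simp
  qed
  have "((\<lambda>\<epsilon>. Res (S \<epsilon>) (y \<epsilon>) \<bullet> g + s \<epsilon> \<bullet> g + v \<bullet> g) \<longlongrightarrow> 0 + 0 + v \<bullet> g) (at_right 0)"
    by (intro tendsto_add Sy sweak tendsto_const)
  then have "((\<lambda>\<epsilon>. Res (S \<epsilon>) (y \<epsilon>) \<bullet> g + s \<epsilon> \<bullet> g + v \<bullet> g) \<longlongrightarrow> v \<bullet> g) (at_right 0)" by simp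
  then show ?thesis
  proof (rule tendsto_cong[THEN iffD1, rotated])
    show "\<forall>\<^sub>F \<epsilon> in at_right 0. Res (S \<epsilon>) (y \<epsilon>) \<bullet> g + s \<epsilon> \<bullet> g + v \<bullet> g = u \<epsilon> \<bullet> g"
      using e
    proof eventually_elim
      case (elim \<epsilon>)
      have "u \<epsilon> = Res (S \<epsilon>) (y \<epsilon>) + s \<epsilon> + v" using elim by (simp add: algebra_simps)
      then show ?case by (simp add: inner_add_left)
    qed
  qed
qed

lemma nonlocal_limit_problem_solvable:
  fixes f :: "'a::euclidean_space l2"
  assumes k: "ckernel k" and \<Omega>: "\<Omega> \<in> sets lebesgue" and l: "l < 1" and \<theta>: "0 \<le> \<theta>" "\<theta> \<le> 1"
    and bound: "\<And>u v. \<bar>Conv k (Res \<Omega> u) \<bullet> Res \<Omega> v\<bar> \<le> l * norm (Res \<Omega> u) * norm (Res \<Omega> v)"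
  shows "\<exists>v. v = \<theta> *\<^sub>R Res \<Omega> (Conv k v - f)"
proof -
  define T where "T v = \<theta> *\<^sub>R Res \<Omega> (Conv k (Res \<Omega> v) - f)" for v
  define L where "L = max 0 l"
  have L: "0 \<le> L" "L < 1" using l by (auto simp: L_def)
  note cl = Conv_linear[OF k] and rl = Res_linear[OF \<Omega>]
  have "\<exists>!v. T v = v"
  proof (rule banach_fix_type[OF L], intro allI)
    fix x y :: "'a l2"
      have "T x - T y = \<theta> *\<^sub>R Res \<Omega> (Conv k (Res \<Omega> (x - y)))"
        unfolding T_def by (simp add: linear_diff[OF cl] linear_diff[OF rl] scaleR_diff_right)
      then have "dist (T x) (T y) = \<theta> * norm (Res \<Omega> (Conv k (Res \<Omega> (x - y))))"
        using \<theta> by (simp add: dist_norm)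
      also have "\<dots> \<le> 1 * (L * norm (x - y))"
        using \<theta> L norm_Res_Conv_le[OF k \<Omega> bound, of "x - y"] by (intro mult_mono) (auto simp: L_def)
      finally show "dist (T x) (T y) \<le> L * dist x y" by (simp add: dist_norm)
  qed
  then obtain v where v: "T v = v" by blast
  have "Res \<Omega> (T v) = T v"
    using \<Omega> by (simp add: T_def linear_cmul[OF rl] Res_Res)
  then have "Res \<Omega> v = v" by (simp only: v)
  then show ?thesis using v by (intro exI[of _ v]) (simp add: T_def)
qed

section \<open>The local limit\<close>

lemma Res_cls_test_function:
  assumes \<Omega>: "\<Omega> \<in> sets lebesgue" and \<phi>: "\<phi> \<in> test_functions \<Omega>"
  shows "Res \<Omega> (cls \<phi>) = cls \<phi>"
proof -
  have "indicator \<Omega> x * \<phi> x = \<phi> x" for x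
    using test_function_support[OF \<phi>, of x] by (cases "\<phi> x = 0") simp_all
  then have "(\<lambda>x. indicator \<Omega> x * \<phi> x) = \<phi>" by (rule ext)
  then show ?thesis using Res_cls[OF \<Omega> test_function_L2[OF \<phi>]] by simp
qed

locale nonlocal_domain = radial_kernel J k for J :: "real^'n::finite \<Rightarrow> real" and k :: 'n +
  fixes \<Omega> :: "(real^'n) set"
  assumes open_dom: "open \<Omega>" and bounded_dom: "bounded \<Omega>"
begin

lemma dom_lmeasurable: "\<Omega> \<in> lmeasurable"
  using open_dom bounded_dom by (simp add: lmeasurable_open)

lemma dom_lebesgue: "\<Omega> \<in> sets lebesgue"
  using dom_lmeasurable by (rule fmeasurableD)

definition "rad = (SOME r. 0 \<le> r \<and> \<Omega> \<subseteq> cball 0 r)"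

lemma rad: "0 \<le> rad" "\<Omega> \<subseteq> cball 0 rad"
proof -
  obtain B where "\<forall>x\<in>\<Omega>. norm x \<le> B" using bounded_dom by (auto simp: bounded_iff)
  then have "\<exists>r. 0 \<le> r \<and> \<Omega> \<subseteq> cball 0 r" by (intro exI[of _ "max 0 B"]) (auto simp: le_max_iff_disj)
  from someI_ex[OF this] show "0 \<le> rad" "\<Omega> \<subseteq> cball 0 rad" unfolding rad_def by auto
qed

text \<open>Schur's test calls for a radius \<open>R\<close> above \<open>rad\<close> and at least
  \<open>rad + \<delta> * \<rho>\<close>; the second moment
  \<open>\<delta>\<^sup>2 * (CARD('n) * m)\<close> over \<open>R\<^sup>2\<close> is then
  \<open>\<delta>\<^sup>2 * gap \<delta>\<close>. Because of \<open>max 1 \<delta>\<close> this is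
  the constant \<open>gap 1\<close> for \<delta> up to 1.\<close>

definition gap :: "real \<Rightarrow> real" where
  "gap \<delta> = CARD('n) * m / (rad + max 1 \<delta> * \<rho> + 1)\<^sup>2"

lemma gap_pos: "0 < gap \<delta>"
proof -
  have "0 \<le> max 1 \<delta> * \<rho>" using rho(1) by (intro mult_nonneg_nonneg) auto
  then have "0 < rad + max 1 \<delta> * \<rho> + 1" using rad(1) by linarith
  then show ?thesis using m_pos by (simp add: gap_def)
qed

lemma poincare:
  assumes \<delta>: "0 < \<delta>"
  shows "\<bar>Conv (K \<delta>) (Res \<Omega> u) \<bullet> Res \<Omega> v\<bar> \<le> (1 - \<delta>\<^sup>2 * gap \<delta>) * norm (Res \<Omega> u) * norm (Res \<Omega> v)"
proof -
  have "\<delta> * \<rho> \<le> max 1 \<delta> * \<rho>" using rho(1) by (intro mult_right_mono) auto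
  moreover have "0 \<le> max 1 \<delta> * \<rho>" using rho(1) by (intro mult_nonneg_nonneg) auto
  ultimately have "rad < rad + max 1 \<delta> * \<rho> + 1" "rad + \<delta> * \<rho> \<le> rad + max 1 \<delta> * \<rho> + 1" by linarith+
  from Conv_Res_le[OF K_ckernel[OF \<delta>] K_nonneg[OF \<delta>] K_even[OF \<delta>] K_1[OF \<delta>] K_supp[OF \<delta>] rad(1) this dom_lebesgue rad(2), of u v]
  show ?thesis by (simp add: K_moment_norm[OF \<delta>] gap_def)
qed

text \<open>Here \<open>m / 2\<close> is the reciprocal of the normalizing constant. The choice
  among solutions is immaterial: later arguments use the equation alone.\<close>

definition nonlocal_limit :: "real \<Rightarrow> real \<Rightarrow> (real^'n) l2 \<Rightarrow> (real^'n) l2" where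
  "nonlocal_limit \<theta> \<delta> f = (SOME v. v = \<theta> *\<^sub>R Res \<Omega> (Conv (K \<delta>) v - (\<delta>\<^sup>2 * m / 2) *\<^sub>R f))"

lemma nonlocal_limit:
  assumes "0 < \<delta>" "0 \<le> \<theta>" "\<theta> \<le> 1"
  shows "nonlocal_limit \<theta> \<delta> f = \<theta> *\<^sub>R Res \<Omega> (Conv (K \<delta>) (nonlocal_limit \<theta> \<delta> f) - (\<delta>\<^sup>2 * m / 2) *\<^sub>R f)"
proof -
  have "1 - \<delta>\<^sup>2 * gap \<delta> < 1" using gap_pos assms by simp
  then have "\<exists>v. v = \<theta> *\<^sub>R Res \<Omega> (Conv (K \<delta>) v - (\<delta>\<^sup>2 * m / 2) *\<^sub>R f)"
    by (rule nonlocal_limit_problem_solvable[OF K_ckernel[OF assms(1)] dom_lebesgue _ assms(2,3) poincare[OF assms(1)]])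
  from someI_ex[OF this] show ?thesis unfolding nonlocal_limit_def .
qed

lemma Conv_K_norm_le: "0 < \<delta> \<Longrightarrow> norm (Conv (K \<delta>) u) \<le> norm u"
  using Conv_norm_le[OF K_ckernel, of \<delta> u] K_1[of \<delta>] by (simp add: K_nonneg)

lemma nonlocal_limit_vanishes:
  assumes \<theta>: "0 \<le> \<theta>" "\<theta> < 1"
  shows "((\<lambda>\<delta>. nonlocal_limit \<theta> \<delta> f) \<longlongrightarrow> 0) (at_right 0)"
proof (rule Lim_null_comparison)
  show "\<forall>\<^sub>F \<delta> in at_right 0. norm (nonlocal_limit \<theta> \<delta> f) \<le> \<delta>\<^sup>2 * m / 2 * norm f / (1 - \<theta>)"
    using eventually_at_right_less[of 0]
  proof eventually_elim
    case (elim \<delta>)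
    define v where "v = nonlocal_limit \<theta> \<delta> f"
    have v: "v = \<theta> *\<^sub>R Res \<Omega> (Conv (K \<delta>) v - (\<delta>\<^sup>2 * m / 2) *\<^sub>R f)"
      unfolding v_def using elim \<theta> by (intro nonlocal_limit) auto
    have "norm v = \<theta> * norm (Res \<Omega> (Conv (K \<delta>) v - (\<delta>\<^sup>2 * m / 2) *\<^sub>R f))"
      using \<theta> by (subst v) simp
    also have "\<dots> \<le> \<theta> * norm (Conv (K \<delta>) v - (\<delta>\<^sup>2 * m / 2) *\<^sub>R f)"
      using \<theta> by (intro mult_left_mono Res_norm_le dom_lebesgue)
    also have "\<dots> \<le> \<theta> * (norm v + \<delta>\<^sup>2 * m / 2 * norm f)"
      using \<theta> norm_triangle_ineq4[of "Conv (K \<delta>) v" "(\<delta>\<^sup>2 * m / 2) *\<^sub>R f"] Conv_K_norm_le[OF elim, of v] m_pos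
      by (intro mult_left_mono) auto
    also have "\<dots> \<le> \<theta> * norm v + 1 * (\<delta>\<^sup>2 * m / 2 * norm f)"
      unfolding distrib_left using \<theta> m_pos by (intro add_mono mult_right_mono) auto
    finally have "(1 - \<theta>) * norm v \<le> \<delta>\<^sup>2 * m / 2 * norm f" by (simp add: algebra_simps)
    then show ?case using \<theta> by (simp add: v_def field_simps)
  qed
  have "((\<lambda>\<delta>. \<delta>\<^sup>2 * m / 2 * norm f / (1 - \<theta>)) \<longlongrightarrow> 0\<^sup>2 * m / 2 * norm f / (1 - \<theta>)) (at_right 0)"
    using \<theta> by (intro tendsto_intros) auto
  then show "((\<lambda>\<delta>. \<delta>\<^sup>2 * m / 2 * norm f / (1 - \<theta>)) \<longlongrightarrow> 0) (at_right 0)" by simp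
qed

section \<open>Estimates uniform in \<delta> for volume fraction one\<close>

abbreviation "V f \<delta> \<equiv> nonlocal_limit 1 \<delta> f"

lemma V_eq:
  assumes "0 < \<delta>"
  shows "V f \<delta> = Res \<Omega> (Conv (K \<delta>) (V f \<delta>) - (\<delta>\<^sup>2 * m / 2) *\<^sub>R f)"
  using nonlocal_limit[OF assms, of 1 f] by simp

lemma V_Res: "0 < \<delta> \<Longrightarrow> Res \<Omega> (V f \<delta>) = V f \<delta>"
  using V_eq[of \<delta> f] Res_Res[OF dom_lebesgue dom_lebesgue] by (metis Int_absorb)

text \<open>The equation tested with its own solution; the restriction is absorbed because the
  solution is supported in \<Omega>.\<close>

lemma V_energy:
  assumes \<delta>: "0 < \<delta>"
  shows "(norm (V f \<delta>))\<^sup>2 - Conv (K \<delta>) (V f \<delta>) \<bullet> V f \<delta> = - (\<delta>\<^sup>2 * m / 2) * (f \<bullet> V f \<delta>)"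
proof -
  let ?v = "V f \<delta>"
  have "(norm ?v)\<^sup>2 = Res \<Omega> (Conv (K \<delta>) ?v - (\<delta>\<^sup>2 * m / 2) *\<^sub>R f) \<bullet> ?v"
    using V_eq[OF \<delta>, of f] by (simp add: power2_norm_eq_inner)
  also have "\<dots> = (Conv (K \<delta>) ?v - (\<delta>\<^sup>2 * m / 2) *\<^sub>R f) \<bullet> ?v"
    by (simp add: Res_inner_commute[OF dom_lebesgue] V_Res[OF \<delta>])
  finally show ?thesis by (simp add: inner_diff_left)
qed

lemma poincare_quadratic:
  assumes \<delta>: "0 < \<delta>" and u: "Res \<Omega> u = u"
  shows "\<delta>\<^sup>2 * gap \<delta> * (norm u)\<^sup>2 \<le> (norm u)\<^sup>2 - Conv (K \<delta>) u \<bullet> u"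
  using poincare[OF \<delta>, of u u] by (simp add: u power2_eq_square algebra_simps)

definition vbound :: "(real^'n) l2 \<Rightarrow> real" where
  "vbound f = m / 2 * norm f / gap 1"

text \<open>The spectral gap and the right-hand side both carry \<open>\<delta>\<^sup>2\<close>,
  which cancels; for \<delta> up to 1 what remains of the gap is the constant
  \<open>gap 1\<close>.\<close>

lemma V_bound:
  assumes \<delta>: "0 < \<delta>" "\<delta> \<le> 1"
  shows "norm (V f \<delta>) \<le> vbound f"
proof -
  have g: "gap \<delta> = gap 1" using \<delta> by (simp add: gap_def)
  have "\<delta>\<^sup>2 * (gap 1 * (norm (V f \<delta>))\<^sup>2) \<le> - (\<delta>\<^sup>2 * m / 2) * (f \<bullet> V f \<delta>)"
    using poincare_quadratic[OF \<delta>(1) V_Res[OF \<delta>(1)], of f] V_energy[OF \<delta>(1), of f] by (simp add: g mult.assoc)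
  also have "\<dots> = \<delta>\<^sup>2 * (m / 2 * - (f \<bullet> V f \<delta>))" by simp
  also have "\<dots> \<le> \<delta>\<^sup>2 * (m / 2 * (norm f * norm (V f \<delta>)))"
    using m_pos Cauchy_Schwarz_ineq2[of f "V f \<delta>"] by (intro mult_left_mono) auto
  finally have "gap 1 * (norm (V f \<delta>))\<^sup>2 \<le> m / 2 * (norm f * norm (V f \<delta>))"
    using \<delta> by simp
  then have "norm (V f \<delta>) * (gap 1 * norm (V f \<delta>)) \<le> norm (V f \<delta>) * (m / 2 * norm f)"
    by (simp add: power2_eq_square mult_ac)
  then have "gap 1 * norm (V f \<delta>) \<le> m / 2 * norm f"
    using m_pos by (cases "norm (V f \<delta>) = 0") auto
  then show ?thesis using gap_pos[of 1] by (simp add: vbound_def field_simps)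
qed

lemma V_bound_eventually: "\<forall>\<^sub>F \<delta> in at_right 0. norm (V f \<delta>) \<le> vbound f"
  using eventually_at_right_real[of 0 1, OF zero_less_one] by eventually_elim (auto intro: V_bound)

text \<open>Discrete partial derivative on classes; on test functions it converges in norm to
  \<open>partial_deriv i\<close>.\<close>

definition gradQ :: "'n \<Rightarrow> real \<Rightarrow> (real^'n) l2 \<Rightarrow> (real^'n) l2" where
  "gradQ i \<delta> h = (- 1 / (m * \<delta>\<^sup>2)) *\<^sub>R Conv (Q \<delta> i) h"

lemma gradQ_linear: "0 < \<delta> \<Longrightarrow> linear (gradQ i \<delta>)"
  unfolding gradQ_def[abs_def] by (intro linear_compose_scale_right Conv_linear Q_ckernel)

lemma Q_integral: "0 < \<delta> \<Longrightarrow> (\<integral>z. Q \<delta> i z \<partial>lebesgue) = 0"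
  unfolding Q_def by (rule K_moment1)

text \<open>The discrete gradients of the nonlocal solutions are bounded because the energies are.\<close>

lemma gradQ_V_bound: "\<exists>A. \<forall>\<delta>. 0 < \<delta> \<and> \<delta> \<le> 1 \<longrightarrow> (\<forall>h. \<bar>V f \<delta> \<bullet> gradQ i \<delta> h\<bar> \<le> A * norm h)"
proof (intro exI allI impI)
  fix \<delta> :: real and h :: "(real^'n) l2" assume "0 < \<delta> \<and> \<delta> \<le> 1"
  then have \<delta>: "0 < \<delta>" "\<delta> \<le> 1" by auto
  let ?v = "V f \<delta>"
  define E where "E = m / 2 * norm f * vbound f"
  have E: "(norm ?v)\<^sup>2 - Conv (K \<delta>) ?v \<bullet> ?v \<le> \<delta>\<^sup>2 * E"
  proof -
    have "- (f \<bullet> ?v) \<le> norm f * norm ?v" using Cauchy_Schwarz_ineq2[of f ?v] by linarith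
    also have "\<dots> \<le> norm f * vbound f" using V_bound[OF \<delta>] by (intro mult_left_mono) auto
    finally have "\<delta>\<^sup>2 * (m / 2) * - (f \<bullet> ?v) \<le> \<delta>\<^sup>2 * (m / 2) * (norm f * vbound f)"
      using m_pos by (intro mult_left_mono) auto
    then show ?thesis using V_energy[OF \<delta>(1), of f] by (simp add: E_def)
  qed
  have quad: "\<bar>?v \<bullet> gradQ i \<delta> h\<bar> \<le> \<rho> / (2 * m) * ((norm h)\<^sup>2 + 2 * E)" for h
  proof -
    have Qle: "\<bar>Q \<delta> i z\<bar> \<le> (\<delta> * \<rho>) * K \<delta> z" for z
    proof (cases "K \<delta> z = 0")
      case False
      have "\<bar>z $ i\<bar> \<le> \<delta> * \<rho>" using component_le_norm_cart[of z i] K_supp[OF \<delta>(1) False] by linarith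
      from mult_right_mono[OF this K_nonneg[OF \<delta>(1)]] have "\<bar>z $ i\<bar> * K \<delta> z \<le> \<delta> * \<rho> * K \<delta> z" .
      then show ?thesis using K_nonneg[OF \<delta>(1), of z] by (simp add: Q_def abs_mult mult.commute[of "K \<delta> z"])
    qed (simp add: Q_def)
    \<comment> \<open>Young parameter \<open>s = \<delta>\<close>. The kernel bound
      \<open>\<delta> * \<rho>\<close> contributes one power of \<delta>, and the energy of order
      \<open>\<delta>\<^sup>2\<close> divided by \<delta> another, so both terms are of order
      \<open>\<delta>\<^sup>2\<close> and compensate the prefactor
      \<open>1 / (m * \<delta>\<^sup>2)\<close>.\<close>
    have "\<bar>Conv (Q \<delta> i) h \<bullet> ?v\<bar> \<le> \<delta> * \<rho> * (\<delta> * (norm h)\<^sup>2 + 2 / \<delta> * ((norm ?v)\<^sup>2 - Conv (K \<delta>) ?v \<bullet> ?v)) / 2"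
      by (rule Conv_odd_energy_bound[OF K_ckernel Q_ckernel Qle Q_integral K_1]) (use \<delta> in auto)
    also have "\<dots> \<le> \<delta> * \<rho> * (\<delta> * (norm h)\<^sup>2 + 2 / \<delta> * (\<delta>\<^sup>2 * E)) / 2"
      using E \<delta> rho(1) by (intro divide_right_mono mult_left_mono add_left_mono) auto
    also have "\<dots> = \<delta>\<^sup>2 * \<rho> / 2 * ((norm h)\<^sup>2 + 2 * E)"
      using \<delta> by (simp add: field_simps power2_eq_square)
    finally have "1 / (m * \<delta>\<^sup>2) * \<bar>Conv (Q \<delta> i) h \<bullet> ?v\<bar> \<le> 1 / (m * \<delta>\<^sup>2) * (\<delta>\<^sup>2 * \<rho> / 2 * ((norm h)\<^sup>2 + 2 * E))"
      using m_pos by (intro mult_left_mono) auto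
    also have "\<dots> = \<rho> / (2 * m) * ((norm h)\<^sup>2 + 2 * E)" using m_pos \<delta> by simp
    finally show ?thesis
      using m_pos by (simp add: gradQ_def inner_commute abs_mult)
  qed
  show "\<bar>?v \<bullet> gradQ i \<delta> h\<bar> \<le> \<rho> / (2 * m) * (1 + 2 * (m / 2 * norm f * vbound f)) * norm h"
  proof (cases "h = 0")
    case True
    then show ?thesis by (simp add: linear_0[OF gradQ_linear[OF \<delta>(1)]])
  next
    case False
    \<comment> \<open>The bound \<open>quad\<close> is not homogeneous in \<open>h\<close>;
      evaluated at a unit vector it becomes a linear bound.\<close>
    have "\<bar>?v \<bullet> gradQ i \<delta> ((1 / norm h) *\<^sub>R h)\<bar> \<le> \<rho> / (2 * m) * (1 + 2 * E)"
      using quad[of "(1 / norm h) *\<^sub>R h"] False by simp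
    then show ?thesis using False
      by (simp add: linear_cmul[OF gradQ_linear[OF \<delta>(1)]] abs_mult E_def field_simps)
  qed
qed

lemma weak_cluster_gradient:
  assumes G: "G \<noteq> bot" "G \<le> at_right 0" and weak: "\<And>g. ((\<lambda>\<delta>. V f \<delta> \<bullet> g) \<longlongrightarrow> v \<bullet> g) G"
  shows "\<exists>g. \<forall>\<phi>\<in>test_functions UNIV. v \<bullet> cls (partial_deriv i \<phi>) = g \<bullet> cls \<phi>"
proof -
  have pos: "\<forall>\<^sub>F \<delta> in G. 0 < \<delta> \<and> \<delta> \<le> 1"
    using filter_leD[OF G(2) eventually_at_right_real[of 0 1, OF zero_less_one]] by eventually_elim auto
  obtain A where A: "\<And>\<delta> h. 0 < \<delta> \<Longrightarrow> \<delta> \<le> 1 \<Longrightarrow> \<bar>V f \<delta> \<bullet> gradQ i \<delta> h\<bar> \<le> A * norm h"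
    using gradQ_V_bound by blast
  define S where "S = {(h, r). ((\<lambda>\<delta>. V f \<delta> \<bullet> gradQ i \<delta> h) \<longlongrightarrow> r) G}"
  have "subspace S"
    unfolding subspace_def
  proof (intro conjI ballI allI)
    have "\<forall>\<^sub>F \<delta> in G. V f \<delta> \<bullet> gradQ i \<delta> 0 = 0"
      using pos by eventually_elim (simp add: linear_0[OF gradQ_linear])
    then show "0 \<in> S" by (simp add: S_def zero_prod_def tendsto_eventually)
  next
    fix x y assume xy: "x \<in> S" "y \<in> S"
    have "((\<lambda>\<delta>. V f \<delta> \<bullet> gradQ i \<delta> (fst x) + V f \<delta> \<bullet> gradQ i \<delta> (fst y)) \<longlongrightarrow> snd x + snd y) G"
      using xy by (intro tendsto_add) (auto simp: S_def case_prod_beta)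
    moreover have "\<forall>\<^sub>F \<delta> in G. V f \<delta> \<bullet> gradQ i \<delta> (fst x) + V f \<delta> \<bullet> gradQ i \<delta> (fst y) = V f \<delta> \<bullet> gradQ i \<delta> (fst x + fst y)"
      using pos by eventually_elim (simp add: linear_add[OF gradQ_linear] inner_add_right)
    ultimately show "x + y \<in> S"
      unfolding S_def mem_Collect_eq case_prod_beta fst_add snd_add by (rule tendsto_cong[THEN iffD1, rotated])
  next
    fix c x assume x: "x \<in> S"
    have "((\<lambda>\<delta>. c * (V f \<delta> \<bullet> gradQ i \<delta> (fst x))) \<longlongrightarrow> c * snd x) G"
      using x by (intro tendsto_mult_left) (auto simp: S_def case_prod_beta)
    moreover have "\<forall>\<^sub>F \<delta> in G. c * (V f \<delta> \<bullet> gradQ i \<delta> (fst x)) = V f \<delta> \<bullet> gradQ i \<delta> (c *\<^sub>R fst x)"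
      using pos by eventually_elim (simp add: linear_cmul[OF gradQ_linear])
    ultimately show "c *\<^sub>R x \<in> S"
      unfolding S_def mem_Collect_eq case_prod_beta fst_scaleR snd_scaleR real_scaleR_def
      by (rule tendsto_cong[THEN iffD1, rotated])
  qed
  moreover have "\<bar>r\<bar> \<le> A * norm h" if "(h, r) \<in> S" for h r
  proof (rule tendsto_upperbound[OF _ _ G(1)])
    show "((\<lambda>\<delta>. \<bar>V f \<delta> \<bullet> gradQ i \<delta> h\<bar>) \<longlongrightarrow> \<bar>r\<bar>) G"
      using that by (intro tendsto_rabs) (simp add: S_def)
    show "\<forall>\<^sub>F \<delta> in G. \<bar>V f \<delta> \<bullet> gradQ i \<delta> h\<bar> \<le> A * norm h"
      using pos by eventually_elim (auto intro: A)
  qed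
  ultimately have "\<exists>g. \<forall>h r. (h, r) \<in> S \<longrightarrow> r = g \<bullet> h" by (rule riesz_graph)
  then obtain g where g: "\<And>h r. (h, r) \<in> S \<Longrightarrow> r = g \<bullet> h" by blast
  have "v \<bullet> cls (partial_deriv i \<phi>) = g \<bullet> cls \<phi>" if \<phi>: "\<phi> \<in> test_functions UNIV" for \<phi>
  proof (rule g)
    have "((\<lambda>\<delta>. gradQ i \<delta> (cls \<phi>)) \<longlongrightarrow> cls (partial_deriv i \<phi>)) G"
      unfolding gradQ_def by (rule tendsto_mono[OF G(2) Q_grad_tendsto[OF \<phi>]])
    then show "(cls \<phi>, v \<bullet> cls (partial_deriv i \<phi>)) \<in> S"
      unfolding S_def mem_Collect_eq prod.case
      by (rule tendsto_inner_weak_strong[OF filter_leD[OF G(2) V_bound_eventually] weak])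
  qed
  then show ?thesis by blast
qed

text \<open>Being supported in \<Omega> is the fixed-point equation of a self-adjoint projection,
  hence stable under weak limits.\<close>

lemma weak_cluster_Res:
  assumes G: "G \<noteq> bot" "G \<le> at_right 0" and weak: "\<And>g. ((\<lambda>\<delta>. V f \<delta> \<bullet> g) \<longlongrightarrow> v \<bullet> g) G"
  shows "Res \<Omega> v = v"
proof -
  have "Res \<Omega> v \<bullet> g = v \<bullet> g" for g
  proof (rule tendsto_unique[OF G(1) _ weak])
    have "\<forall>\<^sub>F \<delta> in G. V f \<delta> \<bullet> Res \<Omega> g = V f \<delta> \<bullet> g"
      using filter_leD[OF G(2) eventually_at_right_less[of 0]]
      by eventually_elim (simp add: Res_inner_commute[OF dom_lebesgue, symmetric] V_Res)
    then show "((\<lambda>\<delta>. V f \<delta> \<bullet> g) \<longlongrightarrow> Res \<Omega> v \<bullet> g) G"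
      unfolding Res_inner_commute[OF dom_lebesgue] by (rule tendsto_cong[THEN iffD1, OF _ weak])
  qed
  from this[of "Res \<Omega> v - v"] have "(Res \<Omega> v - v) \<bullet> (Res \<Omega> v - v) = 0"
    by (simp add: inner_diff_left)
  then show ?thesis by simp
qed

text \<open>By symmetry of the kernel the operator moves onto \<phi>. The rescaled pairing then
  equals \<open>f \<bullet> cls \<phi>\<close> exactly for every \<delta>, while its other form
  converges because the operator applied to \<phi> converges in norm.\<close>

lemma weak_cluster_equation:
  assumes G: "G \<noteq> bot" "G \<le> at_right 0" and weak: "\<And>g. ((\<lambda>\<delta>. V f \<delta> \<bullet> g) \<longlongrightarrow> v \<bullet> g) G"
    and \<phi>: "\<phi> \<in> test_functions \<Omega>"
  shows "v \<bullet> cls (laplace \<phi>) = f \<bullet> cls \<phi>"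
proof (rule tendsto_unique[OF G(1)])
  let ?L = "\<lambda>\<delta>. (2 / (m * \<delta>\<^sup>2)) *\<^sub>R (Conv (K \<delta>) (cls \<phi>) - cls \<phi>)"
  show "((\<lambda>\<delta>. V f \<delta> \<bullet> ?L \<delta>) \<longlongrightarrow> v \<bullet> cls (laplace \<phi>)) G"
    by (rule tendsto_inner_weak_strong[OF filter_leD[OF G(2) V_bound_eventually] weak
          tendsto_mono[OF G(2) K_laplace_tendsto[OF \<phi>]]])
  have "\<forall>\<^sub>F \<delta> in G. V f \<delta> \<bullet> ?L \<delta> = f \<bullet> cls \<phi>"
    using filter_leD[OF G(2) eventually_at_right_less[of 0]]
  proof eventually_elim
    case (elim \<delta>)
    have "V f \<delta> \<bullet> cls \<phi> = (Conv (K \<delta>) (V f \<delta>) - (\<delta>\<^sup>2 * m / 2) *\<^sub>R f) \<bullet> cls \<phi>"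
      using V_eq[OF elim, of f] Res_inner_commute[OF dom_lebesgue] Res_cls_test_function[OF dom_lebesgue \<phi>] by metis
    then have "V f \<delta> \<bullet> (Conv (K \<delta>) (cls \<phi>) - cls \<phi>) = \<delta>\<^sup>2 * m / 2 * (f \<bullet> cls \<phi>)"
      by (simp add: inner_diff_left inner_diff_right Conv_K_symmetric[OF elim])
    then have "V f \<delta> \<bullet> ?L \<delta> = 2 / (m * \<delta>\<^sup>2) * (\<delta>\<^sup>2 * m / 2 * (f \<bullet> cls \<phi>))"
      by (simp only: inner_scaleR_right)
    also have "\<dots> = f \<bullet> cls \<phi>" using m_pos elim by simp
    finally show ?case .
  qed
  then show "((\<lambda>\<delta>. V f \<delta> \<bullet> ?L \<delta>) \<longlongrightarrow> f \<bullet> cls \<phi>) G" by (rule tendsto_eventually)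
qed

text \<open>The classical Poincare inequality as the limit of the nonlocal one, followed by
  integration by parts. It is stated for a difference because \<open>H10_unique\<close> compares two
  approximating sequences.\<close>

lemma poincare_test_functions:
  assumes \<phi>: "\<phi> \<in> test_functions \<Omega>" and \<psi>: "\<psi> \<in> test_functions \<Omega>"
  shows "2 * gap 1 / m * (norm (cls \<phi> - cls \<psi>))\<^sup>2
    \<le> (\<Sum>i\<in>UNIV. (norm (cls (partial_deriv i \<phi>) - cls (partial_deriv i \<psi>)))\<^sup>2)"
proof -
  let ?x = "cls \<phi> - cls \<psi>"
  let ?L = "\<lambda>\<delta>. (2 / (m * \<delta>\<^sup>2)) *\<^sub>R (Conv (K \<delta>) ?x - ?x)"
  have x: "Res \<Omega> ?x = ?x"
    by (simp add: linear_diff[OF Res_linear[OF dom_lebesgue]] Res_cls_test_function[OF dom_lebesgue] \<phi> \<psi>)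
  have "((\<lambda>\<delta>. (2 / (m * \<delta>\<^sup>2)) *\<^sub>R (Conv (K \<delta>) (cls \<phi>) - cls \<phi>) - (2 / (m * \<delta>\<^sup>2)) *\<^sub>R (Conv (K \<delta>) (cls \<psi>) - cls \<psi>))
      \<longlongrightarrow> cls (laplace \<phi>) - cls (laplace \<psi>)) (at_right 0)"
    by (intro tendsto_diff K_laplace_tendsto[OF \<phi>] K_laplace_tendsto[OF \<psi>])
  moreover have "\<forall>\<^sub>F \<delta> in at_right 0. (2 / (m * \<delta>\<^sup>2)) *\<^sub>R (Conv (K \<delta>) (cls \<phi>) - cls \<phi>) - (2 / (m * \<delta>\<^sup>2)) *\<^sub>R (Conv (K \<delta>) (cls \<psi>) - cls \<psi>) = ?L \<delta>"
    using eventually_at_right_less[of 0]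
    by eventually_elim (simp add: linear_diff[OF Conv_linear[OF K_ckernel]] scaleR_diff_right)
  ultimately have "(?L \<longlongrightarrow> cls (laplace \<phi>) - cls (laplace \<psi>)) (at_right 0)"
    by (rule tendsto_cong[THEN iffD1, rotated])
  then have "((\<lambda>\<delta>. - (?L \<delta> \<bullet> ?x)) \<longlongrightarrow> - ((cls (laplace \<phi>) - cls (laplace \<psi>)) \<bullet> ?x)) (at_right 0)"
    by (intro tendsto_minus tendsto_inner tendsto_const)
  moreover have "\<forall>\<^sub>F \<delta> in at_right 0. 2 * gap 1 / m * (norm ?x)\<^sup>2 \<le> - (?L \<delta> \<bullet> ?x)"
    using eventually_at_right_real[of 0 1, OF zero_less_one]
  proof (rule eventually_mono)
    fix \<delta> :: real assume "\<delta> \<in> {0<..<1}"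
    then have \<delta>: "0 < \<delta>" "\<delta> \<le> 1" by auto
    have g: "gap \<delta> = gap 1" using \<delta> by (simp add: gap_def)
    have "2 / (m * \<delta>\<^sup>2) * (\<delta>\<^sup>2 * gap \<delta> * (norm ?x)\<^sup>2) \<le> 2 / (m * \<delta>\<^sup>2) * ((norm ?x)\<^sup>2 - Conv (K \<delta>) ?x \<bullet> ?x)"
      using poincare_quadratic[OF \<delta>(1) x] m_pos by (intro mult_left_mono) auto
    also have "2 / (m * \<delta>\<^sup>2) * (\<delta>\<^sup>2 * gap \<delta> * (norm ?x)\<^sup>2) = 2 * gap 1 / m * (norm ?x)\<^sup>2"
      using \<delta> m_pos by (simp add: g)
    also have "2 / (m * \<delta>\<^sup>2) * ((norm ?x)\<^sup>2 - Conv (K \<delta>) ?x \<bullet> ?x) = - (?L \<delta> \<bullet> ?x)"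
      unfolding power2_norm_eq_inner inner_scaleR_left inner_diff_left[of "Conv (K \<delta>) ?x"] by (simp add: right_diff_distrib)
    finally show "2 * gap 1 / m * (norm ?x)\<^sup>2 \<le> - (?L \<delta> \<bullet> ?x)" .
  qed
  ultimately have le: "2 * gap 1 / m * (norm ?x)\<^sup>2 \<le> - ((cls (laplace \<phi>) - cls (laplace \<psi>)) \<bullet> ?x)"
    by (intro tendsto_lowerbound[OF _ _ trivial_limit_at_right_real])
  have ibp: "cls (laplace \<xi>) \<bullet> cls \<eta> = - (\<Sum>i\<in>UNIV. cls (partial_deriv i \<xi>) \<bullet> cls (partial_deriv i \<eta>))"
    if "\<xi> \<in> test_functions \<Omega>" "\<eta> \<in> test_functions \<Omega>" for \<xi> \<eta>
    unfolding laplace_L2(2)[OF that(1)] inner_sum_left sum_negf[symmetric]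
    by (intro sum.cong refl test_function_ibp[OF test_function_partial_deriv[OF that(1)] that(2)])
  have "- ((cls (laplace \<phi>) - cls (laplace \<psi>)) \<bullet> ?x)
     = (\<Sum>i\<in>UNIV. (norm (cls (partial_deriv i \<phi>) - cls (partial_deriv i \<psi>)))\<^sup>2)"
    by (simp add: inner_diff_left inner_diff_right ibp \<phi> \<psi> power2_norm_eq_inner sum.distrib sum_subtractf)
  then show ?thesis using le by simp
qed

text \<open>\<open>H1_0 \<Omega>\<close> transferred to classes, with the family of derivatives
  explicit so that two elements can be subtracted component by component.\<close>

definition H10 :: "(real^'n) l2 \<Rightarrow> ('n \<Rightarrow> (real^'n) l2) \<Rightarrow> bool" where
  "H10 W D \<longleftrightarrow> (\<forall>\<phi>\<in>test_functions \<Omega>. \<forall>i. W \<bullet> cls (partial_deriv i \<phi>) = - (D i \<bullet> cls \<phi>)) \<and>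
    (\<exists>\<psi>. (\<forall>n::nat. \<psi> n \<in> test_functions \<Omega>) \<and> (\<lambda>n. cls (\<psi> n)) \<longlonglongrightarrow> W \<and>
      (\<forall>i. (\<lambda>n. cls (partial_deriv i (\<psi> n))) \<longlonglongrightarrow> D i))"

text \<open>The difference of the two gradients is orthogonal to gradients of test functions, hence
  to their limits, which include both gradients; so it is orthogonal to itself. The Poincare
  inequality, passed to the limit, then forces the functions to agree.\<close>

lemma H10_unique:
  assumes V: "H10 V' DV" and W: "H10 W DW"
    and eq: "\<And>\<phi>. \<phi> \<in> test_functions \<Omega> \<Longrightarrow> V' \<bullet> cls (laplace \<phi>) = W \<bullet> cls (laplace \<phi>)"
  shows "V' = W"
proof -
  obtain \<phi> where \<phi>: "\<And>n::nat. \<phi> n \<in> test_functions \<Omega>" "(\<lambda>n. cls (\<phi> n)) \<longlonglongrightarrow> V'"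
    "\<And>i. (\<lambda>n. cls (partial_deriv i (\<phi> n))) \<longlonglongrightarrow> DV i" using V by (auto simp: H10_def)
  obtain \<psi> where \<psi>: "\<And>n::nat. \<psi> n \<in> test_functions \<Omega>" "(\<lambda>n. cls (\<psi> n)) \<longlonglongrightarrow> W"
    "\<And>i. (\<lambda>n. cls (partial_deriv i (\<psi> n))) \<longlonglongrightarrow> DW i" using W by (auto simp: H10_def)
  have DV: "V' \<bullet> cls (partial_deriv i \<xi>) = - (DV i \<bullet> cls \<xi>)" and DW: "W \<bullet> cls (partial_deriv i \<xi>) = - (DW i \<bullet> cls \<xi>)"
    if "\<xi> \<in> test_functions \<Omega>" for \<xi> i using V W that by (auto simp: H10_def)
  define D where "D i = DV i - DW i" for i
  have orth: "(\<Sum>i\<in>UNIV. D i \<bullet> cls (partial_deriv i \<xi>)) = 0" if \<xi>: "\<xi> \<in> test_functions \<Omega>" for \<xi>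
  proof -
    have "(\<Sum>i\<in>UNIV. DV i \<bullet> cls (partial_deriv i \<xi>)) = - (V' \<bullet> cls (laplace \<xi>))"
      unfolding laplace_L2(2)[OF \<xi>] inner_sum_right sum_negf[symmetric]
      by (intro sum.cong refl) (simp add: DV[OF test_function_partial_deriv[OF \<xi>]])
    moreover have "(\<Sum>i\<in>UNIV. DW i \<bullet> cls (partial_deriv i \<xi>)) = - (W \<bullet> cls (laplace \<xi>))"
      unfolding laplace_L2(2)[OF \<xi>] inner_sum_right sum_negf[symmetric]
      by (intro sum.cong refl) (simp add: DW[OF test_function_partial_deriv[OF \<xi>]])
    ultimately show ?thesis using eq[OF \<xi>] by (simp add: D_def inner_diff_left sum_subtractf)
  qed
  have "(\<lambda>n. \<Sum>i\<in>UNIV. D i \<bullet> cls (partial_deriv i (\<phi> n))) \<longlonglongrightarrow> (\<Sum>i\<in>UNIV. D i \<bullet> DV i)"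
    by (intro tendsto_sum tendsto_inner tendsto_const \<phi>(3))
  then have 1: "(\<Sum>i\<in>UNIV. D i \<bullet> DV i) = 0"
    unfolding orth[OF \<phi>(1)] by (simp add: LIMSEQ_const_iff)
  have "(\<lambda>n. \<Sum>i\<in>UNIV. D i \<bullet> cls (partial_deriv i (\<psi> n))) \<longlonglongrightarrow> (\<Sum>i\<in>UNIV. D i \<bullet> DW i)"
    by (intro tendsto_sum tendsto_inner tendsto_const \<psi>(3))
  then have 2: "(\<Sum>i\<in>UNIV. D i \<bullet> DW i) = 0"
    unfolding orth[OF \<psi>(1)] by (simp add: LIMSEQ_const_iff)
  have "(\<Sum>i\<in>UNIV. D i \<bullet> D i) = (\<Sum>i\<in>UNIV. D i \<bullet> DV i - D i \<bullet> DW i)"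
    by (intro sum.cong refl) (simp only: D_def inner_diff_right)
  then have D0: "(\<Sum>i\<in>UNIV. (norm (DV i - DW i))\<^sup>2) = 0"
    using 1 2 by (simp add: sum_subtractf power2_norm_eq_inner D_def)
  have "(\<lambda>n. 2 * gap 1 / m * (norm (cls (\<phi> n) - cls (\<psi> n)))\<^sup>2) \<longlonglongrightarrow> 2 * gap 1 / m * (norm (V' - W))\<^sup>2"
    by (intro tendsto_intros \<phi> \<psi>)
  moreover have "(\<lambda>n. \<Sum>i\<in>UNIV. (norm (cls (partial_deriv i (\<phi> n)) - cls (partial_deriv i (\<psi> n))))\<^sup>2) \<longlonglongrightarrow> (\<Sum>i\<in>UNIV. (norm (DV i - DW i))\<^sup>2)"
    by (intro tendsto_intros \<phi> \<psi>)
  ultimately have "2 * gap 1 / m * (norm (V' - W))\<^sup>2 \<le> (\<Sum>i\<in>UNIV. (norm (DV i - DW i))\<^sup>2)"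
    by (rule LIMSEQ_le) (use poincare_test_functions[OF \<phi>(1) \<psi>(1)] in blast)
  then have "(norm (V' - W))\<^sup>2 \<le> 0"
    using D0 gap_pos[of 1] m_pos by (simp add: mult_le_0_iff zero_le_divide_iff divide_le_0_iff)
  then show ?thesis by simp
qed

end

section \<open>Functions on the domain\<close>

text \<open>Links integrals over \<open>lebesgue_on \<Omega>\<close> with the Hilbert space over the
  whole space.\<close>

definition zext :: "'a::euclidean_space set \<Rightarrow> ('a \<Rightarrow> real) \<Rightarrow> 'a \<Rightarrow> real" where
  "zext \<Omega> f x = indicator \<Omega> x * f x"

lemma L2_iff_zext:
  assumes \<Omega>: "\<Omega> \<in> sets lebesgue"
  shows "f \<in> L2 \<Omega> \<longleftrightarrow> zext \<Omega> f \<in> L2 UNIV"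
proof -
  have "(\<lambda>x. indicator \<Omega> x *\<^sub>R (f x)\<^sup>2) = (\<lambda>x. (zext \<Omega> f x)\<^sup>2)"
    by (auto simp: zext_def indicator_def fun_eq_iff)
  then have "integrable (lebesgue_on \<Omega>) (\<lambda>x. (norm (f x))\<^sup>2) \<longleftrightarrow> integrable lebesgue (\<lambda>x. (zext \<Omega> f x)\<^sup>2)"
    using \<Omega> by (simp add: integrable_restrict_space)
  moreover have "f \<in> borel_measurable (lebesgue_on \<Omega>) \<longleftrightarrow> zext \<Omega> f \<in> borel_measurable lebesgue"
    using \<Omega> by (simp add: borel_measurable_restrict_space_iff zext_def[abs_def])
  ultimately show ?thesis
    unfolding L2_UNIV_iff by (simp only: L2_def mem_Collect_eq)
qed

lemmas L2_zext = L2_iff_zext[THEN iffD1] and L2_zextD = L2_iff_zext[THEN iffD2]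

lemma integral_lebesgue_on_zext:
  assumes \<Omega>: "\<Omega> \<in> sets lebesgue"
  shows "(\<integral>x. f x * g x \<partial>lebesgue_on \<Omega>) = (\<integral>x. zext \<Omega> f x * zext \<Omega> g x \<partial>lebesgue)"
proof -
  have "(\<integral>x. f x * g x \<partial>lebesgue_on \<Omega>) = (\<integral>x. indicator \<Omega> x *\<^sub>R (f x * g x) \<partial>lebesgue)"
    using \<Omega> by (intro integral_restrict_space) simp
  also have "\<dots> = (\<integral>x. zext \<Omega> f x * zext \<Omega> g x \<partial>lebesgue)"
    by (intro Bochner_Integration.integral_cong) (auto simp: zext_def indicator_def)
  finally show ?thesis .
qed

lemma integral_L2_inner:
  assumes \<Omega>: "\<Omega> \<in> sets lebesgue" and "f \<in> L2 \<Omega>" "g \<in> L2 \<Omega>"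
  shows "(\<integral>x. f x * g x \<partial>lebesgue_on \<Omega>) = cls (zext \<Omega> f) \<bullet> cls (zext \<Omega> g)"
  using assms by (simp add: integral_lebesgue_on_zext L2_zext inner_cls)

lemma L2_integrable_mult_on:
  fixes f g :: "'a::euclidean_space \<Rightarrow> real"
  assumes \<Omega>: "\<Omega> \<in> sets lebesgue" and "f \<in> L2 \<Omega>" "g \<in> L2 \<Omega>"
  shows "integrable (lebesgue_on \<Omega>) (\<lambda>x. f x * g x)"
proof -
  have "integrable lebesgue (\<lambda>x. zext \<Omega> f x * zext \<Omega> g x)"
    using assms by (intro L2_integrable_mult L2_zext)
  moreover have "(\<lambda>x. zext \<Omega> f x * zext \<Omega> g x) = (\<lambda>x. indicator \<Omega> x *\<^sub>R (f x * g x))"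
    by (auto simp: zext_def indicator_def fun_eq_iff)
  ultimately show ?thesis using \<Omega> by (simp add: integrable_restrict_space)
qed

lemma cls_zext:
  assumes "\<Omega> \<in> sets lebesgue" "f \<in> L2 UNIV"
  shows "zext \<Omega> f \<in> L2 UNIV" "cls (zext \<Omega> f) = Res \<Omega> (cls f)"
  using assms by (simp_all add: zext_def[abs_def] L2_indicator Res_cls)

lemma L2_UNIV_imp_L2:
  fixes f :: "'a::euclidean_space \<Rightarrow> real"
  assumes "\<Omega> \<in> sets lebesgue" "f \<in> L2 UNIV" shows "f \<in> L2 \<Omega>"
  by (rule L2_zextD[OF assms(1) cls_zext(1)[OF assms]])

lemma Res_zext:
  assumes \<Omega>: "\<Omega> \<in> sets lebesgue" and f: "f \<in> L2 \<Omega>"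
  shows "Res \<Omega> (cls (zext \<Omega> f)) = cls (zext \<Omega> f)"
proof -
  have "(\<lambda>x. indicator \<Omega> x * zext \<Omega> f x) = zext \<Omega> f" by (auto simp: zext_def indicator_def fun_eq_iff)
  then show ?thesis using Res_cls[OF \<Omega> L2_zext[OF \<Omega> f]] by simp
qed

lemma zext_test_function:
  assumes "\<phi> \<in> test_functions \<Omega>" shows "zext \<Omega> \<phi> = \<phi>"
proof -
  have "zext \<Omega> \<phi> x = \<phi> x" for x
    using test_function_support[OF assms, of x] by (cases "\<phi> x = 0") (simp_all add: zext_def)
  then show ?thesis by (rule ext)
qed

lemma test_function_L2_on:
  assumes "\<Omega> \<in> sets lebesgue" "\<phi> \<in> test_functions \<Omega>" shows "\<phi> \<in> L2 \<Omega>"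
  by (rule L2_UNIV_imp_L2[OF assms(1) test_function_L2[OF assms(2)]])

text \<open>Pairing over \<Omega> is pairing with the extension by zero of \<open>g\<close>. The
  restriction of \<open>u i\<close> moves onto that extension, where it is the identity.\<close>

lemma weakly_tendsto_L2I:
  fixes u :: "real \<Rightarrow> 'a::euclidean_space \<Rightarrow> real"
  assumes \<Omega>: "\<Omega> \<in> sets lebesgue" and u: "\<forall>\<^sub>F i in F. u i \<in> L2 UNIV" and w: "w \<in> L2 \<Omega>"
    and lim: "\<And>g. ((\<lambda>i. cls (u i) \<bullet> g) \<longlongrightarrow> cls (zext \<Omega> w) \<bullet> g) F"
  shows "weakly_tendsto_L2 \<Omega> u w F"
  unfolding weakly_tendsto_L2_def
proof (intro conjI ballI)
  show "\<forall>\<^sub>F i in F. u i \<in> L2 \<Omega>" using u by eventually_elim (rule L2_UNIV_imp_L2[OF \<Omega>])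
  show "w \<in> L2 \<Omega>" by (rule w)
  fix g :: "'a \<Rightarrow> real" assume g: "g \<in> L2 \<Omega>"
  have "\<forall>\<^sub>F i in F. cls (u i) \<bullet> cls (zext \<Omega> g) = (\<integral>x. u i x * g x \<partial>lebesgue_on \<Omega>)"
    using u
  proof eventually_elim
    case (elim i)
    have "(\<integral>x. u i x * g x \<partial>lebesgue_on \<Omega>) = Res \<Omega> (cls (u i)) \<bullet> cls (zext \<Omega> g)"
      by (simp add: integral_L2_inner[OF \<Omega> L2_UNIV_imp_L2[OF \<Omega> elim] g] cls_zext(2)[OF \<Omega> elim])
    also have "\<dots> = cls (u i) \<bullet> cls (zext \<Omega> g)"
      by (simp add: Res_inner_commute[OF \<Omega>] Res_zext[OF \<Omega> g])
    finally show ?case by simp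
  qed
  then show "((\<lambda>i. \<integral>x. u i x * g x \<partial>lebesgue_on \<Omega>) \<longlongrightarrow> (\<integral>x. w x * g x \<partial>lebesgue_on \<Omega>)) F"
    unfolding integral_L2_inner[OF \<Omega> w g] by (rule tendsto_cong[THEN iffD1, OF _ lim])
qed

lemma L2_component:
  fixes X :: "'a::euclidean_space \<Rightarrow> real^'n::finite"
  assumes "X \<in> L2 \<Omega>" shows "(\<lambda>x. X x $ i) \<in> L2 \<Omega>"
proof -
  have Xm: "X \<in> borel_measurable (lebesgue_on \<Omega>)" and Xi: "integrable (lebesgue_on \<Omega>) (\<lambda>x. (norm (X x))\<^sup>2)"
    using assms by (auto simp: L2_def)
  have m: "(\<lambda>x. X x $ i) \<in> borel_measurable (lebesgue_on \<Omega>)"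
    using measurable_compose[OF Xm borel_measurable_continuous_onI[of "\<lambda>x. x $ i"]]
    by (simp add: continuous_on_component continuous_on_id)
  have "integrable (lebesgue_on \<Omega>) (\<lambda>x. (norm (X x $ i))\<^sup>2)"
  proof (rule Bochner_Integration.integrable_bound[OF Xi])
    show "(\<lambda>x. (norm (X x $ i))\<^sup>2) \<in> borel_measurable (lebesgue_on \<Omega>)" using m by measurable
    show "AE x in lebesgue_on \<Omega>. norm ((norm (X x $ i))\<^sup>2) \<le> norm ((norm (X x))\<^sup>2)"
      using component_le_norm_cart by (intro AE_I2) (auto intro!: power_mono simp: abs_le_square_iff[symmetric])
  qed
  then show ?thesis using m by (simp add: L2_def)
qed

lemma L2_of_components:
  fixes X :: "'a::euclidean_space \<Rightarrow> real^'n::finite"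
  assumes "\<And>i. (\<lambda>x. X x $ i) \<in> L2 \<Omega>" shows "X \<in> L2 \<Omega>"
proof -
  have m: "(\<lambda>x. X x $ i) \<in> borel_measurable (lebesgue_on \<Omega>)"
    and I: "integrable (lebesgue_on \<Omega>) (\<lambda>x. (X x $ i)\<^sup>2)" for i
    using assms[of i] by (auto simp: L2_def)
  have "X = (\<lambda>x. \<Sum>i\<in>UNIV. X x $ i *\<^sub>R axis i 1)"
    using basis_expansion[of "X _"] by (auto simp: scalar_mult_eq_scaleR fun_eq_iff)
  moreover have "(\<lambda>x. \<Sum>i\<in>UNIV. X x $ i *\<^sub>R axis i (1::real)) \<in> borel_measurable (lebesgue_on \<Omega>)"
    using m by (intro borel_measurable_sum borel_measurable_scaleR) auto
  ultimately have Xm: "X \<in> borel_measurable (lebesgue_on \<Omega>)" by simp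
  have "(\<lambda>x. (norm (X x))\<^sup>2) = (\<lambda>x. \<Sum>i\<in>UNIV. (X x $ i)\<^sup>2)"
    by (auto simp: norm_vec_def L2_set_def sum_nonneg)
  then have "integrable (lebesgue_on \<Omega>) (\<lambda>x. (norm (X x))\<^sup>2)" using I by simp
  then show ?thesis using Xm by (simp add: L2_def)
qed

lemma integral_scaleR_component:
  fixes X :: "'a::euclidean_space \<Rightarrow> real^'n::finite"
  assumes \<Omega>: "\<Omega> \<in> sets lebesgue" and f: "f \<in> L2 \<Omega>" and X: "X \<in> L2 \<Omega>"
  shows "(\<integral>x. f x *\<^sub>R X x \<partial>lebesgue_on \<Omega>) $ i = (\<integral>x. f x * X x $ i \<partial>lebesgue_on \<Omega>)"
proof -
  have "(\<lambda>x. f x *\<^sub>R X x) = (\<lambda>x. \<Sum>i\<in>UNIV. (f x * X x $ i) *\<^sub>R axis i 1)"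
    using basis_expansion[of "f _ *\<^sub>R X _"] by (auto simp: scalar_mult_eq_scaleR fun_eq_iff)
  moreover have "integrable (lebesgue_on \<Omega>) (\<lambda>x. \<Sum>i\<in>UNIV. (f x * X x $ i) *\<^sub>R (axis i 1 :: real^'n))"
    by (intro Bochner_Integration.integrable_sum integrable_scaleR_left L2_integrable_mult_on \<Omega> f L2_component X)
  ultimately have "integrable (lebesgue_on \<Omega>) (\<lambda>x. f x *\<^sub>R X x)" by simp
  from integral_bounded_linear[OF bounded_linear_vec_nth this, of i] show ?thesis by simp
qed

lemma test_function_grad_L2:
  fixes \<phi> :: "real^'n::finite \<Rightarrow> real"
  assumes "\<Omega> \<in> sets lebesgue" "\<phi> \<in> test_functions \<Omega>" shows "grad \<phi> \<in> L2 \<Omega>"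
  using assms by (intro L2_of_components) (simp add: grad_def test_function_L2_on test_function_partial_deriv)

text \<open>Turns the vector identity into scalar identities between classes, the form in which the
  Hilbert space arguments apply.\<close>

lemma weak_gradient_components:
  assumes \<Omega>: "\<Omega> \<in> sets lebesgue"
  shows "weak_gradient \<Omega> w g \<longleftrightarrow> w \<in> L2 \<Omega> \<and> g \<in> L2 \<Omega> \<and>
    (\<forall>\<phi>\<in>test_functions \<Omega>. \<forall>i. cls (zext \<Omega> w) \<bullet> cls (partial_deriv i \<phi>) = - (cls (zext \<Omega> (\<lambda>x. g x $ i)) \<bullet> cls \<phi>))"
proof -
  have "(\<integral>x. w x *\<^sub>R grad \<phi> x \<partial>lebesgue_on \<Omega>) = - (\<integral>x. \<phi> x *\<^sub>R g x \<partial>lebesgue_on \<Omega>) \<longleftrightarrow>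
    (\<forall>i. cls (zext \<Omega> w) \<bullet> cls (partial_deriv i \<phi>) = - (cls (zext \<Omega> (\<lambda>x. g x $ i)) \<bullet> cls \<phi>))"
    if w: "w \<in> L2 \<Omega>" and g: "g \<in> L2 \<Omega>" and \<phi>: "\<phi> \<in> test_functions \<Omega>" for \<phi>
  proof -
    have "(\<integral>x. w x *\<^sub>R grad \<phi> x \<partial>lebesgue_on \<Omega>) $ i = cls (zext \<Omega> w) \<bullet> cls (partial_deriv i \<phi>)" for i
    proof -
      note \<phi>' = test_function_partial_deriv[OF \<phi>, of i]
      have "(\<integral>x. w x *\<^sub>R grad \<phi> x \<partial>lebesgue_on \<Omega>) $ i = (\<integral>x. w x * partial_deriv i \<phi> x \<partial>lebesgue_on \<Omega>)"
        unfolding integral_scaleR_component[OF \<Omega> w test_function_grad_L2[OF \<Omega> \<phi>]] by (simp add: grad_def)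
      also have "\<dots> = cls (zext \<Omega> w) \<bullet> cls (zext \<Omega> (partial_deriv i \<phi>))"
        by (rule integral_L2_inner[OF \<Omega> w test_function_L2_on[OF \<Omega> \<phi>']])
      finally show ?thesis by (simp add: zext_test_function[OF \<phi>'])
    qed
    moreover have "(\<integral>x. \<phi> x *\<^sub>R g x \<partial>lebesgue_on \<Omega>) $ i = cls (zext \<Omega> (\<lambda>x. g x $ i)) \<bullet> cls \<phi>" for i
    proof -
      have "(\<integral>x. \<phi> x *\<^sub>R g x \<partial>lebesgue_on \<Omega>) $ i = (\<integral>x. \<phi> x * g x $ i \<partial>lebesgue_on \<Omega>)"
        by (rule integral_scaleR_component[OF \<Omega> test_function_L2_on[OF \<Omega> \<phi>] g])
      also have "\<dots> = cls (zext \<Omega> \<phi>) \<bullet> cls (zext \<Omega> (\<lambda>x. g x $ i))"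
        by (rule integral_L2_inner[OF \<Omega> test_function_L2_on[OF \<Omega> \<phi>] L2_component[OF g]])
      finally show ?thesis by (simp add: zext_test_function[OF \<phi>] inner_commute)
    qed
    ultimately show ?thesis by (simp add: vec_eq_iff)
  qed
  then show ?thesis unfolding weak_gradient_def by blast
qed

section \<open>From classes back to the boundary value problem\<close>

context nonlocal_domain
begin

lemma H1_0_imp_H10:
  assumes w: "w \<in> H1_0 \<Omega>"
  shows "w \<in> L2 \<Omega> \<and> (\<exists>D. H10 (cls (zext \<Omega> w)) D)"
proof -
  note \<Omega> = dom_lebesgue
  obtain g \<phi> where wg: "weak_gradient \<Omega> w g" and \<phi>: "\<And>n::nat. \<phi> n \<in> test_functions \<Omega>"
    and lim: "(\<lambda>n. \<integral>x. (\<phi> n x - w x)\<^sup>2 + (norm (grad (\<phi> n) x - g x))\<^sup>2 \<partial>lebesgue_on \<Omega>) \<longlonglongrightarrow> 0"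
    using w unfolding H1_0_def by blast
  define D where "D i = cls (zext \<Omega> (\<lambda>x. g x $ i))" for i
  have wL: "w \<in> L2 \<Omega>" and gL: "g \<in> L2 \<Omega>"
    and ibp: "\<And>\<phi> i. \<phi> \<in> test_functions \<Omega> \<Longrightarrow> cls (zext \<Omega> w) \<bullet> cls (partial_deriv i \<phi>) = - (D i \<bullet> cls \<phi>)"
    using wg unfolding weak_gradient_components[OF \<Omega>] D_def by blast+
  have dist: "(norm (cls (\<psi>) - cls (zext \<Omega> v)))\<^sup>2 = (\<integral>x. (\<psi> x - v x)\<^sup>2 \<partial>lebesgue_on \<Omega>)
      \<and> integrable (lebesgue_on \<Omega>) (\<lambda>x. (\<psi> x - v x)\<^sup>2)"
    if \<psi>: "\<psi> \<in> test_functions \<Omega>" and v: "v \<in> L2 \<Omega>" for \<psi> v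
  proof -
    have L: "\<psi> \<in> L2 UNIV" "zext \<Omega> v \<in> L2 UNIV" by (rule test_function_L2[OF \<psi>], rule L2_zext[OF \<Omega> v])
    have eq: "zext \<Omega> (\<lambda>x. \<psi> x - v x) = (\<lambda>x. \<psi> x - zext \<Omega> v x)"
      using fun_cong[OF zext_test_function[OF \<psi>]] by (auto simp: zext_def right_diff_distrib fun_eq_iff)
    then have d: "(\<lambda>x. \<psi> x - v x) \<in> L2 \<Omega>"
      using L2_diff[OF L] by (intro L2_zextD[OF \<Omega>]) simp
    have "(norm (cls \<psi> - cls (zext \<Omega> v)))\<^sup>2 = cls (zext \<Omega> (\<lambda>x. \<psi> x - v x)) \<bullet> cls (zext \<Omega> (\<lambda>x. \<psi> x - v x))"
      unfolding eq by (simp add: cls_diff[OF L] power2_norm_eq_inner)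
    also have "\<dots> = (\<integral>x. (\<psi> x - v x)\<^sup>2 \<partial>lebesgue_on \<Omega>)"
      unfolding integral_L2_inner[OF \<Omega> d d, symmetric] by (simp add: power2_eq_square)
    finally show ?thesis using L2_integrable_mult_on[OF \<Omega> d d] by (simp add: power2_eq_square)
  qed
  have sum: "(norm (cls (\<phi> n) - cls (zext \<Omega> w)))\<^sup>2 + (\<Sum>i\<in>UNIV. (norm (cls (partial_deriv i (\<phi> n)) - D i))\<^sup>2)
    = (\<integral>x. (\<phi> n x - w x)\<^sup>2 + (norm (grad (\<phi> n) x - g x))\<^sup>2 \<partial>lebesgue_on \<Omega>)" for n
  proof -
    note d0 = dist[OF \<phi>[of n] wL] and di = dist[OF test_function_partial_deriv[OF \<phi>[of n]] L2_component[OF gL]]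
    have "(\<integral>x. (\<phi> n x - w x)\<^sup>2 + (norm (grad (\<phi> n) x - g x))\<^sup>2 \<partial>lebesgue_on \<Omega>)
      = (\<integral>x. (\<phi> n x - w x)\<^sup>2 + (\<Sum>i\<in>UNIV. (partial_deriv i (\<phi> n) x - g x $ i)\<^sup>2) \<partial>lebesgue_on \<Omega>)"
      by (simp add: norm_vec_def L2_set_def sum_nonneg grad_def)
    also have "\<dots> = (\<integral>x. (\<phi> n x - w x)\<^sup>2 \<partial>lebesgue_on \<Omega>) + (\<Sum>i\<in>UNIV. (\<integral>x. (partial_deriv i (\<phi> n) x - g x $ i)\<^sup>2 \<partial>lebesgue_on \<Omega>))"
      using d0 di by (subst Bochner_Integration.integral_add) (auto intro!: Bochner_Integration.integral_sum)
    also have "\<dots> = (norm (cls (\<phi> n) - cls (zext \<Omega> w)))\<^sup>2 + (\<Sum>i\<in>UNIV. (norm (cls (partial_deriv i (\<phi> n)) - D i))\<^sup>2)"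
      using d0 di by (simp add: D_def)
    finally show ?thesis by simp
  qed
  \<comment> \<open>The squared distance in H1 is the sum of the squared distances of all
    components, so each component is squeezed to its limit.\<close>
  have lim': "(\<lambda>n. cls (f n)) \<longlonglongrightarrow> l" if le: "\<And>n. (norm (cls (f n) - l))\<^sup>2 \<le> (norm (cls (\<phi> n) - cls (zext \<Omega> w)))\<^sup>2 + (\<Sum>i\<in>UNIV. (norm (cls (partial_deriv i (\<phi> n)) - D i))\<^sup>2)"
    for f and l :: "(real^'n) l2"
  proof -
    have "(\<lambda>n. (norm (cls (f n) - l))\<^sup>2) \<longlonglongrightarrow> 0"
      by (rule tendsto_sandwich[OF _ _ tendsto_const lim]) (use le in \<open>auto simp: sum[symmetric]\<close>)
    then have "(\<lambda>n. sqrt ((norm (cls (f n) - l))\<^sup>2)) \<longlonglongrightarrow> sqrt 0" by (intro tendsto_intros)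
    then have "(\<lambda>n. cls (f n) - l) \<longlonglongrightarrow> 0" by (simp add: tendsto_norm_zero_iff)
    then show ?thesis by (simp add: LIM_zero_iff)
  qed
  have "(\<lambda>n. cls (\<phi> n)) \<longlonglongrightarrow> cls (zext \<Omega> w)"
    by (rule lim') (simp add: sum_nonneg)
  moreover have "(\<lambda>n. cls (partial_deriv i (\<phi> n))) \<longlonglongrightarrow> D i" for i
  proof (rule lim')
    fix n
    have "(norm (cls (partial_deriv i (\<phi> n)) - D i))\<^sup>2 \<le> (\<Sum>i\<in>UNIV. (norm (cls (partial_deriv i (\<phi> n)) - D i))\<^sup>2)"
      by (rule member_le_sum[of i UNIV "\<lambda>i. (norm (cls (partial_deriv i (\<phi> n)) - D i))\<^sup>2"]) auto
    then show "(norm (cls (partial_deriv i (\<phi> n)) - D i))\<^sup>2 \<le> (norm (cls (\<phi> n) - cls (zext \<Omega> w)))\<^sup>2 + (\<Sum>i\<in>UNIV. (norm (cls (partial_deriv i (\<phi> n)) - D i))\<^sup>2)"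
      using zero_le_power2[of "norm (cls (\<phi> n) - cls (zext \<Omega> w))"] by linarith
  qed
  ultimately have "H10 (cls (zext \<Omega> w)) D"
    unfolding H10_def using ibp \<phi> by blast
  then show ?thesis using wL by blast
qed

text \<open>One more integration by parts: the weak gradient identity applied to the test functions
  \<open>partial_deriv i \<phi>\<close> removes the gradient of \<open>w\<close> from the
  equation.\<close>

lemma Poisson_solution_laplace:
  assumes w: "weak_Poisson_Dirichlet_solution \<Omega> f w" and f: "f \<in> L2 \<Omega>" and \<phi>: "\<phi> \<in> test_functions \<Omega>"
  shows "cls (zext \<Omega> w) \<bullet> cls (laplace \<phi>) = cls (zext \<Omega> f) \<bullet> cls \<phi>"
proof -
  note \<Omega> = dom_lebesgue
  obtain g where wg: "weak_gradient \<Omega> w g"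
    and eq: "- (\<integral>x. g x \<bullet> grad \<phi> x \<partial>lebesgue_on \<Omega>) = (\<integral>x. f x * \<phi> x \<partial>lebesgue_on \<Omega>)"
    using w \<phi> unfolding weak_Poisson_Dirichlet_solution_def by blast
  define D where "D i = cls (zext \<Omega> (\<lambda>x. g x $ i))" for i
  have wL: "w \<in> L2 \<Omega>" and gL: "g \<in> L2 \<Omega>"
    and ibp: "\<And>\<phi> i. \<phi> \<in> test_functions \<Omega> \<Longrightarrow> cls (zext \<Omega> w) \<bullet> cls (partial_deriv i \<phi>) = - (D i \<bullet> cls \<phi>)"
    using wg unfolding weak_gradient_components[OF \<Omega>] D_def by blast+
  note d\<phi> = test_function_partial_deriv[OF \<phi>]
  have "(\<integral>x. g x \<bullet> grad \<phi> x \<partial>lebesgue_on \<Omega>) = (\<integral>x. (\<Sum>i\<in>UNIV. g x $ i * partial_deriv i \<phi> x) \<partial>lebesgue_on \<Omega>)"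
    by (simp add: inner_vec_def grad_def)
  also have "\<dots> = (\<Sum>i\<in>UNIV. (\<integral>x. g x $ i * partial_deriv i \<phi> x \<partial>lebesgue_on \<Omega>))"
    by (intro Bochner_Integration.integral_sum L2_integrable_mult_on \<Omega> L2_component gL test_function_L2_on d\<phi>)
  also have "\<dots> = (\<Sum>i\<in>UNIV. D i \<bullet> cls (partial_deriv i \<phi>))"
    by (intro sum.cong refl) (simp add: integral_L2_inner[OF \<Omega> L2_component[OF gL] test_function_L2_on[OF \<Omega> d\<phi>]] zext_test_function[OF d\<phi>] D_def)
  finally have "- (\<Sum>i\<in>UNIV. D i \<bullet> cls (partial_deriv i \<phi>)) = cls (zext \<Omega> f) \<bullet> cls \<phi>"
    using eq by (simp add: integral_L2_inner[OF \<Omega> f test_function_L2_on[OF \<Omega> \<phi>]] zext_test_function[OF \<phi>])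
  moreover have "cls (zext \<Omega> w) \<bullet> cls (laplace \<phi>) = - (\<Sum>i\<in>UNIV. D i \<bullet> cls (partial_deriv i \<phi>))"
    unfolding laplace_L2(2)[OF \<phi>] inner_sum_right sum_negf[symmetric]
    by (intro sum.cong refl) (rule ibp[OF d\<phi>])
  ultimately show ?thesis by simp
qed

lemma zext_UNIV: "zext UNIV f = f" by (simp add: zext_def fun_eq_iff)

lemma zext_fn_Res:
  assumes "Res \<Omega> v = v" shows "AE x in lebesgue. x \<notin> \<Omega> \<longrightarrow> fn v x = 0" "cls (zext \<Omega> (fn v)) = v"
proof -
  have "AE x in lebesgue. fn (cls (\<lambda>x. indicator \<Omega> x * fn v x)) x = indicator \<Omega> x * fn v x"
    by (rule fn_cls_AE[OF L2_indicator[OF dom_lebesgue fn_L2]])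
  moreover have "cls (\<lambda>x. indicator \<Omega> x * fn v x) = v" using assms by (simp add: Res_def)
  ultimately have "AE x in lebesgue. fn v x = indicator \<Omega> x * fn v x" by simp
  then show "AE x in lebesgue. x \<notin> \<Omega> \<longrightarrow> fn v x = 0"
    by eventually_elim (auto simp: indicator_def split: if_splits)
  show "cls (zext \<Omega> (fn v)) = v" using cls_zext(2)[OF dom_lebesgue fn_L2[of v]] assms by simp
qed

text \<open>The cluster point has a gradient on the whole space and vanishes outside \<Omega>;
  regularity of the domain places it in \<open>H1_0 \<Omega>\<close>. It solves the same very weak
  equation as \<open>w\<close>, so uniqueness applies.\<close>

lemma weak_cluster_Poisson:
  assumes reg: "zero_extension_regular \<Omega>" and w: "weak_Poisson_Dirichlet_solution \<Omega> f w" and f: "f \<in> L2 \<Omega>"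
    and G: "G \<noteq> bot" "G \<le> at_right 0"
    and weak: "\<And>g. ((\<lambda>\<delta>. V (cls (zext \<Omega> f)) \<delta> \<bullet> g) \<longlongrightarrow> v \<bullet> g) G"
  shows "v = cls (zext \<Omega> w)"
proof -
  have "\<exists>g. \<forall>i. \<forall>\<phi>\<in>test_functions UNIV. v \<bullet> cls (partial_deriv i \<phi>) = g i \<bullet> cls \<phi>"
    using weak_cluster_gradient[OF G weak] by (intro choice) blast
  then obtain g where g: "\<And>i \<phi>. \<phi> \<in> test_functions UNIV \<Longrightarrow> v \<bullet> cls (partial_deriv i \<phi>) = g i \<bullet> cls \<phi>" by blast
  \<comment> \<open>The minus sign turns the vectors representing the functionals into weak
    derivatives.\<close>
  define X where "X x = (\<chi> i. fn (- g i) x)" for x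
  have "X \<in> L2 UNIV" by (rule L2_of_components) (simp add: X_def)
  then have "weak_gradient UNIV (fn v) X"
    by (subst weak_gradient_components) (auto simp: zext_UNIV X_def g)
  then have "fn v \<in> H1 UNIV" by (auto simp: H1_def)
  moreover have R: "Res \<Omega> v = v" by (rule weak_cluster_Res[OF G weak])
  ultimately have "fn v \<in> H1_0 \<Omega>"
    using reg zext_fn_Res(1)[OF R] unfolding zero_extension_regular_def by blast
  then obtain D where D: "H10 v D" using H1_0_imp_H10 zext_fn_Res(2)[OF R] by metis
  obtain D' where D': "H10 (cls (zext \<Omega> w)) D'"
    using H1_0_imp_H10 w unfolding weak_Poisson_Dirichlet_solution_def by blast
  show ?thesis
  proof (rule H10_unique[OF D D'])
    fix \<phi> assume \<phi>: "\<phi> \<in> test_functions \<Omega>"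
    show "v \<bullet> cls (laplace \<phi>) = cls (zext \<Omega> w) \<bullet> cls (laplace \<phi>)"
      using weak_cluster_equation[OF G weak \<phi>] Poisson_solution_laplace[OF w f \<phi>] by simp
  qed
qed

text \<open>The kernel has mass one, so the term with \<open>u x\<close> leaves the integral and the
  equation can be solved for \<open>u x\<close> on \<open>D\<close>; off \<open>D\<close> the
  indicator supplies the value zero.\<close>

lemma nonlocal_Dirichlet_solution_fixed_point:
  assumes u: "nonlocal_Dirichlet_solution (normalizing_constant k J) J D \<delta> f u"
    and \<delta>: "0 < \<delta>" and D: "D \<in> sets lebesgue" "D \<subseteq> \<Omega>" and f: "f \<in> L2 \<Omega>"
  shows "u \<in> L2 UNIV" "cls u = Res D (Conv (K \<delta>) (cls u) - (\<delta>\<^sup>2 * m / 2) *\<^sub>R cls (zext \<Omega> f))"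
proof -
  show uL: "u \<in> L2 UNIV" using u by (simp add: nonlocal_Dirichlet_solution_def)
  have fL: "zext \<Omega> f \<in> L2 UNIV" by (rule L2_zext[OF dom_lebesgue f])
  have C: "normalizing_constant k J = 2 / m"
    by (simp add: normalizing_constant_def moment2_def)
  let ?c = "\<delta>\<^sup>2 * m / 2"
  define q where "q x = conv (K \<delta>) u x - ?c * zext \<Omega> f x" for x
  have qL: "q \<in> L2 UNIV" unfolding q_def[abs_def]
    by (intro L2_diff conv_L2 K_ckernel L2_cmult uL fL \<delta>)
  have int: "(\<integral>y. J ((x - y) /\<^sub>R \<delta>) * (u y - u x) \<partial>lebesgue) = \<delta> ^ CARD('n) * (conv (K \<delta>) u x - u x)" for x
  proof -
    have "(\<integral>y. J ((x - y) /\<^sub>R \<delta>) * (u y - u x) \<partial>lebesgue)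
      = (\<integral>y. \<delta> ^ CARD('n) * (K \<delta> (x - y) * u y) - \<delta> ^ CARD('n) * u x * K \<delta> (x - y) \<partial>lebesgue)"
      using \<delta> by (intro Bochner_Integration.integral_cong) (auto simp: rescale_def right_diff_distrib)
    also have "\<dots> = \<delta> ^ CARD('n) * conv (K \<delta>) u x - \<delta> ^ CARD('n) * u x * (\<integral>y. K \<delta> (x - y) \<partial>lebesgue)"
      unfolding conv_def
      using conv_integrable[OF K_ckernel[OF \<delta>] uL, of x] ckernel_integrable[OF ckernel_reflect[OF K_ckernel[OF \<delta>]], of x]
      by simp
    also have "(\<integral>y. K \<delta> (x - y) \<partial>lebesgue) = 1"
      using integral_lebesgue_reflect[OF ckernel_borel[OF K_ckernel[OF \<delta>]], of x] K_1[OF \<delta>] by simp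
    finally show ?thesis by (simp add: algebra_simps)
  qed
  have "AE x in lebesgue. x \<in> D \<longrightarrow> f x = (2 / m) / \<delta> ^ (CARD('n) + 2) * (\<delta> ^ CARD('n) * (conv (K \<delta>) u x - u x))"
    and "AE x in lebesgue. x \<notin> D \<longrightarrow> u x = 0"
    using u unfolding nonlocal_Dirichlet_solution_def C int by blast+
  then have "AE x in lebesgue. u x = indicator D x * q x"
  proof eventually_elim
    case (elim x)
    show ?case
    proof (cases "x \<in> D")
      case True
      have "f x = (2 / m) / \<delta> ^ (CARD('n) + 2) * (\<delta> ^ CARD('n) * (conv (K \<delta>) u x - u x))"
        using elim True by blast
      also have "\<dots> = (conv (K \<delta>) u x - u x) / ?c"
        using \<delta> by (simp add: power_add power2_eq_square mult.commute)
      finally have cf: "?c * f x = conv (K \<delta>) u x - u x" using \<delta> m_pos by simp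
      have "zext \<Omega> f x = f x" using True D by (auto simp: zext_def)
      then have "u x = q x" unfolding q_def using cf by (simp only:)
      then show ?thesis using True by simp
    qed (use elim in simp)
  qed
  then have "cls u = cls (\<lambda>x. indicator D x * q x)"
    by (subst cls_eq_iff) (auto intro: uL L2_indicator D qL)
  also have "\<dots> = Res D (cls q)" by (rule Res_cls[OF D(1) qL, symmetric])
  also have "cls q = Conv (K \<delta>) (cls u) - ?c *\<^sub>R cls (zext \<Omega> f)"
    unfolding q_def[abs_def]
    by (simp only: cls_diff[OF conv_L2[OF K_ckernel[OF \<delta>] uL] L2_cmult[OF fL]] cls_cmult[OF fL] Conv_cls[OF K_ckernel[OF \<delta>] uL])
  finally show "cls u = Res D (Conv (K \<delta>) (cls u) - (\<delta>\<^sup>2 * m / 2) *\<^sub>R cls (zext \<Omega> f))" .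
qed

lemma perforation_weak_limit:
  assumes u: "\<And>\<epsilon>. 0 < \<epsilon> \<Longrightarrow> \<epsilon> \<le> 1 \<Longrightarrow>
      nonlocal_Dirichlet_solution (normalizing_constant k J) J (perforated_domain \<Omega> \<epsilon> (r \<epsilon>)) \<delta> f (u \<epsilon>)"
    and \<delta>: "0 < \<delta>" and f: "f \<in> L2 \<Omega>"
    and r: "\<forall>\<^sub>F \<epsilon> in at_right 0. 0 \<le> r \<epsilon> \<and> r \<epsilon> < \<epsilon>" and s: "((\<lambda>\<epsilon>. r \<epsilon> / \<epsilon>) \<longlongrightarrow> s) (at_right 0)"
    and \<theta>: "\<theta> = 1 - unit_ball_vol CARD('n) / 2 ^ CARD('n) * s ^ CARD('n)" "0 \<le> \<theta>" "\<theta> \<le> 1"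
  shows "weakly_tendsto_L2 \<Omega> u (fn (nonlocal_limit \<theta> \<delta> (cls (zext \<Omega> f)))) (at_right 0)"
proof (rule weakly_tendsto_L2I[OF dom_lebesgue])
  let ?S = "\<lambda>\<epsilon>. perforated_domain \<Omega> \<epsilon> (r \<epsilon>)"
  let ?v = "nonlocal_limit \<theta> \<delta> (cls (zext \<Omega> f))"
  have S: "?S \<epsilon> \<in> sets lebesgue" "?S \<epsilon> \<subseteq> \<Omega>" for \<epsilon>
    using perforated_domain_lebesgue[OF open_dom] by (auto simp: perforated_domain_def)
  have small: "\<forall>\<^sub>F \<epsilon> in at_right 0. \<epsilon> \<in> {0<..<1::real}" by (intro eventually_at_right_real) simp
  show "\<forall>\<^sub>F \<epsilon> in at_right 0. u \<epsilon> \<in> L2 UNIV"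
    using small by eventually_elim (rule nonlocal_Dirichlet_solution_fixed_point(1)[OF u \<delta> S f], auto)
  have fixed: "\<forall>\<^sub>F \<epsilon> in at_right 0. cls (u \<epsilon>) = Res (?S \<epsilon>) (Conv (K \<delta>) (cls (u \<epsilon>)) - (\<delta>\<^sup>2 * m / 2) *\<^sub>R cls (zext \<Omega> f))"
    using small by eventually_elim (rule nonlocal_Dirichlet_solution_fixed_point(2)[OF u \<delta> S f], auto)
  have v: "?v = \<theta> *\<^sub>R Res \<Omega> (Conv (K \<delta>) ?v - (\<delta>\<^sup>2 * m / 2) *\<^sub>R cls (zext \<Omega> f))"
    by (rule nonlocal_limit[OF \<delta> \<theta>(2,3)])
  show "fn ?v \<in> L2 \<Omega>" by (rule L2_UNIV_imp_L2[OF dom_lebesgue fn_L2])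
  have "Res \<Omega> (\<theta> *\<^sub>R Res \<Omega> q) = \<theta> *\<^sub>R Res \<Omega> q" for q
    by (simp add: linear_cmul[OF Res_linear[OF dom_lebesgue]] Res_Res[OF dom_lebesgue dom_lebesgue])
  from this[of "Conv (K \<delta>) ?v - (\<delta>\<^sup>2 * m / 2) *\<^sub>R cls (zext \<Omega> f)"] have "Res \<Omega> ?v = ?v"
    by (simp only: v[symmetric])
  then have cv: "cls (zext \<Omega> (fn ?v)) = ?v" by (rule zext_fn_Res(2))
  have weak: "((\<lambda>\<epsilon>. Res (?S \<epsilon>) q \<bullet> g) \<longlongrightarrow> \<theta> * (Res \<Omega> q \<bullet> g)) (at_right 0)" for q g
    unfolding Res_inner[OF S(1)] Res_inner[OF dom_lebesgue] \<theta>(1)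
    by (rule perforated_weak_limit[OF open_dom _ r s]) (intro L2_integrable_mult fn_L2)
  have "1 - \<delta>\<^sup>2 * gap \<delta> < 1" using gap_pos \<delta> by simp
  then show "((\<lambda>\<epsilon>. cls (u \<epsilon>) \<bullet> g) \<longlongrightarrow> cls (zext \<Omega> (fn ?v)) \<bullet> g) (at_right 0)" for g
    unfolding cv
    by (rule perforation_limit[OF K_ckernel[OF \<delta>] dom_lmeasurable _ poincare[OF \<delta>] S weak fixed v])
qed

end

theorem theorem5p2:
  fixes \<Omega> :: "(real^'n::finite) set"
    and k :: 'n
    and J f w :: "real^'n \<Rightarrow> real"
    and r b :: "real \<Rightarrow> real"
    and C0 :: real
    and u :: "real \<Rightarrow> real \<Rightarrow> real^'n \<Rightarrow> real"
  assumes domain: "open \<Omega>" "bounded \<Omega>" "connected \<Omega>" "\<Omega> \<noteq> {}"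
    and kernel: "admissible_kernel J"
    and radius: "\<And>\<epsilon>. 0 < \<epsilon> \<Longrightarrow> \<epsilon> \<le> 1 \<Longrightarrow> 0 < r \<epsilon> \<and> r \<epsilon> < \<epsilon>"
    and f: "f \<in> L2 \<Omega>"
    and u: "\<And>\<epsilon> \<delta>. 0 < \<epsilon> \<Longrightarrow> \<epsilon> \<le> 1 \<Longrightarrow> 0 < \<delta> \<Longrightarrow>
      nonlocal_Dirichlet_solution (normalizing_constant k J) J
        (perforated_domain \<Omega> \<epsilon> (r \<epsilon>)) \<delta> f (u \<epsilon> \<delta>)"
    and C0: "0 < C0"
    and b: "\<And>\<epsilon>. b \<epsilon> = C0 * \<epsilon>"
    and w: "((\<lambda>\<epsilon>. r \<epsilon> / b \<epsilon>) \<longlongrightarrow> 0) (at_right 0) \<and> weak_Poisson_Dirichlet_solution \<Omega> f w \<or>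
      (\<forall>\<epsilon>. 0 < \<epsilon> \<and> \<epsilon> \<le> 1 \<longrightarrow> r \<epsilon> = b \<epsilon>) \<and> (AE x in lebesgue_on \<Omega>. w x = 0)"
    and regular: "((\<lambda>\<epsilon>. r \<epsilon> / b \<epsilon>) \<longlongrightarrow> 0) (at_right 0) \<Longrightarrow> zero_extension_regular \<Omega>"
  shows "\<exists>v :: real \<Rightarrow> real^'n \<Rightarrow> real.
      (\<forall>\<delta>>0. weakly_tendsto_L2 \<Omega> (\<lambda>\<epsilon>. u \<epsilon> \<delta>) (v \<delta>) (at_right 0)) \<and>
      weakly_tendsto_L2 \<Omega> v w (at_right 0)"
proof -
  interpret nonlocal_domain J k \<Omega> by unfold_locales (fact kernel domain)+
  note \<Omega> = dom_lebesgue
  \<comment> \<open>Volume fraction of the unit ball in its circumscribed cube; balls of radius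
    \<open>s * \<epsilon>\<close> fill the fraction \<open>c * s ^ CARD('n)\<close> of each
    cell.\<close>
  define c where "c = unit_ball_vol CARD('n) / 2 ^ CARD('n)"
  have c: "0 < c" "c \<le> 1" using unit_ball_vol_le[where 'n = 'n] by (auto simp: c_def)
  have small: "\<forall>\<^sub>F \<epsilon> in at_right 0. \<epsilon> \<in> {0<..<1::real}" by (intro eventually_at_right_real) simp
  have r: "\<forall>\<^sub>F \<epsilon> in at_right 0. 0 \<le> r \<epsilon> \<and> r \<epsilon> < \<epsilon>"
    using small by eventually_elim (use radius in \<open>auto intro: less_imp_le\<close>)
  let ?f = "cls (zext \<Omega> f)"
  from w show ?thesis
  proof (elim disjE conjE)
    assume lim: "((\<lambda>\<epsilon>. r \<epsilon> / b \<epsilon>) \<longlongrightarrow> 0) (at_right 0)" and sol: "weak_Poisson_Dirichlet_solution \<Omega> f w"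
    \<comment> \<open>The density of the holes depends on \<open>r \<epsilon> / \<epsilon>\<close>,
      which is \<open>C0\<close> times the given ratio and tends to 0; hence the volume fraction is
      1.\<close>
    have "((\<lambda>\<epsilon>. C0 * (r \<epsilon> / b \<epsilon>)) \<longlongrightarrow> C0 * 0) (at_right 0)" by (intro tendsto_intros lim)
    then have s: "((\<lambda>\<epsilon>. r \<epsilon> / \<epsilon>) \<longlongrightarrow> 0) (at_right 0)" using C0 by (simp add: b)
    show ?thesis
    proof (intro exI conjI allI impI)
      show "weakly_tendsto_L2 \<Omega> (\<lambda>\<epsilon>. u \<epsilon> \<delta>) (fn (nonlocal_limit 1 \<delta> ?f)) (at_right 0)" if "0 < \<delta>" for \<delta>
        by (rule perforation_weak_limit[OF u that f r s]) (use that in auto)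
      show "weakly_tendsto_L2 \<Omega> (\<lambda>\<delta>. fn (nonlocal_limit 1 \<delta> ?f)) w (at_right 0)"
      proof (rule weakly_tendsto_L2I[OF \<Omega>])
        show "w \<in> L2 \<Omega>" using sol H1_0_imp_H10 unfolding weak_Poisson_Dirichlet_solution_def by blast
        \<comment> \<open>The uniform bound reduces weak convergence to identifying cluster
          points.\<close>
        show "((\<lambda>\<delta>. cls (fn (nonlocal_limit 1 \<delta> ?f)) \<bullet> g) \<longlongrightarrow> cls (zext \<Omega> w) \<bullet> g) (at_right 0)" for g
          unfolding cls_fn
          by (rule tendsto_of_weak_cluster_points[OF V_bound_eventually])
            (rule weak_cluster_Poisson[OF regular[OF lim] sol f])
      qed simp
    qed
  next
    assume eq: "\<forall>\<epsilon>. 0 < \<epsilon> \<and> \<epsilon> \<le> 1 \<longrightarrow> r \<epsilon> = b \<epsilon>" and w0: "AE x in lebesgue_on \<Omega>. w x = 0"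
    \<comment> \<open>The radius condition evaluated at \<open>\<epsilon> = 1\<close>.\<close>
    have "C0 < 1" using radius[of 1] eq b by simp
    \<comment> \<open>Volume fraction left by the holes; it is below 1 since \<open>c\<close> and
      \<open>C0\<close> are positive, so the inner limits even vanish in norm.\<close>
    define \<theta> where "\<theta> = 1 - c * C0 ^ CARD('n)"
    have \<theta>: "0 \<le> \<theta>" "\<theta> < 1"
    proof -
      have "c * C0 ^ CARD('n) \<le> 1 * 1"
        using c C0 \<open>C0 < 1\<close> by (intro mult_mono power_le_one) auto
      then show "0 \<le> \<theta>" by (simp add: \<theta>_def)
      show "\<theta> < 1" using c C0 by (simp add: \<theta>_def)
    qed
    have s: "((\<lambda>\<epsilon>. r \<epsilon> / \<epsilon>) \<longlongrightarrow> C0) (at_right 0)"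
      by (rule tendsto_eventually) (use small in \<open>eventually_elim, use eq b in auto\<close>)
    have "AE x in lebesgue. zext \<Omega> w x = 0"
      using w0 \<Omega> by (auto simp: AE_restrict_space_iff zext_def indicator_def elim!: eventually_mono)
    then have zw: "zext \<Omega> w \<in> L2 UNIV" "cls (zext \<Omega> w) = 0"
      using L2_cong_AE[OF L2_zero, of "zext \<Omega> w"] cls_eq_iff[of "zext \<Omega> w" "\<lambda>x. 0"] by simp_all
    show ?thesis
    proof (intro exI conjI allI impI)
      show "weakly_tendsto_L2 \<Omega> (\<lambda>\<epsilon>. u \<epsilon> \<delta>) (fn (nonlocal_limit \<theta> \<delta> ?f)) (at_right 0)" if "0 < \<delta>" for \<delta>
        by (rule perforation_weak_limit[OF u that f r s]) (use that \<theta> in \<open>auto simp: \<theta>_def c_def\<close>)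
      show "weakly_tendsto_L2 \<Omega> (\<lambda>\<delta>. fn (nonlocal_limit \<theta> \<delta> ?f)) w (at_right 0)"
      proof (rule weakly_tendsto_L2I[OF \<Omega>])
        show "w \<in> L2 \<Omega>" by (rule L2_zextD[OF \<Omega> zw(1)])
        show "((\<lambda>\<delta>. cls (fn (nonlocal_limit \<theta> \<delta> ?f)) \<bullet> g) \<longlongrightarrow> cls (zext \<Omega> w) \<bullet> g) (at_right 0)" for g
          unfolding cls_fn zw(2) by (intro tendsto_inner nonlocal_limit_vanishes[OF \<theta>] tendsto_const)
      qed simp
    qed
  qed
qed

end
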